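(* For every $\epsilon<1$, the following problem is NP-complete: given a directed $k$-linkage problem instance $(G,S,T)$ (with $k$ part of the input), decide whether it is half-integrally feasible. This remains NP-complete even when restricted to instances in which $G$ is strongly $\epsilon k$-connected.
   Context: A separation in a directed graph $G$ is a pair $(A,B)$ with $A,B\subseteq V(G)$, $A\cup B=V(G)$, and no edge $(u,v)$ with $u\in A\setminus B$ and $v\in B\setminus A$; its order is $|A\cap B|$; it is trivial if $A\subseteq B$ or $B\subseteq A$. $G$ is strongly $m$-connected if $|V(G)|\ge m+1$ and $G$ has no nontrivial separation of order less than $m$. An instance of a directed $k$-linkage problem is a tuple $(G,S,T)$ where $G$ is a directed graph and $S=(s_1,\dots,s_k)$, $T=(t_1,\dots,t_k)$ are ordered sets of $k$ distinct vertices of $G$ each. It is half-integrally feasible if there are directed paths $P_1,\dots,P_k$, $P_i$ from $s_i$ to $t_i$, such that every vertex of $G$ lies in at most two distinct paths $P_i$. *)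

theory Defs
  imports Complex_Main "HOL-Computational_Algebra.Polynomial" "Graph_Theory.Pair_Digraph"
begin

section \<open>Multi-tape Turing machines\<close>

text \<open>
  Machines are deterministic and have a fixed number of two-way infinite tapes. States and tape
  symbols are initial segments of the natural numbers; only the restriction of the transition
  function to this finite domain matters (see \<open>wf_tm\<close>). The start state is 0, the blank symbol
  is 0, and the bits of input and output strings are written as 1 (False) and 2 (True).
\<close>

datatype move = Go_Left | Stay | Go_Right

record tm =
  tm_tapes :: nat
  tm_states :: nat
  tm_symbols :: nat
  tm_halt :: nat
  tm_trans :: "nat \<Rightarrow> nat list \<Rightarrow> nat \<times> (nat \<times> move) list"

definition wf_tm :: "tm \<Rightarrow> bool" where
  "wf_tm M \<longleftrightarrow>
     1 \<le> tm_tapes M \<and> 0 < tm_states M \<and> tm_halt M < tm_states M \<and> 3 \<le> tm_symbols M \<and>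
     (\<forall>q < tm_states M. \<forall>ss. length ss = tm_tapes M \<longrightarrow> set ss \<subseteq> {..<tm_symbols M} \<longrightarrow>
        fst (tm_trans M q ss) < tm_states M \<and>
        length (snd (tm_trans M q ss)) = tm_tapes M \<and>
        fst ` set (snd (tm_trans M q ss)) \<subseteq> {..<tm_symbols M})"

text \<open>A tape is its contents together with the position of its head.\<close>
type_synonym tape = "(int \<Rightarrow> nat) \<times> int"
type_synonym config = "nat \<times> tape list"

fun move_pos :: "move \<Rightarrow> int \<Rightarrow> int" where
  "move_pos Go_Left i = i - 1"
| "move_pos Stay i = i"
| "move_pos Go_Right i = i + 1"

definition tape_read :: "tape \<Rightarrow> nat" where
  "tape_read tp = fst tp (snd tp)"

definition tape_act :: "nat \<times> move \<Rightarrow> tape \<Rightarrow> tape" where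
  "tape_act a tp = ((fst tp)(snd tp := fst a), move_pos (snd a) (snd tp))"

definition tm_step :: "tm \<Rightarrow> config \<Rightarrow> config" where
  "tm_step M cfg =
     (if fst cfg = tm_halt M then cfg
      else let (q, as) = tm_trans M (fst cfg) (map tape_read (snd cfg))
           in (q, map2 tape_act as (snd cfg)))"

definition bit_symbol :: "bool \<Rightarrow> nat" where
  "bit_symbol b = (if b then 2 else 1)"

definition string_contents :: "bool list \<Rightarrow> int \<Rightarrow> nat" where
  "string_contents w i =
     (if 0 \<le> i \<and> nat i < length w then bit_symbol (w ! nat i) else 0)"

text \<open>The input strings are written on the first tapes; all other tapes are blank.\<close>
definition tm_init :: "tm \<Rightarrow> bool list list \<Rightarrow> config" where
  "tm_init M xs =
     (0, map (\<lambda>j. (string_contents (if j < length xs then xs ! j else []), 0)) [0..<tm_tapes M])"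

text \<open>
  The output is the string on the last tape. A halted configuration is a fixed point of
  \<open>tm_step\<close>, so being halted after \<open>t\<close> steps means having halted within \<open>t\<close> steps.
\<close>
definition tm_outputs :: "tm \<Rightarrow> bool list list \<Rightarrow> nat \<Rightarrow> bool list \<Rightarrow> bool" where
  "tm_outputs M xs t w \<longleftrightarrow>
     (let cfg = (tm_step M ^^ t) (tm_init M xs)
      in fst cfg = tm_halt M \<and> fst (last (snd cfg)) = string_contents w)"

section \<open>NP-completeness\<close>

definition polytime_computable :: "(bool list \<Rightarrow> bool list) \<Rightarrow> bool" where
  "polytime_computable f \<longleftrightarrow>
     (\<exists>M (p :: nat poly). wf_tm M \<and> (\<forall>x. tm_outputs M [x] (poly p (length x)) (f x)))"

text \<open>
  NP is the class of languages with polynomial-time verifiers: \<open>M\<close> receives the input \<open>x\<close> and a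
  certificate \<open>u\<close> of length at most \<open>p(|x|)\<close> on two separate tapes and answers with a single bit
  within \<open>q(|x|)\<close> steps.
\<close>
definition NP :: "bool list set set" where
  "NP = {L. \<exists>M (p :: nat poly) (q :: nat poly).
     wf_tm M \<and> 2 \<le> tm_tapes M \<and>
     (\<forall>x u. length u \<le> poly p (length x) \<longrightarrow>
        (\<exists>b. tm_outputs M [x, u] (poly q (length x)) [b])) \<and>
     (\<forall>x. x \<in> L \<longleftrightarrow>
        (\<exists>u. length u \<le> poly p (length x) \<and> tm_outputs M [x, u] (poly q (length x)) [True]))}"

definition NP_complete :: "bool list set \<Rightarrow> bool" where
  "NP_complete L \<longleftrightarrow>
     L \<in> NP \<and>
     (\<forall>A \<in> NP. \<exists>f. polytime_computable f \<and> (\<forall>x. x \<in> A \<longleftrightarrow> f x \<in> L))"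

text \<open>
  NP-completeness of the decision problem \<open>L\<close> restricted to the inputs in \<open>I\<close>, i.e. of the
  promise problem with yes-instances \<open>I \<inter> L\<close> and no-instances \<open>I - L\<close>: some NP language agrees
  with \<open>L\<close> on \<open>I\<close>, and every NP language reduces to \<open>L\<close> by a polynomial-time reduction producing
  only inputs in \<open>I\<close>. Recognising membership in \<open>I\<close> is not part of the problem.
\<close>
definition NP_complete_restricted :: "bool list set \<Rightarrow> bool list set \<Rightarrow> bool" where
  "NP_complete_restricted I L \<longleftrightarrow>
     (\<exists>A \<in> NP. A \<inter> I = L \<inter> I) \<and>
     (\<forall>A \<in> NP. \<exists>f. polytime_computable f \<and> (\<forall>x. f x \<in> I \<and> (x \<in> A \<longleftrightarrow> f x \<in> L)))"

lemma NP_complete_restricted_UNIV: "NP_complete_restricted UNIV L \<longleftrightarrow> NP_complete L"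
  by (auto simp: NP_complete_restricted_def NP_complete_def)

section \<open>Connectivity of digraphs and directed linkages\<close>

definition separation :: "'a pair_pre_digraph \<Rightarrow> 'a set \<Rightarrow> 'a set \<Rightarrow> bool" where
  "separation G A B \<longleftrightarrow>
     A \<subseteq> pverts G \<and> B \<subseteq> pverts G \<and> A \<union> B = pverts G \<and>
     \<not> (\<exists>u v. (u, v) \<in> parcs G \<and> u \<in> A - B \<and> v \<in> B - A)"

definition separation_order :: "'a set \<Rightarrow> 'a set \<Rightarrow> nat" where
  "separation_order A B = card (A \<inter> B)"

definition trivial_separation :: "'a set \<Rightarrow> 'a set \<Rightarrow> bool" where
  "trivial_separation A B \<longleftrightarrow> A \<subseteq> B \<or> B \<subseteq> A"

text \<open>
  The parameter is real because it is instantiated with \<open>\<epsilon> k\<close>; for finite digraphs, being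
  strongly \<open>m\<close>-connected is the same as being strongly \<open>\<lceil>m\<rceil>\<close>-connected.
\<close>
definition strongly_m_connected :: "real \<Rightarrow> 'a pair_pre_digraph \<Rightarrow> bool" where
  "strongly_m_connected m G \<longleftrightarrow>
     real (card (pverts G)) \<ge> m + 1 \<and>
     \<not> (\<exists>A B. separation G A B \<and> \<not> trivial_separation A B \<and> real (separation_order A B) < m)"

text \<open>
  The locale \<open>pair_digraph\<close> describes finite digraphs without loops and parallel arcs; antiparallel
  arcs are allowed. The sets of sources and targets may intersect.
\<close>
definition linkage_instance :: "'a pair_pre_digraph \<Rightarrow> 'a list \<Rightarrow> 'a list \<Rightarrow> bool" where
  "linkage_instance G S T \<longleftrightarrow>
     pair_digraph G \<and> length S = length T \<and>
     distinct S \<and> set S \<subseteq> pverts G \<and> distinct T \<and> set T \<subseteq> pverts G"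

text \<open>
  As the sources are distinct, so are the paths; hence counting paths through a vertex is the same
  as counting their indices.
\<close>
definition half_integrally_feasible :: "'a pair_pre_digraph \<Rightarrow> 'a list \<Rightarrow> 'a list \<Rightarrow> bool" where
  "half_integrally_feasible G S T \<longleftrightarrow>
     (\<exists>P :: nat \<Rightarrow> ('a \<times> 'a) awalk.
        (\<forall>i < length S. pre_digraph.apath (with_proj G) (S ! i) (P i) (T ! i)) \<and>
        (\<forall>v \<in> pverts G.
           card {i. i < length S \<and>
             v \<in> set (pre_digraph.awalk_verts (with_proj G) (S ! i) (P i))} \<le> 2))"

section \<open>The decision problem\<close>

definition encode_nat :: "nat \<Rightarrow> bool list" where
  "encode_nat n = replicate n True @ [False]"

text \<open>
  An instance on the vertex set \<open>{..<n}\<close> is encoded by \<open>n\<close>, the \<open>n \<times> n\<close> adjacency matrix, \<open>k\<close>, and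
  the lists of sources and targets. Numbers are written in unary, which is harmless since none of
  them exceeds the number of vertices.
\<close>
definition encode_instance :: "nat pair_pre_digraph \<Rightarrow> nat list \<Rightarrow> nat list \<Rightarrow> bool list" where
  "encode_instance G S T =
     (let n = card (pverts G) in
        encode_nat n @
        [(i, j) \<in> parcs G. i \<leftarrow> [0..<n], j \<leftarrow> [0..<n]] @
        encode_nat (length S) @ concat (map encode_nat S) @ concat (map encode_nat T))"

definition encoded_instance :: "nat pair_pre_digraph \<Rightarrow> nat list \<Rightarrow> nat list \<Rightarrow> bool" where
  "encoded_instance G S T \<longleftrightarrow> linkage_instance G S T \<and> pverts G = {..<card (pverts G)}"

definition half_integral_linkage :: "bool list set" where
  "half_integral_linkage =
     {encode_instance G S T | G S T. encoded_instance G S T \<and> half_integrally_feasible G S T}"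

definition strongly_connected_instances :: "real \<Rightarrow> bool list set" where
  "strongly_connected_instances \<epsilon> =
     {encode_instance G S T | G S T.
        encoded_instance G S T \<and> strongly_m_connected (\<epsilon> * real (length S)) G}"

lemma encode_nat_append_eq_iff:
  "encode_nat m @ xs = encode_nat n @ ys \<longleftrightarrow> m = n \<and> xs = ys"
proof (induction m arbitrary: n)
  case 0
  then show ?case by (cases n) (auto simp: encode_nat_def)
next
  case (Suc m)
  then show ?case by (cases n) (auto simp: encode_nat_def)
qed

lemma encode_nats_append_eq:
  assumes "length S = length S'"
    and "concat (map encode_nat S) @ xs = concat (map encode_nat S') @ ys"
  shows "S = S' \<and> xs = ys"
  using assms by (induction S S' rule: list_induct2) (auto simp: encode_nat_append_eq_iff)

lemma concat_rows_eq:
  assumes "concat (map (\<lambda>i. map (f i) [0..<n]) is) @ xs =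
           concat (map (\<lambda>i. map (g i) [0..<n]) is) @ ys"
  shows "(\<forall>i \<in> set is. \<forall>j < n. f i j = g i j) \<and> xs = ys"
  using assms by (induction "is") (auto simp: map_eq_conv)

lemma encode_instance_inject:
  assumes I: "encoded_instance G S T" "encoded_instance G' S' T'"
    and eq: "encode_instance G S T = encode_instance G' S' T'"
  shows "G = G' \<and> S = S' \<and> T = T'"
proof -
  define n where "n = card (pverts G)"
  have n': "n = card (pverts G')"
    using eq by (auto simp: encode_instance_def Let_def encode_nat_append_eq_iff n_def)
  have eq2: "[(i, j) \<in> parcs G. i \<leftarrow> [0..<n], j \<leftarrow> [0..<n]] @
        encode_nat (length S) @ concat (map encode_nat S) @ concat (map encode_nat T) =
      [(i, j) \<in> parcs G'. i \<leftarrow> [0..<n], j \<leftarrow> [0..<n]] @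
        encode_nat (length S') @ concat (map encode_nat S') @ concat (map encode_nat T')"
    using eq unfolding encode_instance_def Let_def encode_nat_append_eq_iff
      n_def[symmetric] n'[symmetric] by simp
  from concat_rows_eq[OF eq2]
  have arcs: "\<forall>i<n. \<forall>j<n. (i, j) \<in> parcs G \<longleftrightarrow> (i, j) \<in> parcs G'"
    and eq3: "encode_nat (length S) @ concat (map encode_nat S) @ concat (map encode_nat T) =
      encode_nat (length S') @ concat (map encode_nat S') @ concat (map encode_nat T')"
    by auto
  have len: "length S = length S'"
    and eq4: "concat (map encode_nat S) @ concat (map encode_nat T) =
      concat (map encode_nat S') @ concat (map encode_nat T')"
    using eq3 by (auto simp: encode_nat_append_eq_iff)
  have S: "S = S'" and eq5: "concat (map encode_nat T) = concat (map encode_nat T')"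
    using encode_nats_append_eq[OF len eq4] by auto
  have "length T = length T'"
    using I len by (simp add: encoded_instance_def linkage_instance_def)
  then have T: "T = T'" using encode_nats_append_eq[of T T' "[]" "[]"] eq5 by simp
  have wf: "pair_wf_digraph G" "pair_wf_digraph G'"
    using I by (auto simp: encoded_instance_def linkage_instance_def pair_digraph_def
        pair_fin_digraph_def)
  have V: "pverts G = {..<n}" "pverts G' = {..<n}"
    using I n' by (auto simp: encoded_instance_def n_def)
  have "parcs G = parcs G'"
  proof (intro set_eqI iffI; clarify)
    fix i j assume "(i, j) \<in> parcs G"
    then show "(i, j) \<in> parcs G'"
      using arcs V pair_wf_digraph.wellformed'[OF wf(1)] by blast
  next
    fix i j assume "(i, j) \<in> parcs G'"
    then show "(i, j) \<in> parcs G"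
      using arcs V pair_wf_digraph.wellformed'[OF wf(2)] by blast
  qed
  with V S T show ?thesis by (simp add: pair_pre_digraph.equality)
qed

end

theory Submission
  imports Defs
begin

text \<open>
  Hardness: the computations of a verifier are described by a constraint satisfaction problem that
  forbids certain triples of values. A variable becomes a path that chooses a value and then
  passes through all occurrences of that value in the constraints, in the order of the constraints;
  a constraint becomes a path through one of its occurrences, which must not have been chosen. Each
  occurrence is its own source and target, so that it has room for only one of the other paths.
  Connectivity comes from \<open>m\<close> hubs joined to all vertices in both directions: any nontrivial
  separation contains them all. Demanding a path from each hub to the next one in cyclic order
  uses each hub twice, so no other path can pass through a hub. Since \<open>\<epsilon> < 1\<close>, the number of
  hubs exceeds \<open>\<epsilon> k\<close> if it is a large enough multiple of the number of the other demands.

  Machines: both the reduction and the verifier are terms in a small arithmetical language with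
  bounded sums, in which all numbers are polynomially bounded and hence can be held in unary
  counters. It is compiled to Turing machines whose counters are head positions.
\<close>

section \<open>Structured programs for multi-tape machines\<close>

text \<open>NP-completeness quantifies over all languages in \<open>NP\<close>, so the reduction has
  to start from an arbitrary verifier. Two choices keep the intermediate problem simple. A tableau
  records for each time a situation, that is, the state together with all symbols being read; then
  every rule relates at most three entries, and ternary constraints suffice. Moreover, every triple
  of literals gets a clause, vacuous unless the triple is forbidden; so all sizes are closed
  expressions in the length of the input, and only the arcs depend on its bits.

  The constant behind the number of hubs: if \<open>h\<close> counts the demands other than those of
  the hubs, then \<open>k = h + m\<close>, and \<open>\<epsilon> * k \<le> m\<close> means
  \<open>\<epsilon> * h \<le> (1 - \<epsilon>) * m\<close>. So it is enough that \<open>m\<close> is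
  at least \<open>h\<close> times \<open>\<epsilon> / (1 - \<epsilon>)\<close>. For
  \<open>\<epsilon> = 1\<close> no \<open>m\<close> would do, because \<open>h\<close> is
  positive.\<close>

type_synonym store = "nat \<Rightarrow> tape"

datatype com =
  Skip
| Act nat "nat option" move
| Seq com com (infixr ";;" 60)
| IfSym nat nat com com
| Loop nat nat com

definition act :: "nat option \<Rightarrow> move \<Rightarrow> nat \<Rightarrow> nat \<times> move" where
  "act w m a = ((case w of None \<Rightarrow> a | Some b \<Rightarrow> b), m)"

text \<open>The time counts the instructions of the compiled code: one for a test, and one more for
  the jump that ends a then-branch or a loop body.\<close>

inductive exec :: "com \<Rightarrow> store \<Rightarrow> nat \<Rightarrow> store \<Rightarrow> bool" where
  exec_Skip: "exec Skip s 0 s"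
| exec_Act: "exec (Act j w m) s 1 (s(j := tape_act (act w m (tape_read (s j))) (s j)))"
| exec_Seq: "exec c s n s' \<Longrightarrow> exec d s' n' s'' \<Longrightarrow> exec (c ;; d) s (n + n') s''"
| exec_IfT: "tape_read (s j) = a \<Longrightarrow> exec c s n s' \<Longrightarrow> exec (IfSym j a c d) s (n + 2) s'"
| exec_IfF: "tape_read (s j) \<noteq> a \<Longrightarrow> exec d s n s' \<Longrightarrow> exec (IfSym j a c d) s (n + 1) s'"
| exec_Stop: "tape_read (s j) = a \<Longrightarrow> exec (Loop j a c) s 1 s"
| exec_Step: "tape_read (s j) \<noteq> a \<Longrightarrow> exec c s n s' \<Longrightarrow> exec (Loop j a c) s' n' s'' \<Longrightarrow>
    exec (Loop j a c) s (1 + n + 1 + n') s''"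

text \<open>
  An instruction reads the symbol on one tape, and determines from it the symbol to be written,
  the move and the address of the next instruction.
\<close>
type_synonym instr = "nat \<times> (nat \<Rightarrow> (nat \<times> move) \<times> nat)"

section \<open>Compilation to code with jumps\<close>

fun csize :: "com \<Rightarrow> nat" where
  "csize Skip = 0"
| "csize (Act j w m) = 1"
| "csize (c ;; d) = csize c + csize d"
| "csize (IfSym j a c d) = csize c + csize d + 2"
| "csize (Loop j a c) = csize c + 2"

fun code :: "com \<Rightarrow> nat \<Rightarrow> instr list" where
  "code Skip l = []"
| "code (Act j w m) l = [(j, \<lambda>a. (act w m a, l + 1))]"
| "code (c ;; d) l = code c l @ code d (l + csize c)"
| "code (IfSym j a c d) l =
     (j, \<lambda>b. ((b, Stay), if b = a then l + 1 else l + csize c + 2)) # code c (l + 1) @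
     (j, \<lambda>b. ((b, Stay), l + csize c + 2 + csize d)) # code d (l + csize c + 2)"
| "code (Loop j a c) l =
     (j, \<lambda>b. ((b, Stay), if b = a then l + csize c + 2 else l + 1)) # code c (l + 1) @
     [(j, \<lambda>b. ((b, Stay), l))]"

lemma length_code [simp]: "length (code c l) = csize c"
  by (induction c arbitrary: l) auto

fun istep :: "instr list \<Rightarrow> nat \<times> store \<Rightarrow> nat \<times> store" where
  "istep P (pc, s) =
     (if pc < length P then
        let (j, f) = P ! pc; (a, q) = f (tape_read (s j)) in (q, s(j := tape_act a (s j)))
      else (pc, s))"

definition embedded :: "instr list \<Rightarrow> nat \<Rightarrow> instr list \<Rightarrow> bool" where
  "embedded P l C \<longleftrightarrow> l + length C \<le> length P \<and> (\<forall>i < length C. P ! (l + i) = C ! i)"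

lemma embedded_append:
  "embedded P l (C @ D) \<longleftrightarrow> embedded P l C \<and> embedded P (l + length C) D"
proof -
  have "(\<forall>i < length C + length D. P ! (l + i) = (C @ D) ! i) \<longleftrightarrow>
    (\<forall>i < length C. P ! (l + i) = C ! i) \<and> (\<forall>i < length D. P ! (l + length C + i) = D ! i)"
    (is "?L \<longleftrightarrow> ?R")
  proof
    assume L: ?L
    have "P ! (l + length C + i) = D ! i" if "i < length D" for i
      using L[rule_format, of "length C + i"] that by (simp add: add.assoc)
    moreover have "P ! (l + i) = C ! i" if "i < length C" for i
      using L[rule_format, of i] that by (simp add: nth_append)
    ultimately show ?R by blast
  next
    assume R: ?R
    show ?L
    proof (intro allI impI)
      fix i assume "i < length C + length D"
      then show "P ! (l + i) = (C @ D) ! i"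
        using R[THEN conjunct1, rule_format, of i] R[THEN conjunct2, rule_format, of "i - length C"]
        by (cases "i < length C") (auto simp: nth_append)
    qed
  qed
  then show ?thesis by (auto simp: embedded_def)
qed

lemma embedded_Cons:
  "embedded P l (x # D) \<longleftrightarrow> l < length P \<and> P ! l = x \<and> embedded P (Suc l) D"
  using embedded_append[of P l "[x]" D] by (auto simp: embedded_def)

lemma funpow_trans: "(f ^^ m) x = y \<Longrightarrow> (f ^^ n) y = z \<Longrightarrow> (f ^^ (m + n)) x = z"
  by (simp add: add.commute[of m n] funpow_add)

lemma tape_act_Stay [simp]: "tape_read t = a \<Longrightarrow> tape_act (a, Stay) t = t"
  by (auto simp: tape_act_def tape_read_def)

text \<open>Jump targets are absolute addresses, so the start address \<open>l\<close> varies in the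
  induction and has to be the place where the code is embedded. The step count is exact, which lets
  runs be composed by \<open>funpow_trans\<close>.\<close>

lemma exec_code:
  "exec c s n s' \<Longrightarrow> embedded P l (code c l) \<Longrightarrow>
    (istep P ^^ n) (l, s) = (l + csize c, s')"
proof (induction arbitrary: l rule: exec.induct)
  case (exec_Skip s)
  then show ?case by simp
next
  case (exec_Act j w m s)
  then show ?case by (simp add: embedded_Cons fun_upd_def)
next
  case (exec_Seq c s n s' d n' s'')
  then have e: "embedded P l (code c l)" "embedded P (l + csize c) (code d (l + csize c))"
    by (auto simp: embedded_append)
  show ?case
    using funpow_trans[OF exec_Seq.IH(1)[OF e(1)] exec_Seq.IH(2)[OF e(2)]] by (simp add: add.assoc)
next
  case (exec_IfT s j a c n s' d)
  then have e: "embedded P (l + 1) (code c (l + 1))" and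
    p: "l < length P" "P ! l = (j, \<lambda>b. ((b, Stay), if b = a then l + 1 else l + csize c + 2))"
       "l + 1 + csize c < length P" "P ! (l + 1 + csize c) = (j, \<lambda>b. ((b, Stay), l + csize c + 2 + csize d))"
    by (auto simp: embedded_append embedded_Cons)
  have 1: "(istep P ^^ 1) (l, s) = (l + 1, s)" using p exec_IfT by simp
  have 2: "(istep P ^^ 1) (l + 1 + csize c, s') = (l + csize c + 2 + csize d, s')" using p by simp
  show ?case using funpow_trans[OF 1 funpow_trans[OF exec_IfT.IH[OF e] 2]]
    by (simp add: algebra_simps)
next
  case (exec_IfF s j a d n s' c)
  then have e: "embedded P (l + csize c + 2) (code d (l + csize c + 2))" and
    p: "l < length P" "P ! l = (j, \<lambda>b. ((b, Stay), if b = a then l + 1 else l + csize c + 2))"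
    by (auto simp: embedded_append embedded_Cons)
  have 1: "(istep P ^^ 1) (l, s) = (l + csize c + 2, s)" using p exec_IfF by simp
  show ?case using funpow_trans[OF 1 exec_IfF.IH[OF e]] by (simp add: algebra_simps)
next
  case (exec_Stop s j a c)
  then show ?case by (simp add: embedded_Cons)
next
  case (exec_Step s j a c n s' n' s'')
  then have e: "embedded P (l + 1) (code c (l + 1))" and
    p: "l < length P" "P ! l = (j, \<lambda>b. ((b, Stay), if b = a then l + csize c + 2 else l + 1))"
       "l + 1 + csize c < length P" "P ! (l + 1 + csize c) = (j, \<lambda>b. ((b, Stay), l))"
    by (auto simp: embedded_append embedded_Cons)
  have 1: "(istep P ^^ 1) (l, s) = (l + 1, s)" using p exec_Step by simp
  have 2: "(istep P ^^ 1) (l + 1 + csize c, s') = (l, s')" using p by simp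
  show ?case
    using funpow_trans[OF 1 funpow_trans[OF exec_Step.IH(1)[OF e]
        funpow_trans[OF 2 exec_Step.IH(2)[OF exec_Step.prems]]]]
    by (simp add: algebra_simps)
qed

section \<open>From code to Turing machines\<close>

fun wfc :: "nat \<Rightarrow> com \<Rightarrow> bool" where
  "wfc K Skip = True"
| "wfc K (Act j w m) = (j < K \<and> (\<forall>b. w = Some b \<longrightarrow> b < 3))"
| "wfc K (c ;; d) = (wfc K c \<and> wfc K d)"
| "wfc K (IfSym j a c d) = (j < K \<and> wfc K c \<and> wfc K d)"
| "wfc K (Loop j a c) = (j < K \<and> wfc K c)"

lemma wfc_code:
  assumes "wfc K c" "(j, f) \<in> set (code c l)"
  shows "j < K" "a < 3 \<Longrightarrow> fst (fst (f a)) < 3" "snd (f a) \<le> l + csize c"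
  using assms by (induction c arbitrary: l) (force simp: act_def split: option.splits)+

text \<open>
  Program tape 0 is the output tape, which is the last tape of the machine; the program tapes
  1 and 2 hold the inputs, which are on the first tapes of the machine.
\<close>
definition to_config :: "nat \<Rightarrow> nat \<times> store \<Rightarrow> config" where
  "to_config K cs = (fst cs, map (\<lambda>i. snd cs (if i = K - 1 then 0 else i + 1)) [0..<K])"

text \<open>The states are the addresses of the code. The halting state is the address just behind
  it, where \<open>istep\<close> no longer moves either, so that the two step functions agree
  everywhere. Three symbols suffice because the mark of a counter is the symbol of a bit.\<close>

definition com_tm :: "nat \<Rightarrow> com \<Rightarrow> tm" where
  "com_tm K c = \<lparr>tm_tapes = K, tm_states = csize c + 1, tm_symbols = 3, tm_halt = csize c,
     tm_trans = \<lambda>q ss. if q < csize c then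
         let (j, f) = code c 0 ! q; t = (if j = 0 then K - 1 else j - 1); (a, q') = f (ss ! t)
         in (q', map (\<lambda>i. if i = t then a else (ss ! i, Stay)) [0..<K])
       else (q, map (\<lambda>a. (a, Stay)) ss)\<rparr>"

lemma com_tm_step:
  assumes "1 \<le> K" "wfc K c"
  shows "tm_step (com_tm K c) (to_config K cs) = to_config K (istep (code c 0) cs)"
proof (cases cs)
  case (Pair pc s)
  show ?thesis
  proof (cases "pc < csize c")
    case True
    obtain j f where jf: "code c 0 ! pc = (j, f)" by fastforce
    obtain a q where aq: "f (tape_read (s j)) = (a, q)" by fastforce
    define t where "t = (if j = 0 then K - 1 else j - 1)"
    have jK: "j < K" using wfc_code(1)[OF assms(2), of j f 0] jf True
      by (metis length_code nth_mem)
    have tK: "t < K" using jK by (auto simp: t_def)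
    \<comment> \<open>\<open>jt\<close> and \<open>tn\<close>: machine tape \<open>t\<close> is the
      only one that carries program tape \<open>j\<close>.\<close>
    have jt: "(if t = K - 1 then 0 else t + 1) = j" using jK by (auto simp: t_def)
    have tn: "i = t" if "i < K" "(if i = K - 1 then 0 else i + 1) = j" for i
      using that by (auto simp: t_def split: if_splits)
    define rs where "rs = map tape_read (snd (to_config K (pc, s)))"
    have rst: "rs ! t = tape_read (s j)"
      using tK jt by (auto simp: rs_def to_config_def)
    have rsi: "rs ! i = tape_read (snd (to_config K (pc, s)) ! i)" if "i < K" for i
      using that by (simp add: rs_def to_config_def)
    have trans: "tm_trans (com_tm K c) pc rs =
      (q, map (\<lambda>i. if i = t then a else (rs ! i, Stay)) [0..<K])"
      using True by (simp add: com_tm_def jf t_def[symmetric] rst aq)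
    have "tm_step (com_tm K c) (to_config K (pc, s)) =
      (q, map2 tape_act (map (\<lambda>i. if i = t then a else (rs ! i, Stay)) [0..<K])
            (snd (to_config K (pc, s))))"
      unfolding tm_step_def rs_def[symmetric] using True trans
      by (simp add: to_config_def com_tm_def)
    also have "\<dots> = to_config K (q, s(j := tape_act a (s j)))"
    proof -
      have "map2 tape_act (map (\<lambda>i. if i = t then a else (rs ! i, Stay)) [0..<K])
            (snd (to_config K (pc, s))) = snd (to_config K (q, s(j := tape_act a (s j))))"
      proof (rule nth_equalityI)
        show "length (map2 tape_act (map (\<lambda>i. if i = t then a else (rs ! i, Stay)) [0..<K])
            (snd (to_config K (pc, s)))) = length (snd (to_config K (q, s(j := tape_act a (s j)))))"
          by (simp add: to_config_def)
      next
        fix i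
        assume "i < length (map2 tape_act (map (\<lambda>i. if i = t then a else (rs ! i, Stay)) [0..<K])
            (snd (to_config K (pc, s))))"
        then have i: "i < K" by (simp add: to_config_def)
        show "map2 tape_act (map (\<lambda>i. if i = t then a else (rs ! i, Stay)) [0..<K])
            (snd (to_config K (pc, s))) ! i = snd (to_config K (q, s(j := tape_act a (s j)))) ! i"
        proof (cases "i = t")
          case True
          then show ?thesis using i jt by (auto simp: to_config_def)
        next
          case False
          then have "(if i = K - 1 then 0 else i + 1) \<noteq> j" using tn[OF i] by blast
          then show ?thesis using i False rsi[OF i] by (auto simp: to_config_def)
        qed
      qed
      then show ?thesis by (simp add: to_config_def)
    qed
    finally show ?thesis using True by (simp add: Pair jf aq)
  next
    case False
    have "tm_step (com_tm K c) (to_config K (pc, s)) = to_config K (pc, s)"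
    proof -
      have "map2 tape_act (map (\<lambda>a. (a, Stay)) (map tape_read ts)) ts = ts" for ts
        by (induction ts) auto
      moreover obtain ts where "to_config K (pc, s) = (pc, ts)" by (simp add: to_config_def)
      ultimately show ?thesis using False by (simp add: tm_step_def com_tm_def)
    qed
    then show ?thesis using False by (simp add: Pair)
  qed
qed

lemma com_tm_steps:
  assumes "1 \<le> K" "wfc K c"
  shows "(tm_step (com_tm K c) ^^ n) (to_config K cs) = to_config K ((istep (code c 0) ^^ n) cs)"
  by (induction n) (simp_all add: com_tm_step[OF assms])

lemma wf_com_tm:
  assumes "1 \<le> K" "wfc K c"
  shows "wf_tm (com_tm K c)"
proof -
  have "fst (tm_trans (com_tm K c) q ss) < csize c + 1 \<and>
        length (snd (tm_trans (com_tm K c) q ss)) = K \<and>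
        fst ` set (snd (tm_trans (com_tm K c) q ss)) \<subseteq> {..<3}"
    if q: "q < csize c + 1" and ss: "length ss = K" "set ss \<subseteq> {..<3}" for q ss
  proof (cases "q < csize c")
    case True
    obtain j f where jf: "code c 0 ! q = (j, f)" by fastforce
    define t where "t = (if j = 0 then K - 1 else j - 1)"
    obtain a q' where aq: "f (ss ! t) = (a, q')" by fastforce
    have mem: "(j, f) \<in> set (code c 0)" using jf True by (metis length_code nth_mem)
    have "j < K" using wfc_code(1)[OF assms(2) mem] .
    then have tK: "t < K" by (auto simp: t_def)
    have sym: "ss ! i < 3" if "i < K" for i using ss that by (metis lessThan_iff nth_mem subsetD)
    have "q' \<le> csize c" using wfc_code(3)[OF assms(2) mem, of "ss ! t"] aq by simp
    moreover have "fst a < 3" using wfc_code(2)[OF assms(2) mem sym[OF tK]] aq by simp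
    moreover have "tm_trans (com_tm K c) q ss =
      (q', map (\<lambda>i. if i = t then a else (ss ! i, Stay)) [0..<K])"
      using True by (simp add: com_tm_def jf t_def[symmetric] aq)
    ultimately show ?thesis using sym by auto
  next
    case False
    then have "tm_trans (com_tm K c) q ss = (q, map (\<lambda>a. (a, Stay)) ss)"
      by (simp add: com_tm_def)
    then show ?thesis using q ss by force
  qed
  then show ?thesis using assms by (auto simp: wf_tm_def com_tm_def)
qed

section \<open>Polynomial bounds\<close>

text \<open>Equality with a polynomial rather than a bound: the coefficients are natural numbers, so
  monotonicity comes for free, and bounds can be substituted into each other.\<close>

definition polyb :: "(nat \<Rightarrow> nat) \<Rightarrow> bool" where
  "polyb f \<longleftrightarrow> (\<exists>p :: nat poly. \<forall>n. f n = poly p n)"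

lemma polyb_id: "polyb (\<lambda>n. n)"
  unfolding polyb_def by (rule exI[of _ "[:0, 1:]"]) simp

lemma polyb_const: "polyb (\<lambda>n. c)"
  unfolding polyb_def by (rule exI[of _ "[:c:]"]) simp

lemma polyb_add: "polyb f \<Longrightarrow> polyb g \<Longrightarrow> polyb (\<lambda>n. f n + g n)"
  unfolding polyb_def by (metis poly_add)

lemma polyb_mult: "polyb f \<Longrightarrow> polyb g \<Longrightarrow> polyb (\<lambda>n. f n * g n)"
  unfolding polyb_def by (metis poly_mult)

lemma polyb_comp: "polyb f \<Longrightarrow> polyb g \<Longrightarrow> polyb (\<lambda>n. f (g n))"
  unfolding polyb_def by (metis poly_pcompose)

lemmas polyb_intros = polyb_id polyb_const polyb_add polyb_mult

lemma poly_nat_mono: "a \<le> b \<Longrightarrow> poly p a \<le> poly p b" for p :: "nat poly"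
  unfolding poly_altdef by (intro sum_mono mult_left_mono power_mono) auto

lemma polyb_mono: "polyb f \<Longrightarrow> a \<le> b \<Longrightarrow> f a \<le> f b"
  unfolding polyb_def by (auto simp: poly_nat_mono)

section \<open>Counter programs\<close>

text \<open>
  The value of a counter is the position of a head on a tape that is blank except for a mark at
  position 0. The heads on the input tapes 1 and 2 are counters as well, without the mark.
\<close>
definition mark :: "int \<Rightarrow> nat" where
  "mark i = (if i = 0 then 1 else 0)"

text \<open>On tape 0 the head stands just behind the output written so far; for all other tapes its
  position is the value of the counter.\<close>

definition cst :: "bool list \<Rightarrow> bool list \<Rightarrow> bool list \<Rightarrow> (nat \<Rightarrow> nat) \<Rightarrow> store" where
  "cst x u out e = (\<lambda>j.
     if j = 0 then (string_contents out, int (length out))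
     else (if j = 1 then string_contents x else if j = 2 then string_contents u else mark, int (e j)))"

text \<open>The time is only an upper bound, so that branches of different lengths can share
  one.\<close>

definition runs :: "bool list \<Rightarrow> bool list \<Rightarrow> com \<Rightarrow> bool list \<Rightarrow> (nat \<Rightarrow> nat) \<Rightarrow> nat \<Rightarrow>
    bool list \<Rightarrow> (nat \<Rightarrow> nat) \<Rightarrow> bool" where
  "runs x u c out e n out' e' \<longleftrightarrow> (\<exists>n' \<le> n. exec c (cst x u out e) n' (cst x u out' e'))"

definition Inc :: "nat \<Rightarrow> com" where "Inc j = Act j None Go_Right"
definition Dec :: "nat \<Rightarrow> com" where "Dec j = Act j None Go_Left"

lemma tape_read_cst [simp]:
  "3 \<le> j \<Longrightarrow> tape_read (cst x u out e j) = Suc 0 \<longleftrightarrow> e j = 0"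
  "tape_read (cst x u out e (Suc 0)) = string_contents x (int (e 1))"
  "tape_read (cst x u out e 2) = string_contents u (int (e 2))"
  by (auto simp: tape_read_def cst_def mark_def)

lemma runs_mono: "runs x u c out e n out' e' \<Longrightarrow> n \<le> m \<Longrightarrow> runs x u c out e m out' e'"
  unfolding runs_def by (meson le_trans)

lemma runs_Skip: "runs x u Skip out e n out e"
  unfolding runs_def using exec_Skip by blast

lemma runs_Inc: assumes "1 \<le> j" shows "runs x u (Inc j) out e 1 out (e(j := e j + 1))"
proof -
  have "(cst x u out e)(j := tape_act (act None Go_Right (tape_read (cst x u out e j))) (cst x u out e j))
    = cst x u out (e(j := e j + 1))"
    using assms by (auto simp: cst_def tape_act_def act_def tape_read_def fun_eq_iff)
  then show ?thesis unfolding runs_def Inc_def using exec_Act by (metis order_refl)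
qed

lemma runs_Dec:
  assumes "1 \<le> j" "0 < e j" shows "runs x u (Dec j) out e 1 out (e(j := e j - 1))"
proof -
  have "(cst x u out e)(j := tape_act (act None Go_Left (tape_read (cst x u out e j))) (cst x u out e j))
    = cst x u out (e(j := e j - 1))"
    using assms by (auto simp: cst_def tape_act_def act_def tape_read_def fun_eq_iff of_nat_diff)
  then show ?thesis unfolding runs_def Dec_def using exec_Act by (metis order_refl)
qed

lemma string_contents_snoc:
  "(string_contents out)(int (length out) := bit_symbol b) = string_contents (out @ [b])"
  by (auto simp: string_contents_def fun_eq_iff nth_append nat_less_iff nat_eq_iff2)

lemma runs_Emit: "runs x u (Act 0 (Some (bit_symbol b)) Go_Right) out e 1 (out @ [b]) e"
proof -
  have "(cst x u out e)(0 := tape_act (act (Some (bit_symbol b)) Go_Right (tape_read (cst x u out e 0)))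
      (cst x u out e 0)) = cst x u (out @ [b]) e"
    by (auto simp: cst_def tape_act_def act_def string_contents_snoc fun_eq_iff)
  then show ?thesis unfolding runs_def using exec_Act by (metis order_refl)
qed

lemma runs_Seq:
  "runs x u c out e n out' e' \<Longrightarrow> runs x u d out' e' n' out'' e'' \<Longrightarrow>
    runs x u (c ;; d) out e (n + n') out'' e''"
  unfolding runs_def by (meson add_mono exec_Seq)

lemma runs_IfT:
  "tape_read (cst x u out e j) = a \<Longrightarrow> runs x u c out e n out' e' \<Longrightarrow>
    runs x u (IfSym j a c d) out e (n + 2) out' e'"
  unfolding runs_def by (meson add_le_mono1 exec_IfT)

lemma runs_IfF:
  "tape_read (cst x u out e j) \<noteq> a \<Longrightarrow> runs x u d out e n out' e' \<Longrightarrow>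
    runs x u (IfSym j a c d) out e (n + 2) out' e'"
  unfolding runs_def by (meson add_mono exec_IfF one_le_numeral)

text \<open>In place of an invariant, \<open>W k\<close> and \<open>E k\<close> give the output and
  the counters after \<open>k\<close> rounds explicitly. Each round costs a test and a jump besides
  its body; the last 1 is the failing test.\<close>

lemma runs_Loop:
  assumes "\<And>k. k < v \<Longrightarrow> tape_read (cst x u (W k) (E k) j) \<noteq> a"
    and "tape_read (cst x u (W v) (E v) j) = a"
    and "\<And>k. k < v \<Longrightarrow> runs x u c (W k) (E k) T (W (Suc k)) (E (Suc k))"
  shows "runs x u (Loop j a c) (W 0) (E 0) (v * (T + 2) + 1) (W v) (E v)"
proof -
  have "runs x u (Loop j a c) (W (v - i)) (E (v - i)) (i * (T + 2) + 1) (W v) (E v)"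
    if "i \<le> v" for i
    using that
  proof (induction i)
    case 0
    show ?case unfolding runs_def using exec_Stop[where s = "cst x u (W v) (E v)" and j = j, OF assms(2)] by auto
  next
    case (Suc i)
    define k where "k = v - Suc i"
    have k: "k < v" "Suc k = v - i" using Suc.prems by (auto simp: k_def)
    obtain n where n: "n \<le> i * (T + 2) + 1"
      "exec (Loop j a c) (cst x u (W (Suc k)) (E (Suc k))) n (cst x u (W v) (E v))"
      using Suc by (auto simp: runs_def k)
    obtain n' where n': "n' \<le> T" "exec c (cst x u (W k) (E k)) n' (cst x u (W (Suc k)) (E (Suc k)))"
      using assms(3)[OF k(1)] by (auto simp: runs_def)
    have "exec (Loop j a c) (cst x u (W k) (E k)) (1 + n' + 1 + n) (cst x u (W v) (E v))"
      using exec_Step[where s = "cst x u (W k) (E k)" and j = j, OF assms(1)[OF k(1)] n'(2) n(2)] .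
    then show ?case unfolding runs_def k_def[symmetric]
      using n(1) n'(1) by (intro exI[of _ "1 + n' + 1 + n"]) auto
  qed
  from this[of v] show ?thesis by simp
qed

lemma runs_counter_Loop:
  assumes "3 \<le> j" and "\<And>k. k \<le> v \<Longrightarrow> E k j = v - k"
    and "\<And>k. k < v \<Longrightarrow> runs x u c (W k) (E k) T (W (Suc k)) (E (Suc k))"
    and "E 0 = e" "W 0 = out" "v * (T + 2) + 1 \<le> n"
  shows "runs x u (Loop j 1 c) out e n (W v) (E v)"
proof -
  have "runs x u (Loop j 1 c) (W 0) (E 0) (v * (T + 2) + 1) (W v) (E v)"
    by (rule runs_Loop) (use assms(1-3) in auto)
  then show ?thesis using assms(4-6) runs_mono by metis
qed

section \<open>Moving, clearing and copying counters\<close>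

definition Move :: "nat \<Rightarrow> nat \<Rightarrow> com" where
  "Move a b = Loop a 1 (Dec a ;; Inc b)"

lemma runs_Move:
  assumes "3 \<le> a" "1 \<le> b" "a \<noteq> b"
  shows "runs x u (Move a b) out e (4 * e a + 1) out (e(a := 0, b := e b + e a))"
proof -
  define E where "E k = e(a := e a - k, b := e b + k)" for k
  have body: "runs x u (Dec a ;; Inc b) out (E k) (1 + 1) out (E (Suc k))" if "k < e a" for k
  proof (rule runs_Seq)
    show "runs x u (Dec a) out (E k) 1 out ((E k)(a := E k a - 1))"
      using assms that by (intro runs_Dec) (auto simp: E_def)
    have "((E k)(a := E k a - 1))(b := ((E k)(a := E k a - 1)) b + 1) = E (Suc k)"
      using assms by (auto simp: E_def fun_eq_iff)
    then show "runs x u (Inc b) out ((E k)(a := E k a - 1)) 1 out (E (Suc k))"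
      using runs_Inc[OF assms(2), of x u out "(E k)(a := E k a - 1)"] by simp
  qed
  have "runs x u (Loop a 1 (Dec a ;; Inc b)) out e (4 * e a + 1) out (E (e a))"
    by (rule runs_counter_Loop[where T = 2 and E = E and W = "\<lambda>_. out"])
      (use assms body in \<open>auto simp: E_def numeral_2_eq_2\<close>)
  then show ?thesis by (simp add: Move_def E_def)
qed

definition Clear :: "nat \<Rightarrow> com" where
  "Clear a = Loop a 1 (Dec a)"

lemma runs_Clear:
  assumes "3 \<le> a"
  shows "runs x u (Clear a) out e (3 * e a + 1) out (e(a := 0))"
proof -
  define E where "E k = e(a := e a - k)" for k
  have body: "runs x u (Dec a) out (E k) 1 out (E (Suc k))" if "k < e a" for k
    using runs_Dec[of a "E k" x u out] assms that by (simp add: E_def)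
  have "runs x u (Loop a 1 (Dec a)) out e (3 * e a + 1) out (E (e a))"
    by (rule runs_counter_Loop[where T = 1 and E = E and W = "\<lambda>_. out"])
      (use assms body in \<open>auto simp: E_def\<close>)
  then show ?thesis by (simp add: Clear_def E_def)
qed

definition Move2 :: "nat \<Rightarrow> nat \<Rightarrow> nat \<Rightarrow> com" where
  "Move2 a b c = Loop a 1 (Dec a ;; Inc b ;; Inc c)"

lemma runs_Move2:
  assumes "3 \<le> a" "1 \<le> b" "1 \<le> c" "a \<noteq> b" "a \<noteq> c" "b \<noteq> c"
  shows "runs x u (Move2 a b c) out e (5 * e a + 1) out (e(a := 0, b := e b + e a, c := e c + e a))"
proof -
  define E where "E k = e(a := e a - k, b := e b + k, c := e c + k)" for k
  have body: "runs x u (Dec a ;; Inc b ;; Inc c) out (E k) (1 + (1 + 1)) out (E (Suc k))"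
    if "k < e a" for k
  proof (rule runs_Seq[OF _ runs_Seq])
    let ?e = "(E k)(a := E k a - 1)"
    show "runs x u (Dec a) out (E k) 1 out ?e"
      using assms that by (intro runs_Dec) (auto simp: E_def)
    show "runs x u (Inc b) out ?e 1 out (?e(b := ?e b + 1))"
      by (rule runs_Inc[OF assms(2)])
    have "(?e(b := ?e b + 1))(c := (?e(b := ?e b + 1)) c + 1) = E (Suc k)"
      using assms by (auto simp: E_def fun_eq_iff)
    then show "runs x u (Inc c) out (?e(b := ?e b + 1)) 1 out (E (Suc k))"
      using runs_Inc[OF assms(3), of x u out "?e(b := ?e b + 1)"] by simp
  qed
  have "runs x u (Loop a 1 (Dec a ;; Inc b ;; Inc c)) out e (5 * e a + 1) out (E (e a))"
    by (rule runs_counter_Loop[where T = 3 and E = E and W = "\<lambda>_. out"])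
      (use assms body in \<open>auto simp: E_def numeral_3_eq_3\<close>)
  then show ?thesis by (simp add: Move2_def E_def)
qed

text \<open>A counter can be read only by counting it down; hence the detour through the scratch
  counter \<open>c\<close>, from which \<open>a\<close> is restored.\<close>

definition Copy :: "nat \<Rightarrow> nat \<Rightarrow> nat \<Rightarrow> com" where
  "Copy a b c = Move2 a b c ;; Move c a"

lemma runs_Copy:
  assumes "3 \<le> a" "1 \<le> b" "3 \<le> c" "a \<noteq> b" "a \<noteq> c" "b \<noteq> c" "e c = 0"
  shows "runs x u (Copy a b c) out e (9 * e a + 2) out (e(b := e b + e a))"
proof -
  let ?e = "e(a := 0, b := e b + e a, c := e c + e a)"
  have "?e(c := 0, a := ?e a + ?e c) = e(b := e b + e a)"
    using assms by (auto simp: fun_eq_iff)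
  then have "runs x u (Move c a) out ?e (4 * e a + 1) out (e(b := e b + e a))"
    using runs_Move[of c a x u out ?e] assms by simp
  then have "runs x u (Copy a b c) out e (5 * e a + 1 + (4 * e a + 1)) out (e(b := e b + e a))"
    unfolding Copy_def using runs_Move2[of a b c x u out e] assms by (intro runs_Seq) auto
  then show ?thesis by simp
qed

fun Incs :: "nat \<Rightarrow> nat \<Rightarrow> com" where
  "Incs j 0 = Skip"
| "Incs j (Suc n) = Incs j n ;; Inc j"

lemma runs_Incs: "1 \<le> j \<Longrightarrow> runs x u (Incs j n) out e n out (e(j := e j + n))"
proof (induction n)
  case 0
  then show ?case using runs_Skip by simp
next
  case (Suc n)
  let ?e = "e(j := e j + n)"
  have "runs x u (Incs j n ;; Inc j) out e (n + 1) out (?e(j := ?e j + 1))"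
    by (rule runs_Seq[OF Suc.IH[OF Suc.prems] runs_Inc[OF Suc.prems]])
  moreover have "?e(j := ?e j + 1) = e(j := e j + Suc n)" by (simp add: fun_eq_iff)
  ultimately show ?case unfolding Incs.simps by (simp only: Suc_eq_plus1)
qed

section \<open>A language of polynomial-time terms\<close>

text \<open>
  A term evaluates to a number; as a condition, it holds if its value is nonzero, so that
  \<open>Mul\<close> is conjunction and \<open>Sum\<close> is bounded existential quantification. The variables are
  named by the counters 3, 4, \<dots>; inputs are named by their tapes 1 and 2.
\<close>
datatype trm =
  Var nat
| Cst nat
| Add trm trm
| Mul trm trm
| Lt trm trm
| Bit nat trm
| Len nat
| Sum nat trm trm

definition inp :: "bool list \<Rightarrow> bool list \<Rightarrow> nat \<Rightarrow> bool list" where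
  "inp x u j = (if j = 1 then x else u)"

primrec tv :: "trm \<Rightarrow> bool list \<Rightarrow> bool list \<Rightarrow> (nat \<Rightarrow> nat) \<Rightarrow> nat" where
  "tv (Var i) x u e = e i"
| "tv (Cst n) x u e = n"
| "tv (Add s t) x u e = tv s x u e + tv t x u e"
| "tv (Mul s t) x u e = tv s x u e * tv t x u e"
| "tv (Lt s t) x u e = (if tv s x u e < tv t x u e then 1 else 0)"
| "tv (Bit j t) x u e =
     (if tv t x u e < length (inp x u j) \<and> inp x u j ! tv t x u e then 1 else 0)"
| "tv (Len j) x u e = length (inp x u j)"
| "tv (Sum i t s) x u e = (\<Sum>a < tv t x u e. tv s x u (e(i := a)))"

primrec wft :: "nat \<Rightarrow> trm \<Rightarrow> bool" where
  "wft b (Var i) = (3 \<le> i \<and> i < b)"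
| "wft b (Cst n) = True"
| "wft b (Add s t) = (wft b s \<and> wft b t)"
| "wft b (Mul s t) = (wft b s \<and> wft b t)"
| "wft b (Lt s t) = (wft b s \<and> wft b t)"
| "wft b (Bit j t) = ((j = 1 \<or> j = 2) \<and> wft b t)"
| "wft b (Len j) = (j = 1 \<or> j = 2)"
| "wft b (Sum i t s) = (3 \<le> i \<and> i < b \<and> wft b t \<and> wft b s)"

text \<open>The counters from \<open>b\<close> on are free; the result is put into counter \<open>b\<close>.\<close>
primrec ct :: "trm \<Rightarrow> nat \<Rightarrow> com" where
  "ct (Var i) b = Copy i b (b + 1)"
| "ct (Cst n) b = Incs b n"
| "ct (Add s t) b = ct s b ;; ct t (b + 1) ;; Move (b + 1) b"
| "ct (Mul s t) b = ct s (b + 1) ;; ct t (b + 2) ;;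
     Loop (b + 1) 1 (Dec (b + 1) ;; Copy (b + 2) b (b + 3)) ;; Clear (b + 2)"
| "ct (Lt s t) b = ct s (b + 1) ;; ct t (b + 2) ;;
     Loop (b + 1) 1 (Dec (b + 1) ;; IfSym (b + 2) 1 Skip (Dec (b + 2))) ;;
     IfSym (b + 2) 1 Skip (Inc b ;; Clear (b + 2))"
| "ct (Bit j t) b = ct t (b + 1) ;; Move2 (b + 1) (b + 2) j ;; IfSym j 2 (Inc b) Skip ;;
     Loop (b + 2) 1 (Dec (b + 2) ;; Dec j)"
| "ct (Len j) b = Loop j 0 (Inc j ;; Inc b) ;; Copy b (b + 1) (b + 2) ;;
     Loop (b + 1) 1 (Dec (b + 1) ;; Dec j)"
| "ct (Sum i t s) b = ct t (b + 1) ;; Move i (b + 2) ;;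
     Loop (b + 1) 1 (Dec (b + 1) ;; ct s (b + 3) ;; Move (b + 3) b ;; Inc i) ;;
     Clear i ;; Move (b + 2) i"

section \<open>Correctness and running time of compiled terms\<close>

lemma wft_mono: "wft b t \<Longrightarrow> b \<le> b' \<Longrightarrow> wft b' t"
  by (induction t) auto

lemma tv_cong:
  "wft b t \<Longrightarrow> (\<And>i. 3 \<le> i \<Longrightarrow> i < b \<Longrightarrow> e i = e' i) \<Longrightarrow> tv t x u e = tv t x u e'"
proof (induction t arbitrary: e e')
  case (Add s t)
  from Add.IH[of e e'] Add.prems show ?case by simp
next
  case (Mul s t)
  from Mul.IH[of e e'] Mul.prems show ?case by simp
next
  case (Lt s t)
  from Lt.IH[of e e'] Lt.prems show ?case by simp
next
  case (Bit j t)
  from Bit.IH[of e e'] Bit.prems show ?case by simp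
next
  case (Sum i t s)
  have t: "tv t x u e = tv t x u e'" using Sum.IH(1)[of e e'] Sum.prems by simp
  have "tv s x u (e(i := a)) = tv s x u (e'(i := a))" for a
    by (rule Sum.IH(2)) (use Sum.prems in auto)
  then show ?case by (simp add: t)
qed auto

text \<open>The invariant between the evaluations of terms: scratch counters are zero, the heads on
  the input tapes are back at their start, and \<open>N\<close> bounds everything on which the
  running time depends.\<close>

definition okay :: "bool list \<Rightarrow> bool list \<Rightarrow> nat \<Rightarrow> (nat \<Rightarrow> nat) \<Rightarrow> nat \<Rightarrow> bool" where
  "okay x u b e N \<longleftrightarrow> 3 \<le> b \<and> (\<forall>i \<ge> b. e i = 0) \<and> e 1 = 0 \<and> e 2 = 0 \<and>
     length x \<le> N \<and> length u \<le> N \<and> (\<forall>i. e i \<le> N)"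

text \<open>One function bounds both the time and the value, since the value of a subterm determines
  how often a loop is run and how large the counters are when the next subterm is evaluated. The
  bound must not depend on \<open>b\<close>, because the same term is compiled with different
  scratch counters.\<close>

definition tbound :: "trm \<Rightarrow> (nat \<Rightarrow> nat) \<Rightarrow> bool" where
  "tbound t f \<longleftrightarrow> polyb f \<and> (\<forall>x u b e N out. wft b t \<longrightarrow> okay x u b e N \<longrightarrow>
     runs x u (ct t b) out e (f N) out (e(b := tv t x u e)) \<and> tv t x u e \<le> f N)"

lemma tboundD:
  assumes "tbound t f" "wft b t" "okay x u b e N"
  shows "runs x u (ct t b) out e (f N) out (e(b := tv t x u e))" "tv t x u e \<le> f N"
  using assms by (auto simp: tbound_def)

lemma okay_mono: "okay x u b e N \<Longrightarrow> b \<le> b' \<Longrightarrow> N \<le> N' \<Longrightarrow> okay x u b' e N'"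
  unfolding okay_def by (meson le_trans)

lemma okay_upd:
  "okay x u b e N \<Longrightarrow> b \<le> b' \<Longrightarrow> 3 \<le> j \<Longrightarrow> j < b' \<Longrightarrow> N \<le> N' \<Longrightarrow> v \<le> N' \<Longrightarrow>
    okay x u b' (e(j := v)) N'"
  unfolding okay_def by (auto intro: le_trans)

lemma okay_upd_same:
  "okay x u b e N \<Longrightarrow> 3 \<le> j \<Longrightarrow> j < b \<Longrightarrow> v \<le> N \<Longrightarrow> okay x u b (e(j := v)) N"
  by (rule okay_upd[where b = b and N = N]) auto

lemma tv_upd: "wft b t \<Longrightarrow> b \<le> j \<Longrightarrow> tv t x u (e(j := v)) = tv t x u e"
  by (rule tv_cong) auto

lemma runs_cong:
  "runs x u c out e n out' e' \<Longrightarrow> n \<le> n' \<Longrightarrow> out'' = out' \<Longrightarrow> e'' = e' \<Longrightarrow>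
    runs x u c out e n' out'' e''"
  using runs_mono by simp

lemma tbound_polyb: "tbound t f \<Longrightarrow> polyb f"
  by (simp add: tbound_def)

lemma tbound_V: "tbound (Var i) (\<lambda>N. 9 * N + 2)"
  unfolding tbound_def
proof (intro conjI allI impI)
  fix x u b e N out
  assume w: "wft b (Var i)" and o: "okay x u b e N"
  have i: "3 \<le> i" "i < b" and e: "e b = 0" "e (b + 1) = 0" "e i \<le> N"
    using w o by (auto simp: okay_def)
  have "runs x u (Copy i b (b + 1)) out e (9 * e i + 2) out (e(b := e b + e i))"
    using i e by (intro runs_Copy) auto
  then show "runs x u (ct (Var i) b) out e (9 * N + 2) out (e(b := tv (Var i) x u e))"
    unfolding ct.simps by (rule runs_cong) (use e in auto)
  show "tv (Var i) x u e \<le> 9 * N + 2" using e by simp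
qed (intro polyb_intros)

lemma tbound_C: "tbound (Cst n) (\<lambda>N. n)"
  unfolding tbound_def
proof (intro conjI allI impI)
  fix x u b e N out
  assume o: "okay x u b e N"
  show "runs x u (ct (Cst n) b) out e n out (e(b := tv (Cst n) x u e))"
    using runs_Incs[of b x u n out e] o by (simp add: okay_def)
qed (auto intro: polyb_intros)

text \<open>While \<open>t\<close> is evaluated, the value of \<open>s\<close> already occupies
  counter \<open>b\<close>; this raises the bound on the counters from \<open>N\<close> to
  \<open>N + f N\<close>.\<close>

lemma runs_pair:
  assumes "tbound s f" "tbound t g" "wft b s" "wft b t" "okay x u b e N"
  shows "runs x u (ct s b) out e (f N) out (e(b := tv s x u e))"
    and "runs x u (ct t (b + 1)) out (e(b := tv s x u e)) (g (N + f N)) out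
      (e(b := tv s x u e, b + 1 := tv t x u e))"
    and "tv s x u e \<le> f N" "tv t x u e \<le> g (N + f N)"
proof -
  show 1: "runs x u (ct s b) out e (f N) out (e(b := tv s x u e))" and vs: "tv s x u e \<le> f N"
    using tboundD[OF assms(1,3,5)] by auto
  have o: "okay x u (b + 1) (e(b := tv s x u e)) (N + f N)"
    by (rule okay_upd[OF assms(5)]) (use vs assms(5) in \<open>auto simp: okay_def\<close>)
  have w: "wft (b + 1) t" using assms(4) wft_mono by simp
  have v: "tv t x u (e(b := tv s x u e)) = tv t x u e" using assms(4) by (simp add: tv_upd)
  show "runs x u (ct t (b + 1)) out (e(b := tv s x u e)) (g (N + f N)) out
      (e(b := tv s x u e, b + 1 := tv t x u e))" "tv t x u e \<le> g (N + f N)"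
    using tboundD[OF assms(2) w o] v by auto
qed

lemma tbound_Add:
  assumes s: "tbound s f" and t: "tbound t g"
  shows "tbound (Add s t) (\<lambda>N. f N + g (N + f N) + 4 * g (N + f N) + 1)"
  unfolding tbound_def
proof (intro conjI allI impI)
  fix x u b e N out
  assume w: "wft b (Add s t)" and o: "okay x u b e N"
  let ?vs = "tv s x u e" and ?vt = "tv t x u e"
  note p = runs_pair[OF s t _ _ o]
  let ?e2 = "e(b := ?vs, b + 1 := ?vt)"
  have b: "3 \<le> b" "e (b + 1) = 0" using o by (auto simp: okay_def)
  have m: "runs x u (Move (b + 1) b) out ?e2 (4 * ?e2 (b + 1) + 1) out
      (?e2(b + 1 := 0, b := ?e2 b + ?e2 (b + 1)))"
    using b by (intro runs_Move) auto
  have "runs x u (ct (Add s t) b) out e (f N + (g (N + f N) + (4 * ?e2 (b + 1) + 1))) out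
      (?e2(b + 1 := 0, b := ?e2 b + ?e2 (b + 1)))"
    unfolding ct.simps by (rule runs_Seq[OF p(1) runs_Seq[OF p(2) m]]) (use w in auto)
  then show "runs x u (ct (Add s t) b) out e (f N + g (N + f N) + 4 * g (N + f N) + 1) out
      (e(b := tv (Add s t) x u e))"
    by (rule runs_cong) (use w b p(3,4) in \<open>auto simp: fun_eq_iff\<close>)
  show "tv (Add s t) x u e \<le> f N + g (N + f N) + 4 * g (N + f N) + 1" using w p(3,4) by simp
next
  show "polyb (\<lambda>N. f N + g (N + f N) + 4 * g (N + f N) + 1)"
    using s t by (intro polyb_intros polyb_comp[OF tbound_polyb[OF t]]) (auto simp: tbound_def)
qed

lemma tbound_Mul:
  assumes s: "tbound s f" and t: "tbound t g"
  shows "tbound (Mul s t)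
    (\<lambda>N. f N + g (N + f N) + (f N * (9 * g (N + f N) + 5) + 1) + (3 * g (N + f N) + 1))"
  unfolding tbound_def
proof (intro conjI allI impI)
  fix x u b e N out
  assume w: "wft b (Mul s t)" and o: "okay x u b e N"
  let ?vs = "tv s x u e" and ?vt = "tv t x u e"
  have o': "okay x u (b + 1) e N" and w': "wft (b + 1) s" "wft (b + 1) t"
    using w o okay_mono wft_mono by auto
  have b: "3 \<le> b" "e (b + 1) = 0" "e b = 0" "e (b + 2) = 0" "e (b + 3) = 0"
    using o by (auto simp: okay_def)
  note p = runs_pair[OF s t w' o']
  let ?e2 = "e(b + 1 := ?vs, b + 1 + 1 := ?vt)"
  define E where "E k = ?e2(b + 1 := ?vs - k, b := k * ?vt)" for k
  have body: "runs x u (Dec (b + 1) ;; Copy (b + 2) b (b + 3)) out (E k) (1 + (9 * ?vt + 2)) out (E (Suc k))"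
    if k: "k < ?vs" for k
  proof (rule runs_Seq)
    let ?E = "(E k)(b + 1 := E k (b + 1) - 1)"
    show "runs x u (Dec (b + 1)) out (E k) 1 out ?E"
      using k by (intro runs_Dec) (auto simp: E_def)
    have "runs x u (Copy (b + 2) b (b + 3)) out ?E (9 * ?E (b + 2) + 2) out (?E(b := ?E b + ?E (b + 2)))"
      using b by (intro runs_Copy) (auto simp: E_def)
    then show "runs x u (Copy (b + 2) b (b + 3)) out ?E (9 * ?vt + 2) out (E (Suc k))"
      by (rule runs_cong) (auto simp: E_def fun_eq_iff)
  qed
  have l: "runs x u (Loop (b + 1) 1 (Dec (b + 1) ;; Copy (b + 2) b (b + 3))) out ?e2
      (?vs * (9 * ?vt + 5) + 1) out (E ?vs)"
    by (rule runs_counter_Loop[where E = E and W = "\<lambda>_. out", OF _ _ body])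
      (use b in \<open>auto simp: E_def fun_eq_iff algebra_simps\<close>)
  have c: "runs x u (Clear (b + 2)) out (E ?vs) (3 * E ?vs (b + 2) + 1) out ((E ?vs)(b + 2 := 0))"
    by (rule runs_Clear) (use b in auto)
  have "runs x u (ct (Mul s t) b) out e
     (f N + (g (N + f N) + (?vs * (9 * ?vt + 5) + 1 + (3 * E ?vs (b + 2) + 1)))) out ((E ?vs)(b + 2 := 0))"
    unfolding ct.simps using runs_Seq[OF p(1) runs_Seq[OF p(2) runs_Seq[OF l c]]]
    by simp
  moreover have "?vs * (9 * ?vt + 5) \<le> f N * (9 * g (N + f N) + 5)"
    using p(3,4) by (intro mult_mono) auto
  moreover have "E ?vs (b + 2) \<le> g (N + f N)" using p(4) by (simp add: E_def)
  moreover have "e(b := tv (Mul s t) x u e) = (E ?vs)(b + 2 := 0)"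
    using b by (auto simp: E_def fun_eq_iff)
  ultimately show "runs x u (ct (Mul s t) b) out e
      (f N + g (N + f N) + (f N * (9 * g (N + f N) + 5) + 1) + (3 * g (N + f N) + 1)) out
      (e(b := tv (Mul s t) x u e))"
    by - (rule runs_cong[OF _ _ refl], assumption, linarith, assumption)
  have "?vs * ?vt \<le> f N * (9 * g (N + f N) + 5)" using p(3,4) by (intro mult_mono) auto
  then show "tv (Mul s t) x u e \<le>
      f N + g (N + f N) + (f N * (9 * g (N + f N) + 5) + 1) + (3 * g (N + f N) + 1)" by simp
next
  show "polyb (\<lambda>N. f N + g (N + f N) + (f N * (9 * g (N + f N) + 5) + 1) + (3 * g (N + f N) + 1))"
    using s t by (intro polyb_intros polyb_comp[OF tbound_polyb[OF t]]) (auto simp: tbound_def)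
qed

text \<open>Both values are counted down \<open>tv s\<close> times, the second one stopping at 0.
  What is left of it is the truncated difference, which is nonzero exactly if \<open>tv s\<close> is
  the smaller value.\<close>

lemma tbound_Lt:
  assumes s: "tbound s f" and t: "tbound t g"
  shows "tbound (Lt s t) (\<lambda>N. f N + g (N + f N) + (f N * 6 + 1) + (3 * g (N + f N) + 4))"
  unfolding tbound_def
proof (intro conjI allI impI)
  fix x u b e N out
  assume w: "wft b (Lt s t)" and o: "okay x u b e N"
  let ?vs = "tv s x u e" and ?vt = "tv t x u e"
  have o': "okay x u (b + 1) e N" and w': "wft (b + 1) s" "wft (b + 1) t"
    using w o okay_mono wft_mono by auto
  have b: "3 \<le> b" "e (b + 1) = 0" "e b = 0" "e (b + 2) = 0"
    using o by (auto simp: okay_def)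
  note p = runs_pair[OF s t w' o']
  let ?e2 = "e(b + 1 := ?vs, b + 1 + 1 := ?vt)"
  define E where "E k = ?e2(b + 1 := ?vs - k, b + 2 := ?vt - k)" for k
  have body: "runs x u (Dec (b + 1) ;; IfSym (b + 2) 1 Skip (Dec (b + 2))) out (E k) (1 + (1 + 2)) out (E (Suc k))"
    if k: "k < ?vs" for k
  proof (rule runs_Seq)
    let ?E = "(E k)(b + 1 := E k (b + 1) - 1)"
    show "runs x u (Dec (b + 1)) out (E k) 1 out ?E"
      using k by (intro runs_Dec) (auto simp: E_def)
    show "runs x u (IfSym (b + 2) 1 Skip (Dec (b + 2))) out ?E (1 + 2) out (E (Suc k))"
    proof (cases "?E (b + 2) = 0")
      case True
      then have "E (Suc k) = ?E" by (auto simp: E_def fun_eq_iff)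
      moreover have "runs x u (IfSym (b + 2) 1 Skip (Dec (b + 2))) out ?E (1 + 2) out ?E"
        by (rule runs_IfT[OF _ runs_Skip]) (use True b in auto)
      ultimately show ?thesis by simp
    next
      case False
      have "runs x u (Dec (b + 2)) out ?E 1 out (?E(b + 2 := ?E (b + 2) - 1))"
        using False by (intro runs_Dec) auto
      then have "runs x u (IfSym (b + 2) 1 Skip (Dec (b + 2))) out ?E (1 + 2) out
          (?E(b + 2 := ?E (b + 2) - 1))"
        by (intro runs_IfF) (use False b in auto)
      moreover have "E (Suc k) = ?E(b + 2 := ?E (b + 2) - 1)" by (auto simp: E_def fun_eq_iff)
      ultimately show ?thesis by simp
    qed
  qed
  have l: "runs x u (Loop (b + 1) 1 (Dec (b + 1) ;; IfSym (b + 2) 1 Skip (Dec (b + 2)))) out ?e2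
      (?vs * 6 + 1) out (E ?vs)"
    by (rule runs_counter_Loop[where E = E and W = "\<lambda>_. out", OF _ _ body])
      (use b in \<open>auto simp: E_def fun_eq_iff\<close>)
  let ?E = "E ?vs"
  have c: "runs x u (IfSym (b + 2) 1 Skip (Inc b ;; Clear (b + 2))) out ?E
      (1 + (3 * ?vt + 1) + 2) out (e(b := tv (Lt s t) x u e))"
  proof (cases "?E (b + 2) = 0")
    case True
    then have "e(b := tv (Lt s t) x u e) = ?E" using b by (auto simp: E_def fun_eq_iff)
    moreover have "runs x u (IfSym (b + 2) 1 Skip (Inc b ;; Clear (b + 2))) out ?E
        (1 + (3 * ?vt + 1) + 2) out ?E"
      by (rule runs_IfT[OF _ runs_Skip]) (use True b in auto)
    ultimately show ?thesis by simp
  next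
    case False
    let ?F = "?E(b := ?E b + 1)"
    have "runs x u (Inc b ;; Clear (b + 2)) out ?E (1 + (3 * ?F (b + 2) + 1)) out (?F(b + 2 := 0))"
      by (rule runs_Seq[OF runs_Inc runs_Clear]) (use b in auto)
    then have "runs x u (IfSym (b + 2) 1 Skip (Inc b ;; Clear (b + 2))) out ?E
        (1 + (3 * ?F (b + 2) + 1) + 2) out (?F(b + 2 := 0))"
      by (intro runs_IfF) (use False b in auto)
    moreover have "e(b := tv (Lt s t) x u e) = ?F(b + 2 := 0)"
      using b False by (auto simp: E_def fun_eq_iff)
    ultimately show ?thesis by - (rule runs_cong[OF _ _ refl], assumption, simp (no_asm) add: E_def, assumption)
  qed
  have "runs x u (ct (Lt s t) b) out e
     (f N + (g (N + f N) + (?vs * 6 + 1 + (1 + (3 * ?vt + 1) + 2)))) out (e(b := tv (Lt s t) x u e))"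
    unfolding ct.simps using runs_Seq[OF p(1) runs_Seq[OF p(2) runs_Seq[OF l c]]]
    by simp
  then show "runs x u (ct (Lt s t) b) out e
      (f N + g (N + f N) + (f N * 6 + 1) + (3 * g (N + f N) + 4)) out (e(b := tv (Lt s t) x u e))"
    by (rule runs_cong) (use p(3,4) in auto)
  show "tv (Lt s t) x u e \<le> f N + g (N + f N) + (f N * 6 + 1) + (3 * g (N + f N) + 4)" by simp
next
  show "polyb (\<lambda>N. f N + g (N + f N) + (f N * 6 + 1) + (3 * g (N + f N) + 4))"
    using s t by (intro polyb_intros polyb_comp[OF tbound_polyb[OF t]]) (auto simp: tbound_def)
qed

text \<open>An input tape has no mark at position 0 by which the head could recognise its start. The
  way back is therefore measured by a counter that recorded the way out.\<close>

lemma runs_rewind: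
  assumes "3 \<le> a" "j = 1 \<or> j = 2" "e j = e a"
  shows "runs x u (Loop a 1 (Dec a ;; Dec j)) out e (4 * e a + 1) out (e(a := 0, j := 0))"
proof -
  have ja: "1 \<le> j" "j \<noteq> a" using assms(1,2) by auto
  define E where "E k = e(a := e a - k, j := e a - k)" for k
  have body: "runs x u (Dec a ;; Dec j) out (E k) (1 + 1) out (E (Suc k))" if k: "k < e a" for k
  proof (rule runs_Seq)
    let ?E = "(E k)(a := E k a - 1)"
    show "runs x u (Dec a) out (E k) 1 out ?E"
      using assms(1) ja k by (intro runs_Dec) (simp_all add: E_def)
    have "runs x u (Dec j) out ?E 1 out (?E(j := ?E j - 1))"
      using ja k by (intro runs_Dec) (simp_all add: E_def)
    moreover have "E (Suc k) = ?E(j := ?E j - 1)" using ja by (simp add: E_def fun_eq_iff)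
    ultimately show "runs x u (Dec j) out ?E 1 out (E (Suc k))" by simp
  qed
  have "runs x u (Loop a 1 (Dec a ;; Dec j)) out e (4 * e a + 1) out (E (e a))"
    by (rule runs_counter_Loop[where E = E and W = "\<lambda>_. out", OF _ _ body])
      (use assms(1,3) ja in \<open>simp_all add: E_def fun_eq_iff\<close>)
  then show ?thesis by (simp add: E_def)
qed

lemma string_contents_eq_2 [simp]:
  "string_contents w (int v) = 2 \<longleftrightarrow> v < length w \<and> w ! v"
  by (auto simp: string_contents_def bit_symbol_def)

lemma string_contents_eq_0 [simp]:
  "string_contents w (int v) = 0 \<longleftrightarrow> length w \<le> v"
  by (auto simp: string_contents_def bit_symbol_def)

lemma tape_read_inp:
  "j = 1 \<or> j = 2 \<Longrightarrow> tape_read (cst x u out e j) = string_contents (inp x u j) (int (e j))"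
  by (auto simp: inp_def)

text \<open>\<open>Move2\<close> drives the input head to the wanted position and keeps the position
  in \<open>b + 2\<close> for the way back. Behind the input the head reads a blank, which is not 2,
  in accordance with the value 0 of the term.\<close>

lemma tbound_Bit:
  assumes t: "tbound t g"
  shows "tbound (Bit j t) (\<lambda>N. g N + (5 * g N + 1) + 3 + (4 * g N + 1))"
  unfolding tbound_def
proof (intro conjI allI impI)
  fix x u b e N out
  assume w: "wft b (Bit j t)" and o: "okay x u b e N"
  let ?v = "tv t x u e"
  have j: "j = 1 \<or> j = 2" using w by simp
  then have jj: "1 \<le> j" by auto
  have o': "okay x u (b + 1) e N" and w': "wft (b + 1) t"
    using w o okay_mono wft_mono by auto
  have b: "3 \<le> b" "e (b + 1) = 0" "e b = 0" "e (b + 2) = 0" "e j = 0" "j \<noteq> b" "j < b"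
    using o j by (auto simp: okay_def)
  note p = tboundD[OF t w' o']
  let ?e1 = "e(b + 1 := ?v)"
  have m: "runs x u (Move2 (b + 1) (b + 2) j) out ?e1 (5 * ?e1 (b + 1) + 1) out
     (?e1(b + 1 := 0, b + 2 := ?e1 (b + 2) + ?e1 (b + 1), j := ?e1 j + ?e1 (b + 1)))"
    (is "runs _ _ _ _ _ _ _ ?e2")
    using b jj by (intro runs_Move2) auto
  have e2: "?e2 = e(b + 2 := ?v, j := ?v)" using b by (auto simp: fun_eq_iff)
  let ?e3 = "e(b + 2 := ?v, j := ?v, b := tv (Bit j t) x u e)"
  have i: "runs x u (IfSym j 2 (Inc b) Skip) out (e(b + 2 := ?v, j := ?v)) (1 + 2) out ?e3"
  proof (cases "?v < length (inp x u j) \<and> inp x u j ! ?v")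
    case True
    have "runs x u (Inc b) out (e(b + 2 := ?v, j := ?v)) 1 out ?e3"
      using runs_Inc[of b x u out "e(b + 2 := ?v, j := ?v)"] b True by simp
    then show ?thesis by (intro runs_IfT) (use True in \<open>simp_all add: tape_read_inp[OF j]\<close>)
  next
    case False
    then have e3: "?e3 = e(b + 2 := ?v, j := ?v)" using b by (auto simp: fun_eq_iff)
    show ?thesis unfolding e3
      by (intro runs_IfF[OF _ runs_Skip]) (use False in \<open>simp add: tape_read_inp[OF j]\<close>)
  qed
  have r: "runs x u (Loop (b + 2) 1 (Dec (b + 2) ;; Dec j)) out ?e3 (4 * ?e3 (b + 2) + 1) out
      (?e3(b + 2 := 0, j := 0))"
    by (rule runs_rewind[OF _ j]) (use b in auto)
  have "runs x u (ct (Bit j t) b) out e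
     (g N + (5 * ?e1 (b + 1) + 1 + (1 + 2 + (4 * ?e3 (b + 2) + 1)))) out (?e3(b + 2 := 0, j := 0))"
    unfolding ct.simps using runs_Seq[OF p(1) runs_Seq[OF m[unfolded e2] runs_Seq[OF i r]]] by simp
  then show "runs x u (ct (Bit j t) b) out e (g N + (5 * g N + 1) + 3 + (4 * g N + 1)) out
      (e(b := tv (Bit j t) x u e))"
    by (rule runs_cong) (use b p(2) in \<open>auto simp: fun_eq_iff\<close>)
  show "tv (Bit j t) x u e \<le> g N + (5 * g N + 1) + 3 + (4 * g N + 1)" by simp
next
  show "polyb (\<lambda>N. g N + (5 * g N + 1) + 3 + (4 * g N + 1))"
    using t by (intro polyb_intros) (auto simp: tbound_def)
qed

lemma tbound_Len: "tbound (Len j) (\<lambda>N. 4 * N + 1 + (9 * N + 2) + (4 * N + 1))"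
  unfolding tbound_def
proof (intro conjI allI impI)
  fix x u b e N out
  assume w: "wft b (Len j)" and o: "okay x u b e N"
  have j: "j = 1 \<or> j = 2" using w by simp
  then have jj: "1 \<le> j" by auto
  let ?L = "length (inp x u j)"
  have b: "3 \<le> b" "e (b + 1) = 0" "e b = 0" "e (b + 2) = 0" "e j = 0" "j \<noteq> b" "j < b"
    and N: "?L \<le> N"
    using o j by (auto simp: okay_def inp_def)
  define E where "E k = e(j := k, b := k)" for k
  have body: "runs x u (Inc j ;; Inc b) out (E k) (1 + 1) out (E (Suc k))" for k
  proof (rule runs_Seq)
    let ?E = "(E k)(j := E k j + 1)"
    show "runs x u (Inc j) out (E k) 1 out ?E" using jj by (intro runs_Inc) auto
    have "runs x u (Inc b) out ?E 1 out (?E(b := ?E b + 1))" using b by (intro runs_Inc) auto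
    moreover have "E (Suc k) = ?E(b := ?E b + 1)" using b by (auto simp: E_def fun_eq_iff)
    ultimately show "runs x u (Inc b) out ?E 1 out (E (Suc k))" by simp
  qed
  have Ej: "E k j = k" for k using b by (simp add: E_def)
  have l: "runs x u (Loop j 0 (Inc j ;; Inc b)) out (E 0) (?L * (1 + 1 + 2) + 1) out (E ?L)"
    by (rule runs_Loop[where E = E and W = "\<lambda>_. out", OF _ _ body])
      (simp_all add: tape_read_inp[OF j] Ej)
  have E0: "E 0 = e" using b by (auto simp: E_def fun_eq_iff)
  have c: "runs x u (Copy b (b + 1) (b + 2)) out (E ?L) (9 * E ?L b + 2) out
      ((E ?L)(b + 1 := E ?L (b + 1) + E ?L b))" (is "runs _ _ _ _ _ _ _ ?F")
    using b by (intro runs_Copy) (auto simp: E_def)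
  have r: "runs x u (Loop (b + 1) 1 (Dec (b + 1) ;; Dec j)) out ?F (4 * ?F (b + 1) + 1) out
      (?F(b + 1 := 0, j := 0))"
    by (rule runs_rewind[OF _ j]) (use b in \<open>auto simp: E_def\<close>)
  have "runs x u (ct (Len j) b) out e
     (?L * (1 + 1 + 2) + 1 + (9 * E ?L b + 2 + (4 * ?F (b + 1) + 1))) out (?F(b + 1 := 0, j := 0))"
    unfolding ct.simps by (rule runs_Seq[OF l[unfolded E0] runs_Seq[OF c r]])
  then show "runs x u (ct (Len j) b) out e (4 * N + 1 + (9 * N + 2) + (4 * N + 1)) out
      (e(b := tv (Len j) x u e))"
    by (rule runs_cong) (use b N in \<open>auto simp: fun_eq_iff E_def\<close>)
  show "tv (Len j) x u e \<le> 4 * N + 1 + (9 * N + 2) + (4 * N + 1)" using N by simp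
qed (intro polyb_intros)

text \<open>\<open>h\<close> bounds one evaluation of the summand: at that time the counters
  contain, besides the values bounded by \<open>N\<close>, an index and a remaining number of
  rounds, both at most \<open>g N\<close>, and a partial sum of at most
  \<open>g N * f (N + g N)\<close>. The old value of the bound variable \<open>i\<close> is kept in
  \<open>b + 2\<close> and restored at the end.\<close>

lemma tbound_Sum:
  assumes s: "tbound s f" and t: "tbound t g"
  defines "h \<equiv> \<lambda>N. f (N + g N + g N * f (N + g N))"
  shows "tbound (Sum i t s)
    (\<lambda>N. g N + (4 * N + 1) + (g N * (h N + (4 * h N + 1) + 4) + 1) + (3 * g N + 1) + (4 * N + 1))"
  unfolding tbound_def
proof (intro conjI allI impI)
  fix x u b e N out
  assume w: "wft b (Sum i t s)" and o: "okay x u b e N"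
  let ?v = "tv t x u e"
  define S where "S a = tv s x u (e(i := a))" for a
  have i: "3 \<le> i" "i < b" and ws: "wft b s" using w by auto
  have o': "okay x u (b + 1) e N" and w': "wft (b + 1) t"
    using w o okay_mono wft_mono by auto
  have b: "3 \<le> b" "e (b + 1) = 0" "e b = 0" "e (b + 2) = 0" "e (b + 3) = 0"
    using o by (auto simp: okay_def)
  have N: "e i \<le> N" using o by (simp add: okay_def)
  note p = tboundD[OF t w' o']
  have fm: "f n \<le> f m" if "n \<le> m" for n m using s that polyb_mono by (auto simp: tbound_def)
  have S1: "S a \<le> f (N + g N)" if "a \<le> ?v" for a
    unfolding S_def
    by (rule tboundD(2)[OF s ws okay_upd[OF o]]) (use i that p(2) in auto)
  have Sum: "(\<Sum>a<k. S a) \<le> g N * f (N + g N)" if "k \<le> ?v" for k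
  proof -
    have "(\<Sum>a<k. S a) \<le> (\<Sum>a<k. f (N + g N))" using S1 that by (intro sum_mono) auto
    also have "\<dots> \<le> g N * f (N + g N)" using that p(2) by simp
    finally show ?thesis .
  qed
  have fh: "f (N + g N) \<le> h N" unfolding h_def by (intro fm) simp
  let ?e1 = "e(b + 1 := ?v)"
  have m: "runs x u (Move i (b + 2)) out ?e1 (4 * ?e1 i + 1) out
     (?e1(i := 0, b + 2 := ?e1 (b + 2) + ?e1 i))"
    using i by (intro runs_Move) auto
  define E where "E k = e(b := \<Sum>a<k. S a, b + 1 := ?v - k, b + 2 := e i, i := k)" for k
  have E0: "?e1(i := 0, b + 2 := ?e1 (b + 2) + ?e1 i) = E 0"
    using i b by (auto simp: E_def fun_eq_iff)
  have body: "runs x u (Dec (b + 1) ;; ct s (b + 3) ;; Move (b + 3) b ;; Inc i) out (E k)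
      (1 + (h N + (4 * h N + 1 + 1))) out (E (Suc k))" if k: "k < ?v" for k
  proof -
    let ?E1 = "(E k)(b + 1 := E k (b + 1) - 1)"
    have 1: "runs x u (Dec (b + 1)) out (E k) 1 out ?E1"
      using i k by (intro runs_Dec) (auto simp: E_def)
    have v: "tv s x u ?E1 = S k" unfolding S_def
      by (rule tv_cong[OF ws]) (use i in \<open>auto simp: E_def\<close>)
    have E1: "okay x u (b + 3) ?E1 (N + g N + g N * f (N + g N))"
      unfolding E_def
      by (intro okay_upd_same okay_mono[OF o])
        (use i b k N p(2) Sum[of k] in auto)
    have w3: "wft (b + 3) s" using ws wft_mono by simp
    let ?E2 = "?E1(b + 3 := S k)"
    have 2: "runs x u (ct s (b + 3)) out ?E1 (h N) out ?E2"
      using tboundD(1)[OF s w3 E1] unfolding v h_def .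
    have 3: "runs x u (Move (b + 3) b) out ?E2 (4 * ?E2 (b + 3) + 1) out
        (?E2(b + 3 := 0, b := ?E2 b + ?E2 (b + 3)))" (is "runs _ _ _ _ _ _ _ ?E3")
      using b by (intro runs_Move) auto
    have "S k \<le> h N" using S1[of k] fh k by simp
    then have 3: "runs x u (Move (b + 3) b) out ?E2 (4 * h N + 1) out ?E3"
      using 3 by (rule_tac runs_cong) auto
    have 4: "runs x u (Inc i) out ?E3 1 out (?E3(i := ?E3 i + 1))"
      using i by (intro runs_Inc) auto
    have "E (Suc k) = ?E3(i := ?E3 i + 1)" using i b by (auto simp: E_def fun_eq_iff)
    then show ?thesis using runs_Seq[OF 1 runs_Seq[OF 2 runs_Seq[OF 3 4]]] by simp
  qed
  have l: "runs x u (Loop (b + 1) 1 (Dec (b + 1) ;; ct s (b + 3) ;; Move (b + 3) b ;; Inc i))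
      out (E 0) (?v * (h N + (4 * h N + 1) + 4) + 1) out (E ?v)"
    by (rule runs_counter_Loop[where E = E and W = "\<lambda>_. out", OF _ _ body])
      (use i b in \<open>auto simp: E_def fun_eq_iff algebra_simps\<close>)
  have c: "runs x u (Clear i) out (E ?v) (3 * E ?v i + 1) out ((E ?v)(i := 0))"
    (is "runs _ _ _ _ _ _ _ ?F") using i by (rule_tac runs_Clear)
  have r: "runs x u (Move (b + 2) i) out ?F (4 * ?F (b + 2) + 1) out
      (?F(b + 2 := 0, i := ?F i + ?F (b + 2)))" (is "runs _ _ _ _ _ _ _ ?G")
    using i by (intro runs_Move) auto
  have "runs x u (ct (Sum i t s) b) out e
     (g N + (4 * ?e1 i + 1 + (?v * (h N + (4 * h N + 1) + 4) + 1 +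
       (3 * E ?v i + 1 + (4 * ?F (b + 2) + 1))))) out ?G"
    unfolding ct.simps
    by (rule runs_Seq[OF p(1) runs_Seq[OF m[unfolded E0] runs_Seq[OF l runs_Seq[OF c r]]]])
  moreover have "?v * (h N + (4 * h N + 1) + 4) \<le> g N * (h N + (4 * h N + 1) + 4)"
    using p(2) by (intro mult_mono) auto
  moreover have "?e1 i \<le> N" "E ?v i \<le> g N" "?F (b + 2) \<le> N"
    using p(2) N i by (auto simp: E_def)
  moreover have "e(b := tv (Sum i t s) x u e) = ?G"
    using i b by (auto simp: E_def fun_eq_iff S_def)
  ultimately show "runs x u (ct (Sum i t s) b) out e
      (g N + (4 * N + 1) + (g N * (h N + (4 * h N + 1) + 4) + 1) + (3 * g N + 1) + (4 * N + 1)) out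
      (e(b := tv (Sum i t s) x u e))"
    by - (rule runs_cong[OF _ _ refl], assumption, linarith, assumption)
  have "g N * f (N + g N) \<le> g N * (h N + (4 * h N + 1) + 4)" using fh by (intro mult_mono) auto
  then show "tv (Sum i t s) x u e \<le> g N + (4 * N + 1) +
      (g N * (h N + (4 * h N + 1) + 4) + 1) + (3 * g N + 1) + (4 * N + 1)"
    using Sum[of ?v] unfolding S_def tv.simps by linarith
next
  have "polyb h" unfolding h_def
    using s t by (intro polyb_comp[OF tbound_polyb[OF s]] polyb_intros) (auto simp: tbound_def)
  then show "polyb (\<lambda>N. g N + (4 * N + 1) + (g N * (h N + (4 * h N + 1) + 4) + 1) +
      (3 * g N + 1) + (4 * N + 1))"
    using t by (intro polyb_intros) (auto simp: tbound_def)
qed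

lemma ex_tbound: "\<exists>f. tbound t f"
proof (induction t)
  case (Var i) show ?case using tbound_V by blast
next
  case (Cst n) show ?case using tbound_C by blast
next
  case (Add s t) then show ?case using tbound_Add by blast
next
  case (Mul s t) then show ?case using tbound_Mul by blast
next
  case (Lt s t) then show ?case using tbound_Lt by blast
next
  case (Bit j t) then show ?case using tbound_Bit by blast
next
  case (Len j) show ?case using tbound_Len by blast
next
  case (Sum i t s) then show ?case using tbound_Sum by blast
qed

section \<open>Programs that print strings\<close>

datatype prog =
  Emit trm
| Cat prog prog
| For nat trm prog

primrec pv :: "prog \<Rightarrow> bool list \<Rightarrow> bool list \<Rightarrow> (nat \<Rightarrow> nat) \<Rightarrow> bool list" where
  "pv (Emit t) x u e = [tv t x u e \<noteq> 0]"
| "pv (Cat p q) x u e = pv p x u e @ pv q x u e"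
| "pv (For i t p) x u e = concat (map (\<lambda>a. pv p x u (e(i := a))) [0..<tv t x u e])"

primrec wfp :: "nat \<Rightarrow> prog \<Rightarrow> bool" where
  "wfp b (Emit t) = wft b t"
| "wfp b (Cat p q) = (wfp b p \<and> wfp b q)"
| "wfp b (For i t p) = (3 \<le> i \<and> i < b \<and> wft b t \<and> wfp b p)"

primrec cp :: "prog \<Rightarrow> nat \<Rightarrow> com" where
  "cp (Emit t) b = ct t b ;; IfSym b 1 (Act 0 (Some (bit_symbol False)) Go_Right)
     (Act 0 (Some (bit_symbol True)) Go_Right ;; Clear b)"
| "cp (Cat p q) b = cp p b ;; cp q b"
| "cp (For i t p) b = ct t b ;; Move i (b + 1) ;;
     Loop b 1 (Dec b ;; cp p (b + 2) ;; Inc i) ;; Clear i ;; Move (b + 1) i"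

lemma wfp_mono: "wfp b p \<Longrightarrow> b \<le> b' \<Longrightarrow> wfp b' p"
  by (induction p) (auto intro: wft_mono)

lemma pv_cong:
  "wfp b p \<Longrightarrow> (\<And>i. 3 \<le> i \<Longrightarrow> i < b \<Longrightarrow> e i = e' i) \<Longrightarrow> pv p x u e = pv p x u e'"
proof (induction p arbitrary: e e')
  case (Emit t)
  then show ?case using tv_cong[of b t e e'] by simp
next
  case (Cat p q)
  from Cat.IH[of e e'] Cat.prems show ?case by simp
next
  case (For i t p)
  have t: "tv t x u e = tv t x u e'" using tv_cong[of b t e e'] For.prems by simp
  have "pv p x u (e(i := a)) = pv p x u (e'(i := a))" for a
    by (rule For.IH) (use For.prems in auto)
  then show ?case by (simp add: t)
qed

definition pbound :: "prog \<Rightarrow> (nat \<Rightarrow> nat) \<Rightarrow> bool" where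
  "pbound p f \<longleftrightarrow> polyb f \<and> (\<forall>x u b e N out. wfp b p \<longrightarrow> okay x u b e N \<longrightarrow>
     runs x u (cp p b) out e (f N) (out @ pv p x u e) e)"

lemma pboundD:
  assumes "pbound p f" "wfp b p" "okay x u b e N"
  shows "runs x u (cp p b) out e (f N) (out @ pv p x u e) e"
  using assms by (auto simp: pbound_def)

lemma pbound_polyb: "pbound p f \<Longrightarrow> polyb f"
  by (simp add: pbound_def)

lemma pbound_Emit:
  assumes t: "tbound t f"
  shows "pbound (Emit t) (\<lambda>N. f N + (3 * f N + 4))"
  unfolding pbound_def
proof (intro conjI allI impI)
  fix x u b e N out
  assume w: "wfp b (Emit t)" and o: "okay x u b e N"
  let ?v = "tv t x u e"
  have b: "3 \<le> b" "e b = 0" using o by (auto simp: okay_def)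
  have p: "runs x u (ct t b) out e (f N) out (e(b := ?v))" "?v \<le> f N"
    using tboundD[OF t _ o] w by auto
  have "runs x u (IfSym b 1 (Act 0 (Some (bit_symbol False)) Go_Right)
     (Act 0 (Some (bit_symbol True)) Go_Right ;; Clear b)) out (e(b := ?v)) (3 * f N + 4)
     (out @ [?v \<noteq> 0]) e"
  proof (cases "?v = 0")
    case True
    then have e: "e(b := ?v) = e" using b by (auto simp: fun_eq_iff)
    have "runs x u (IfSym b 1 (Act 0 (Some (bit_symbol False)) Go_Right)
     (Act 0 (Some (bit_symbol True)) Go_Right ;; Clear b)) out (e(b := ?v)) (1 + 2)
     (out @ [False]) (e(b := ?v))"
      by (rule runs_IfT[OF _ runs_Emit]) (use True b in auto)
    then show ?thesis by (rule runs_cong) (use True e in auto)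
  next
    case False
    have "runs x u (IfSym b 1 (Act 0 (Some (bit_symbol False)) Go_Right)
     (Act 0 (Some (bit_symbol True)) Go_Right ;; Clear b)) out (e(b := ?v))
      (1 + (3 * (e(b := ?v)) b + 1) + 2) (out @ [True]) ((e(b := ?v))(b := 0))"
      by (rule runs_IfF[OF _ runs_Seq[OF runs_Emit runs_Clear]]) (use False b in auto)
    then show ?thesis by (rule runs_cong) (use False b p in \<open>auto simp: fun_eq_iff\<close>)
  qed
  then show "runs x u (cp (Emit t) b) out e (f N + (3 * f N + 4)) (out @ pv (Emit t) x u e) e"
    unfolding cp.simps pv.simps by (rule runs_Seq[OF p(1)])
qed (intro polyb_intros tbound_polyb[OF t])

lemma pbound_Cat:
  assumes "pbound p f" "pbound q g"
  shows "pbound (Cat p q) (\<lambda>N. f N + g N)"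
  unfolding pbound_def
proof (intro conjI allI impI)
  fix x u b e N out
  assume w: "wfp b (Cat p q)" and o: "okay x u b e N"
  show "runs x u (cp (Cat p q) b) out e (f N + g N) (out @ pv (Cat p q) x u e) e"
    using runs_Seq[OF pboundD[OF assms(1) _ o, of out] pboundD[OF assms(2) _ o]] w by simp
qed (intro polyb_intros pbound_polyb[OF assms(1)] pbound_polyb[OF assms(2)])

text \<open>In contrast to a sum, nothing accumulates in the counters: the body leaves them
  unchanged, so \<open>N + f N\<close> bounds them in every round.\<close>

lemma pbound_For:
  assumes t: "tbound t f" and p: "pbound p g"
  shows "pbound (For i t p)
    (\<lambda>N. f N + (4 * N + 1) + (f N * (g (N + f N) + 4) + 1) + (3 * f N + 1) + (4 * N + 1))"
  unfolding pbound_def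
proof (intro conjI allI impI)
  fix x u b e N out
  assume w: "wfp b (For i t p)" and o: "okay x u b e N"
  let ?v = "tv t x u e"
  have i: "3 \<le> i" "i < b" and wp: "wfp b p" using w by auto
  have b: "3 \<le> b" "e (b + 1) = 0" "e b = 0" using o by (auto simp: okay_def)
  have N: "e i \<le> N" using o by (simp add: okay_def)
  have ft: "runs x u (ct t b) out e (f N) out (e(b := ?v))" "?v \<le> f N"
    using tboundD[OF t _ o] w by auto
  let ?e1 = "e(b := ?v)"
  have m: "runs x u (Move i (b + 1)) out ?e1 (4 * ?e1 i + 1) out
     (?e1(i := 0, b + 1 := ?e1 (b + 1) + ?e1 i))"
    using i by (intro runs_Move) auto
  define E where "E k = e(b := ?v - k, b + 1 := e i, i := k)" for k
  define W where "W k = out @ concat (map (\<lambda>a. pv p x u (e(i := a))) [0..<k])" for k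
  have E0: "?e1(i := 0, b + 1 := ?e1 (b + 1) + ?e1 i) = E 0"
    using i b by (auto simp: E_def fun_eq_iff)
  have body: "runs x u (Dec b ;; cp p (b + 2) ;; Inc i) (W k) (E k)
      (1 + (g (N + f N) + 1)) (W (Suc k)) (E (Suc k))" if k: "k < ?v" for k
  proof -
    let ?E1 = "(E k)(b := E k b - 1)"
    have 1: "runs x u (Dec b) (W k) (E k) 1 (W k) ?E1"
      using i k b by (intro runs_Dec) (auto simp: E_def)
    have v: "pv p x u ?E1 = pv p x u (e(i := k))"
      by (rule pv_cong[OF wp]) (use i in \<open>auto simp: E_def\<close>)
    have E1: "okay x u (b + 2) ?E1 (N + f N)"
      unfolding E_def
      by (intro okay_upd_same okay_mono[OF o])
        (use i b k N ft(2) in auto)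
    have w2: "wfp (b + 2) p" using wp wfp_mono by simp
    have 2: "runs x u (cp p (b + 2)) (W k) ?E1 (g (N + f N)) (W (Suc k)) ?E1"
      using pboundD[OF p w2 E1, of "W k"] unfolding v by (simp add: W_def)
    have 3: "runs x u (Inc i) (W (Suc k)) ?E1 1 (W (Suc k)) (?E1(i := ?E1 i + 1))"
      using i by (intro runs_Inc) auto
    have "E (Suc k) = ?E1(i := ?E1 i + 1)" using i b by (auto simp: E_def fun_eq_iff)
    then show ?thesis using runs_Seq[OF 1 runs_Seq[OF 2 3]] by simp
  qed
  have l: "runs x u (Loop b 1 (Dec b ;; cp p (b + 2) ;; Inc i))
      out (E 0) (?v * (g (N + f N) + 4) + 1) (W ?v) (E ?v)"
    by (rule runs_counter_Loop[where E = E and W = W, OF _ _ body])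
      (use i b in \<open>auto simp: E_def W_def fun_eq_iff algebra_simps\<close>)
  have c: "runs x u (Clear i) (W ?v) (E ?v) (3 * E ?v i + 1) (W ?v) ((E ?v)(i := 0))"
    (is "runs _ _ _ _ _ _ _ ?F") using i by (rule_tac runs_Clear)
  have r: "runs x u (Move (b + 1) i) (W ?v) ?F (4 * ?F (b + 1) + 1) (W ?v)
      (?F(b + 1 := 0, i := ?F i + ?F (b + 1)))" (is "runs _ _ _ _ _ _ _ ?G")
    using i by (intro runs_Move) auto
  have "runs x u (cp (For i t p) b) out e
     (f N + (4 * ?e1 i + 1 + (?v * (g (N + f N) + 4) + 1 +
       (3 * E ?v i + 1 + (4 * ?F (b + 1) + 1))))) (W ?v) ?G"
    unfolding cp.simps
    by (rule runs_Seq[OF ft(1) runs_Seq[OF m[unfolded E0] runs_Seq[OF l runs_Seq[OF c r]]]])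
  moreover have "?v * (g (N + f N) + 4) \<le> f N * (g (N + f N) + 4)"
    using ft(2) by (intro mult_mono) auto
  moreover have "?e1 i \<le> N" "E ?v i \<le> f N" "?F (b + 1) \<le> N"
    using ft(2) N i by (auto simp: E_def)
  moreover have "e = ?G" using i b by (auto simp: E_def fun_eq_iff)
  ultimately show "runs x u (cp (For i t p) b) out e
      (f N + (4 * N + 1) + (f N * (g (N + f N) + 4) + 1) + (3 * f N + 1) + (4 * N + 1))
      (out @ pv (For i t p) x u e) e"
    by - (rule runs_cong, assumption, linarith, simp add: W_def, assumption)
next
  show "polyb (\<lambda>N. f N + (4 * N + 1) + (f N * (g (N + f N) + 4) + 1) + (3 * f N + 1) + (4 * N + 1))"
    using t p by (intro polyb_intros polyb_comp[OF pbound_polyb[OF p]]) (auto simp: tbound_def pbound_def)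
qed

lemma ex_pbound: "\<exists>f. pbound p f"
proof (induction p)
  case (Emit t) show ?case using ex_tbound pbound_Emit by blast
next
  case (Cat p q) then show ?case using pbound_Cat by blast
next
  case (For i t p) then show ?case using ex_tbound pbound_For by meson
qed

section \<open>Initialisation, and machines for programs and terms\<close>

primrec marks :: "nat \<Rightarrow> com" where
  "marks 0 = Skip"
| "marks (Suc n) = marks n ;; Act (3 + n) (Some 1) Stay"

lemma exec_marks:
  "exec (marks n) s n (\<lambda>j. if 3 \<le> j \<and> j < 3 + n then tape_act (1, Stay) (s j) else s j)"
proof (induction n)
  case 0
  have "(\<lambda>j. if 3 \<le> j \<and> j < 3 + 0 then tape_act (1, Stay) (s j) else s j) = s"
    by (auto simp: fun_eq_iff)
  then show ?case using exec_Skip by simp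
next
  case (Suc n)
  have "exec (marks n ;; Act (3 + n) (Some 1) Stay) s (n + 1)
    ((\<lambda>j. if 3 \<le> j \<and> j < 3 + n then tape_act (1, Stay) (s j) else s j)
     (3 + n := tape_act (1, Stay) (s (3 + n))))" (is "exec _ _ _ ?f")
    using exec_Seq[OF Suc.IH exec_Act[of "3 + n" "Some 1" Stay]] by (simp add: act_def)
  moreover have "?f = (\<lambda>j. if 3 \<le> j \<and> j < 3 + Suc n then tape_act (1, Stay) (s j) else s j)"
    by (auto simp: fun_eq_iff)
  ultimately show ?case by simp
qed

lemma wfc_mono: "wfc K c \<Longrightarrow> K \<le> K' \<Longrightarrow> wfc K' c"
  by (induction c) auto

definition bounded_com :: "com \<Rightarrow> bool" where
  "bounded_com c \<longleftrightarrow> (\<exists>K. wfc K c)"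

lemma bounded_com_simps [simp]:
  "bounded_com Skip"
  "bounded_com (Act j w m) \<longleftrightarrow> (\<forall>b. w = Some b \<longrightarrow> b < 3)"
  "bounded_com (c ;; d) \<longleftrightarrow> bounded_com c \<and> bounded_com d"
  "bounded_com (IfSym j a c d) \<longleftrightarrow> bounded_com c \<and> bounded_com d"
  "bounded_com (Loop j a c) \<longleftrightarrow> bounded_com c"
proof -
  show "bounded_com Skip" by (simp add: bounded_com_def)
  show "bounded_com (Act j w m) \<longleftrightarrow> (\<forall>b. w = Some b \<longrightarrow> b < 3)"
    by (auto simp: bounded_com_def intro: exI[of _ "Suc j"])
  show "bounded_com (c ;; d) \<longleftrightarrow> bounded_com c \<and> bounded_com d"
    unfolding bounded_com_def wfc.simps by (meson max.cobounded1 max.cobounded2 wfc_mono)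
  show "bounded_com (IfSym j a c d) \<longleftrightarrow> bounded_com c \<and> bounded_com d"
  proof
    assume "bounded_com c \<and> bounded_com d"
    then obtain K K' where "wfc K c" "wfc K' d" by (auto simp: bounded_com_def)
    then have "wfc (j + K + K' + 1) (IfSym j a c d)" using wfc_mono by simp
    then show "bounded_com (IfSym j a c d)" unfolding bounded_com_def by blast
  qed (auto simp: bounded_com_def)
  show "bounded_com (Loop j a c) \<longleftrightarrow> bounded_com c"
  proof
    assume "bounded_com c"
    then obtain K where "wfc K c" by (auto simp: bounded_com_def)
    then have "wfc (j + K + 1) (Loop j a c)" using wfc_mono by simp
    then show "bounded_com (Loop j a c)" unfolding bounded_com_def by blast
  qed (auto simp: bounded_com_def)
qed

lemma bounded_com_basic [simp]:
  "bounded_com (Inc j)" "bounded_com (Dec j)" "bounded_com (Move a b)" "bounded_com (Clear a)"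
  "bounded_com (Move2 a b c)" "bounded_com (Copy a b c)"
  by (simp_all add: Inc_def Dec_def Move_def Clear_def Move2_def Copy_def)

lemma bounded_com_Incs [simp]: "bounded_com (Incs j n)"
  by (induction n) auto

lemma bounded_com_ct [simp]: "bounded_com (ct t b)"
  by (induction t arbitrary: b) auto

lemma bounded_com_cp [simp]: "bounded_com (cp p b)"
  by (induction p arbitrary: b) (auto simp: bit_symbol_def)

lemma wfc_marks: "wfc (3 + n) (marks n)"
  by (induction n) (auto intro: wfc_mono)

lemma funpow_halted:
  assumes "fst cfg = tm_halt M"
  shows "(tm_step M ^^ n) cfg = cfg"
  using assms by (induction n) (auto simp: tm_step_def)

lemma tm_outputs_mono:
  assumes "tm_outputs M xs t w" "t \<le> t'"
  shows "tm_outputs M xs t' w"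
proof -
  obtain d where d: "t' = d + t" using assms(2) by (metis add.commute le_Suc_ex)
  show ?thesis
    using assms(1) funpow_halted[of "(tm_step M ^^ t) (tm_init M xs)" M d]
    by (simp add: tm_outputs_def Let_def d funpow_add)
qed

text \<open>A missing second input leaves the same tapes as an empty one. So one machine can serve
  as a reduction, with one input, and as a verifier, with two.\<close>

theorem prog_tm:
  assumes "wfp b p"
  shows "\<exists>M q. wf_tm M \<and> 2 \<le> tm_tapes M \<and> polyb q \<and> (\<forall>x u.
    tm_outputs M [x, u] (q (length x + length u)) (pv p x u (\<lambda>_. 0)) \<and>
    tm_outputs M [x] (q (length x)) (pv p x [] (\<lambda>_. 0)))"
proof -
  have w: "wfp (max 3 b) p" using assms wfp_mono by simp
  let ?e = "\<lambda>_ :: nat. 0 :: nat"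
  obtain f where f: "pbound p f" using ex_pbound by blast
  obtain K0 where K0: "wfc K0 (cp p (max 3 b))"
    using bounded_com_cp bounded_com_def by blast
  define c where "c = marks K0 ;; cp p (max 3 b)"
  define K where "K = 3 + K0"
  have K: "1 \<le> K" "wfc K c"
    using wfc_mono[OF K0] wfc_marks[of K0] by (auto simp: c_def K_def)
  define M where "M = com_tm K c"
  define q where "q n = K0 + f n" for n
  have out: "tm_outputs M xs (q (length x + length u)) (pv p x u ?e)"
    if xs: "xs = [x, u] \<or> (xs = [x] \<and> u = [])" for x u xs
  proof -
    \<comment> \<open>Program tapes from \<open>3 + K0\<close> on do not exist in the machine, so
      they may be given the mark that \<open>cst\<close> demands of all counters.\<close>
    define s0 :: store where "s0 j = (if 3 + K0 \<le> j then (mark, 0) else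
      (if j = 1 then string_contents x else if j = 2 then string_contents u else string_contents [], 0))" for j
    have "(string_contents (if j < length xs then xs ! j else []), 0) =
        s0 (if j = K - 1 then 0 else j + 1)" if j: "j < K" for j
    proof -
      consider "j = 0" | "j = 1" | "2 \<le> j" by linarith
      then show ?thesis
      proof cases
        case 3
        then have "\<not> j < length xs" using xs by auto
        then show ?thesis using 3 j by (simp add: s0_def K_def)
      qed (use xs in \<open>auto simp: s0_def K_def\<close>)
    qed
    then have init: "tm_init M xs = to_config K (0, s0)"
      by (simp add: tm_init_def M_def com_tm_def to_config_def)
    have blank: "tape_act (1, Stay) (string_contents [], 0) = (mark, 0)"
      by (auto simp: tape_act_def string_contents_def mark_def fun_eq_iff)
    have "(\<lambda>j. if 3 \<le> j \<and> j < 3 + K0 then tape_act (1, Stay) (s0 j) else s0 j) = cst x u [] ?e"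
      using blank by (auto simp: cst_def s0_def fun_eq_iff)
    then have 1: "exec (marks K0) s0 K0 (cst x u [] ?e)" using exec_marks[of K0 s0] by simp
    have "okay x u (max 3 b) ?e (length x + length u)" by (simp add: okay_def)
    from pboundD[OF f w this, of "[]"]
    obtain n where n: "n \<le> f (length x + length u)"
      "exec (cp p (max 3 b)) (cst x u [] ?e) n (cst x u (pv p x u ?e) ?e)"
      by (auto simp: runs_def)
    have "exec c s0 (K0 + n) (cst x u (pv p x u ?e) ?e)"
      unfolding c_def by (rule exec_Seq[OF 1 n(2)])
    moreover have "embedded (code c 0) 0 (code c 0)" by (simp add: embedded_def)
    ultimately have "(istep (code c 0) ^^ (K0 + n)) (0, s0) = (csize c, cst x u (pv p x u ?e) ?e)"
      using exec_code by force
    then have "(tm_step M ^^ (K0 + n)) (tm_init M xs) = to_config K (csize c, cst x u (pv p x u ?e) ?e)"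
      unfolding M_def init[unfolded M_def] com_tm_steps[OF K] by simp
    moreover have "last (snd (to_config K (csize c, cst x u (pv p x u ?e) ?e))) =
        cst x u (pv p x u ?e) ?e 0"
      using K(1) by (simp add: to_config_def last_map)
    ultimately have "tm_outputs M xs (K0 + n) (pv p x u ?e)"
      by (simp add: tm_outputs_def Let_def to_config_def M_def com_tm_def cst_def)
    then show ?thesis by (rule tm_outputs_mono) (use n(1) in \<open>simp add: q_def\<close>)
  qed
  have "wf_tm M" "2 \<le> tm_tapes M" unfolding M_def using wf_com_tm[OF K]
    by (auto simp: com_tm_def K_def)
  moreover have "polyb q" unfolding q_def using f by (intro polyb_intros) (auto simp: pbound_def)
  moreover have "tm_outputs M [x] (q (length x)) (pv p x [] ?e)" for x
    using out[of "[x]" x "[]"] by simp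
  ultimately show ?thesis using out by blast
qed

lemma polytime_computable_prog:
  assumes "wfp b p"
  shows "polytime_computable (\<lambda>x. pv p x [] (\<lambda>_. 0))"
  using prog_tm[OF assms] unfolding polytime_computable_def polyb_def by metis

lemma NP_term:
  assumes "wft b t" and "polyb p"
    and L: "\<And>x. x \<in> L \<longleftrightarrow> (\<exists>u. length u \<le> p (length x) \<and> tv t x u (\<lambda>_. 0) \<noteq> 0)"
  shows "L \<in> NP"
proof -
  have "wfp b (Emit t)" using assms(1) by simp
  from prog_tm[OF this] obtain M q where M: "wf_tm M" "2 \<le> tm_tapes M" "polyb q"
    and out: "\<And>x u. tm_outputs M [x, u] (q (length x + length u)) [tv t x u (\<lambda>_. 0) \<noteq> 0]"
    by auto
  have "polyb (\<lambda>n. q (n + p n))" using M(3) assms(2) by (intro polyb_comp[OF M(3)] polyb_intros)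
  then obtain r where r: "\<And>n. q (n + p n) = poly r n" by (auto simp: polyb_def)
  obtain pp where pp: "\<And>n. p n = poly pp n" using assms(2) by (auto simp: polyb_def)
  have out': "tm_outputs M [x, u] (poly r (length x)) [tv t x u (\<lambda>_. 0) \<noteq> 0]"
    if "length u \<le> p (length x)" for x u
    unfolding r[symmetric]
    by (rule tm_outputs_mono[OF out polyb_mono[OF M(3)]]) (use that in simp)
  have uniq: "w = w'" if "tm_outputs M xs n [w]" "tm_outputs M xs n [w']" for xs n w w'
  proof -
    have "string_contents [w] 0 = string_contents [w'] 0"
      using that by (simp add: tm_outputs_def Let_def)
    then show ?thesis by (simp add: string_contents_def bit_symbol_def split: if_splits)
  qed
  have "x \<in> L \<longleftrightarrow> (\<exists>u. length u \<le> poly pp (length x) \<and> tm_outputs M [x, u] (poly r (length x)) [True])" for x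
  proof
    assume "x \<in> L"
    then obtain u where u: "length u \<le> p (length x)" "tv t x u (\<lambda>_. 0) \<noteq> 0" using L by blast
    then show "\<exists>u. length u \<le> poly pp (length x) \<and> tm_outputs M [x, u] (poly r (length x)) [True]"
      using out'[OF u(1)] by (intro exI[of _ u]) (simp add: pp)
  next
    assume "\<exists>u. length u \<le> poly pp (length x) \<and> tm_outputs M [x, u] (poly r (length x)) [True]"
    then obtain u where u: "length u \<le> p (length x)" "tm_outputs M [x, u] (poly r (length x)) [True]"
      unfolding pp by blast
    have "tv t x u (\<lambda>_. 0) \<noteq> 0" using uniq[OF u(2) out'[OF u(1)]] by simp
    then show "x \<in> L" using L u(1) by blast
  qed
  moreover have "\<forall>x u. length u \<le> poly pp (length x) \<longrightarrow> (\<exists>b. tm_outputs M [x, u] (poly r (length x)) [b])"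
    using out' pp by metis
  ultimately show ?thesis
    unfolding NP_def mem_Collect_eq using M(1,2) by blast
qed

section \<open>Linkages as families of vertex lists\<close>

definition vpath :: "'a pair_pre_digraph \<Rightarrow> 'a \<Rightarrow> 'a list \<Rightarrow> 'a \<Rightarrow> bool" where
  "vpath G s vs t \<longleftrightarrow> vs \<noteq> [] \<and> hd vs = s \<and> last vs = t \<and> distinct vs \<and> set vs \<subseteq> pverts G \<and>
     successively (\<lambda>a b. (a, b) \<in> parcs G) vs"

lemma pawalk_verts_path:
  assumes "pair_wf_digraph G" "set p \<subseteq> parcs G" "pcas u p v" "u \<in> pverts G"
  shows "pawalk_verts u p \<noteq> [] \<and> hd (pawalk_verts u p) = u \<and> last (pawalk_verts u p) = v \<and>
    set (pawalk_verts u p) \<subseteq> pverts G \<and> successively (\<lambda>a b. (a, b) \<in> parcs G) (pawalk_verts u p)"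
  using assms(2-4)
proof (induction p arbitrary: u)
  case (Cons e p)
  have e: "snd e \<in> pverts G" "(u, snd e) \<in> parcs G"
    using Cons.prems pair_wf_digraph.arc_snd_in_verts[OF assms(1)] by auto
  have IH: "pawalk_verts (snd e) p \<noteq> []" "hd (pawalk_verts (snd e) p) = snd e"
    "last (pawalk_verts (snd e) p) = v" "set (pawalk_verts (snd e) p) \<subseteq> pverts G"
    "successively (\<lambda>a b. (a, b) \<in> parcs G) (pawalk_verts (snd e) p)"
    using Cons.IH[of "snd e"] Cons.prems e by auto
  obtain b q where bq: "pawalk_verts (snd e) p = b # q" using IH(1) by (cases "pawalk_verts (snd e) p") auto
  show ?case using IH e Cons.prems bq by auto
qed auto

lemma path_pawalk:
  assumes "vs \<noteq> []" "successively (\<lambda>a b. (a, b) \<in> E) vs"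
  shows "set (zip vs (tl vs)) \<subseteq> E \<and> pcas (hd vs) (zip vs (tl vs)) (last vs) \<and>
    pawalk_verts (hd vs) (zip vs (tl vs)) = vs"
  using assms
proof (induction vs)
  case (Cons v vs)
  then show ?case by (cases vs) auto
qed simp

text \<open>Without parallel arcs a path is determined by its vertices, and the capacity condition
  counts nothing else; so vertex lists can replace arc walks.\<close>

lemma half_integrally_feasible_iff:
  assumes "pair_wf_digraph G"
  shows "half_integrally_feasible G S T \<longleftrightarrow>
    (\<exists>Q. (\<forall>i < length S. vpath G (S ! i) (Q i) (T ! i)) \<and>
         (\<forall>v \<in> pverts G. card {i. i < length S \<and> v \<in> set (Q i)} \<le> 2))"
proof -
  have A: "pre_digraph.apath (with_proj G) u p v \<longleftrightarrow>
      u \<in> pverts G \<and> set p \<subseteq> parcs G \<and> pcas u p v \<and> distinct (pawalk_verts u p)" for u p v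
    by (simp add: pre_digraph.apath_def pre_digraph.awalk_def cas_with_proj_eq awalk_verts_with_proj_eq)
  show ?thesis
  proof
    assume "half_integrally_feasible G S T"
    then obtain P where P: "\<And>i. i < length S \<Longrightarrow> pre_digraph.apath (with_proj G) (S ! i) (P i) (T ! i)"
      "\<forall>v \<in> pverts G. card {i. i < length S \<and> v \<in> set (pawalk_verts (S ! i) (P i))} \<le> 2"
      by (auto simp: half_integrally_feasible_def awalk_verts_with_proj_eq)
    have "vpath G (S ! i) (pawalk_verts (S ! i) (P i)) (T ! i)" if "i < length S" for i
      using P(1)[OF that, unfolded A] pawalk_verts_path[OF assms] by (auto simp: vpath_def)
    then show "\<exists>Q. (\<forall>i < length S. vpath G (S ! i) (Q i) (T ! i)) \<and>
         (\<forall>v \<in> pverts G. card {i. i < length S \<and> v \<in> set (Q i)} \<le> 2)"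
      using P(2) by (intro exI[of _ "\<lambda>i. pawalk_verts (S ! i) (P i)"]) simp
  next
    assume "\<exists>Q. (\<forall>i < length S. vpath G (S ! i) (Q i) (T ! i)) \<and>
         (\<forall>v \<in> pverts G. card {i. i < length S \<and> v \<in> set (Q i)} \<le> 2)"
    then obtain Q where Q: "\<And>i. i < length S \<Longrightarrow> vpath G (S ! i) (Q i) (T ! i)"
      "\<forall>v \<in> pverts G. card {i. i < length S \<and> v \<in> set (Q i)} \<le> 2" by blast
    have ap: "pre_digraph.apath (with_proj G) (S ! i) (zip (Q i) (tl (Q i))) (T ! i) \<and>
        pawalk_verts (S ! i) (zip (Q i) (tl (Q i))) = Q i" if "i < length S" for i
    proof -
      have q: "Q i \<noteq> []" "hd (Q i) = S ! i" "last (Q i) = T ! i" "distinct (Q i)"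
        "set (Q i) \<subseteq> pverts G" "successively (\<lambda>a b. (a, b) \<in> parcs G) (Q i)"
        using Q(1)[OF that] by (auto simp: vpath_def)
      have "S ! i \<in> pverts G" using q(1,2,5) hd_in_set by force
      then show ?thesis unfolding A using path_pawalk[OF q(1,6)] q by auto
    qed
    have "{i. i < length S \<and> v \<in> set (pawalk_verts (S ! i) (zip (Q i) (tl (Q i))))} =
        {i. i < length S \<and> v \<in> set (Q i)}" for v
      using ap by auto
    then show "half_integrally_feasible G S T"
      unfolding half_integrally_feasible_def awalk_verts_with_proj_eq
      using ap Q(2) by (intro exI[of _ "\<lambda>i. zip (Q i) (tl (Q i))"]) simp
  qed
qed

lemma vpath_ends:
  assumes "vpath G s vs t"
  shows "s \<in> set vs" "t \<in> set vs"
  using assms by (auto simp: vpath_def)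

text \<open>Apart from their ends, this is all that is used of given paths in the hardness proof:
  starting at the source, they are followed forwards one arc at a time.\<close>

lemma vpath_successor:
  assumes "vpath G s vs t" "x \<in> set vs" "x \<noteq> t"
  shows "\<exists>y \<in> set vs. (x, y) \<in> parcs G"
proof -
  obtain us ws where vs: "vs = us @ x # ws" using assms(2) by (meson split_list)
  have "ws \<noteq> []" using assms vs by (auto simp: vpath_def)
  then obtain y ws' where "ws = y # ws'" by (cases ws) auto
  then show ?thesis using assms(1) vs by (auto simp: vpath_def successively_append_iff)
qed

text \<open>If \<open>x\<close> already lies on the path found for \<open>y\<close>, the part before
  \<open>x\<close> is cut off. The verifier needs this, as its certificates only guarantee a walk
  inside \<open>A\<close>.\<close>

lemma rtrancl_vpath:
  assumes "(s, t) \<in> (parcs G \<inter> A \<times> A)\<^sup>*" "s \<in> A" "A \<subseteq> pverts G"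
  shows "\<exists>vs. vpath G s vs t \<and> set vs \<subseteq> A"
  using assms(1,2)
proof (induction rule: converse_rtrancl_induct)
  case base
  then show ?case using assms(3) by (intro exI[of _ "[t]"]) (auto simp: vpath_def)
next
  case (step x y)
  then obtain vs where vs: "vpath G y vs t" "set vs \<subseteq> A" by auto
  show ?case
  proof (cases "x \<in> set vs")
    case True
    then obtain us ws where "vs = us @ x # ws" by (meson split_list)
    then have "vpath G x (x # ws) t \<and> set (x # ws) \<subseteq> A"
      using vs by (auto simp: vpath_def successively_append_iff)
    then show ?thesis by blast
  next
    case False
    obtain z ws where zs: "vs = z # ws" using vs(1) by (cases vs) (auto simp: vpath_def)
    have "vpath G x (x # vs) t \<and> set (x # vs) \<subseteq> A"
      using vs step False zs assms(3) by (auto simp: vpath_def)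
    then show ?thesis by blast
  qed
qed

section \<open>Constraint satisfaction as a highly connected linkage problem\<close>

text \<open>Uniqueness of digits is behind every numbering below: of occurrences, literals, clauses,
  tableau entries and certificate bits.\<close>

lemma nat_digits:
  assumes "a * b + r = a' * b + r'" "r < b" "r' < (b :: nat)"
  shows "a = a' \<and> r = r'"
proof -
  have "(a * b + r) div b = (a' * b + r') div b" "(a * b + r) mod b = (a' * b + r') mod b"
    using assms(1) by simp_all
  then show ?thesis using assms(2,3) by simp
qed

lemma nat_digits_less:
  assumes "a < m" "r < b"
  shows "a * b + r < m * (b :: nat)"
proof -
  have "a * b + r < Suc a * b" using assms(2) by simp
  also have "\<dots> \<le> m * b" using assms(1) by (intro mult_right_mono) auto
  finally show ?thesis .
qed

text \<open>The right-hand side has only bounded quantifiers over indices, so that a term can check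
  it; it is also the form in which three paths at one vertex give a contradiction.\<close>

lemma card_le_2_iff:
  fixes k :: nat
  shows "card {i. i < k \<and> Q i} \<le> 2 \<longleftrightarrow>
    (\<forall>i < k. \<forall>j < k. \<forall>l < k. Q i \<and> Q j \<and> Q l \<longrightarrow> i = j \<or> i = l \<or> j = l)"
proof -
  let ?A = "{i. i < k \<and> Q i}"
  have fin: "finite ?A" by simp
  show ?thesis
  proof
    assume c: "card ?A \<le> 2"
    show "\<forall>i < k. \<forall>j < k. \<forall>l < k. Q i \<and> Q j \<and> Q l \<longrightarrow> i = j \<or> i = l \<or> j = l"
    proof (intro allI impI)
      fix i j l assume a: "i < k" "j < k" "l < k" "Q i \<and> Q j \<and> Q l"
      show "i = j \<or> i = l \<or> j = l"
      proof (rule ccontr)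
        assume "\<not> (i = j \<or> i = l \<or> j = l)"
        then have "card {i, j, l} = 3" by auto
        moreover have "card {i, j, l} \<le> card ?A" by (rule card_mono[OF fin]) (use a in auto)
        ultimately show False using c by simp
      qed
    qed
  next
    assume a: "\<forall>i < k. \<forall>j < k. \<forall>l < k. Q i \<and> Q j \<and> Q l \<longrightarrow> i = j \<or> i = l \<or> j = l"
    show "card ?A \<le> 2"
    proof (rule ccontr)
      assume "\<not> card ?A \<le> 2"
      then have "3 \<le> card ?A" by simp
      then obtain B where "B \<subseteq> ?A" "card B = 3" by (meson obtain_subset_with_card_n)
      then obtain i j l where "i \<in> ?A" "j \<in> ?A" "l \<in> ?A" "i \<noteq> j" "i \<noteq> l" "j \<noteq> l"
        by (auto simp: card_3_iff)
      then show False using a by blast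
    qed
  qed
qed

lemma card_le_2_contra:
  fixes a b c k :: nat
  assumes "card {i. i < k \<and> P i} \<le> 2" "a < k" "b < k" "c < k" "P a" "P b" "P c"
    "a \<noteq> b" "a \<noteq> c" "b \<noteq> c"
  shows False
  using assms unfolding card_le_2_iff by blast

lemma successively_upt:
  assumes "\<And>c. Suc c < N \<Longrightarrow> P (f c) (f (Suc c))"
  shows "successively P (map f [0..<N])"
  using assms
proof (induction N)
  case (Suc N)
  then show ?case by (cases N) (auto simp: successively_append_iff)
qed simp

text \<open>The number \<open>v * D + d\<close> encodes the literal \<open>\<sigma> v \<noteq> d\<close>.\<close>
definition csp_sat :: "nat \<Rightarrow> nat \<Rightarrow> nat \<Rightarrow> (nat \<Rightarrow> nat \<Rightarrow> bool) \<Rightarrow> bool" where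
  "csp_sat V D C lit \<longleftrightarrow> (\<exists>\<sigma>. (\<forall>v < V. \<sigma> v < D) \<and>
     (\<forall>c < C. \<exists>v < V. \<exists>d < D. lit c (v * D + d) \<and> \<sigma> v \<noteq> d))"

text \<open>
  The vertices are, in this order: the occurrences \<open>c * (V * D) + y\<close> of the literals \<open>y\<close>, the
  sources of the clauses, the sources of the variables, the \<open>m\<close> hubs, the targets of the clauses,
  the targets of the variables.
\<close>
locale csp_graph =
  fixes V D C m :: nat and lit :: "nat \<Rightarrow> nat \<Rightarrow> bool"
  assumes pos: "0 < C" "2 \<le> m"
begin

definition Y :: nat where "Y = V * D"
definition W :: nat where "W = C * Y"
definition h :: nat where "h = W + C + V"
definition k :: nat where "k = h + m"
definition n :: nat where "n = k + C + V"

definition hub :: "nat \<Rightarrow> bool" where "hub i \<longleftrightarrow> h \<le> i \<and> i < k"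

text \<open>Only the arcs of clause paths depend on \<open>lit\<close>. The path of a variable
  visits its value in every clause, whether or not that literal occurs there; so all chains have the
  same length \<open>C\<close>.\<close>

definition arc0 :: "nat \<Rightarrow> nat \<Rightarrow> bool" where
  "arc0 i j \<longleftrightarrow> (\<exists>c < C. \<exists>v < V. \<exists>d < D.
     i = W + c \<and> j = c * Y + (v * D + d) \<and> lit c (v * D + d) \<or>
     i = c * Y + (v * D + d) \<and> j = k + c \<and> lit c (v * D + d) \<or>
     i = W + C + v \<and> j = c * Y + (v * D + d) \<and> c = 0 \<or>
     i = c * Y + (v * D + d) \<and> j = k + C + v \<and> Suc c = C \<or>
     i = c * Y + (v * D + d) \<and> j = Suc c * Y + (v * D + d) \<and> Suc c < C)"

definition G :: "nat pair_pre_digraph" where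
  "G = \<lparr>pverts = {..<n},
     parcs = {(i, j). i < n \<and> j < n \<and> i \<noteq> j \<and> (hub i \<or> hub j \<or> arc0 i j)}\<rparr>"

text \<open>The shift by \<open>C + V + m\<close> takes \<open>W + c\<close> to \<open>k + c\<close>
  and \<open>W + C + v\<close> to \<open>k + C + v\<close>, because
  \<open>k = W + C + V + m\<close>. The last two cases form the cycle through the hubs.\<close>

definition tgt :: "nat \<Rightarrow> nat" where
  "tgt i = (if i < W then i else if i < h then i + (C + V + m) else if Suc i < k then Suc i else h)"

definition S :: "nat list" where "S = [0..<k]"
definition T :: "nat list" where "T = map tgt [0..<k]"

lemma wf: "pair_wf_digraph G" "pair_digraph G"
proof -
  show 1: "pair_wf_digraph G" by unfold_locales (auto simp: G_def)
  have "parcs G \<subseteq> {..<n} \<times> {..<n}" by (auto simp: G_def)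
  then have "finite (parcs G)" by (rule finite_subset) simp
  then show "pair_digraph G" using 1
    by (auto simp: pair_digraph_def pair_fin_digraph_def pair_fin_digraph_axioms_def
        pair_loopfree_digraph_def pair_loopfree_digraph_axioms_def) (auto simp: G_def)
qed

lemma verts: "pverts G = {..<n}" "card (pverts G) = n"
  by (simp_all add: G_def)

lemma instance_encoded: "encoded_instance G S T"
proof -
  have le: "h \<le> k" "k \<le> n" "W \<le> h" "h = W + C + V" "k = h + m" "n = k + C + V"
    by (auto simp: h_def k_def n_def)
  have "inj_on tgt {0..<k}"
    by (rule inj_onI) (use le pos in \<open>auto simp: tgt_def split: if_splits\<close>)
  moreover have "tgt i < n" if "i < k" for i
    using that le pos by (auto simp: tgt_def)
  ultimately show ?thesis
    using wf le by (auto simp: encoded_instance_def linkage_instance_def verts S_def T_def distinct_map)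
qed

text \<open>A hub in \<open>A - B\<close> would send an arc to every vertex of \<open>B - A\<close>,
  and a hub in \<open>B - A\<close> would receive one from every vertex of \<open>A - B\<close>.
  Both sets are nonempty if the separation is nontrivial, so all hubs lie in
  \<open>A \<inter> B\<close>.\<close>

lemma connected:
  assumes "\<epsilon> < 1" "\<epsilon> * real k \<le> real m"
  shows "strongly_m_connected (\<epsilon> * real (length S)) G"
proof -
  have "separation_order A B \<ge> m" if s: "separation G A B" and nt: "\<not> trivial_separation A B" for A B
  proof -
    obtain u v where uv: "u \<in> A - B" "v \<in> B - A" using nt by (auto simp: trivial_separation_def)
    have AB: "A \<union> B = {..<n}" "A \<subseteq> {..<n}" "B \<subseteq> {..<n}"
      and no: "\<And>u v. (u, v) \<in> parcs G \<Longrightarrow> u \<in> A - B \<Longrightarrow> v \<in> B - A \<Longrightarrow> False"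
      using s by (auto simp: separation_def verts)
    have "{h..<k} \<subseteq> A \<inter> B"
    proof
      fix x assume x: "x \<in> {h..<k}"
      then have hx: "hub x" "x \<in> A \<union> B" using AB(1) by (auto simp: hub_def n_def)
      show "x \<in> A \<inter> B"
      proof (rule ccontr)
        assume "x \<notin> A \<inter> B"
        then consider "x \<in> A - B" | "x \<in> B - A" using hx(2) by blast
        then show False
        proof cases
          case 1
          moreover have "(x, v) \<in> parcs G" using 1 uv AB hx(1) by (auto simp: G_def)
          ultimately show False using no uv by blast
        next
          case 2
          moreover have "(u, x) \<in> parcs G" using 2 uv AB hx(1) by (auto simp: G_def)
          ultimately show False using no uv by blast
        qed
      qed
    qed
    moreover have "finite (A \<inter> B)" using AB by (meson finite_Int finite_lessThan finite_subset)
    ultimately have "card {h..<k} \<le> card (A \<inter> B)" by (rule card_mono[rotated])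
    then show ?thesis by (simp add: separation_order_def k_def)
  qed
  moreover have "real n \<ge> real m + 1" using pos by (simp add: n_def k_def h_def)
  ultimately show ?thesis using assms
    by (force simp: strongly_m_connected_def verts S_def)
qed

section \<open>Arcs that avoid the hubs\<close>

lemma occ_lt:
  assumes "c < C" "v < V" "d < D"
  shows "v * D + d < Y \<and> c * Y + (v * D + d) < W"
  unfolding W_def Y_def using assms by (intro conjI nat_digits_less)

lemma occ_inject:
  assumes "c * Y + (v * D + d) = c' * Y + (v' * D + d')"
    "c < C" "v < V" "d < D" "c' < C" "v' < V" "d' < D"
  shows "c = c' \<and> v = v' \<and> d = d'"
  using nat_digits[OF assms(1)] nat_digits[of v D d v' d'] occ_lt assms by blast

lemma layout: "W \<le> h" "h < k" "k < n" "h = W + C + V" "k = h + m" "n = k + C + V"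
  using pos by (auto simp: h_def k_def n_def)

lemma arc_no_hub:
  assumes "(i, j) \<in> parcs G" "\<not> hub i" "\<not> hub j"
  shows "arc0 i j"
  using assms by (auto simp: G_def)

text \<open>The blocks of the vertex numbering are disjoint. Hence the tail of an arc tells which of
  the cases of \<open>arc0\<close> it comes from; the same holds in the next three lemmas.\<close>

lemma arc_clause_source:
  assumes "arc0 (W + c) j" "c < C"
  shows "\<exists>v < V. \<exists>d < D. j = c * Y + (v * D + d) \<and> lit c (v * D + d)"
proof -
  obtain c' v d where a: "c' < C" "v < V" "d < D"
     "W + c = W + c' \<and> j = c' * Y + (v * D + d) \<and> lit c' (v * D + d) \<or>
     W + c = c' * Y + (v * D + d) \<or> W + c = W + C + v"
    using assms(1) unfolding arc0_def by blast
  then show ?thesis using occ_lt[OF a(1-3)] assms(2) by auto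
qed

lemma arc_var_source:
  assumes "arc0 (W + C + v) j" "v < V"
  shows "\<exists>d < D. j = v * D + d"
proof -
  obtain c' v' d where a: "c' < C" "v' < V" "d < D"
     "W + C + v = W + c' \<or>
     W + C + v = c' * Y + (v' * D + d) \<or> (W + C + v = W + C + v' \<and> j = c' * Y + (v' * D + d) \<and> c' = 0)"
    using assms(1) unfolding arc0_def by blast
  then show ?thesis using occ_lt[OF a(1-3)] assms(2) by auto
qed

lemma arc_occ:
  assumes "arc0 (c * Y + (v * D + d)) j" "c < C" "v < V" "d < D"
  shows "j = k + c \<or> j = k + C + v \<and> Suc c = C \<or> j = Suc c * Y + (v * D + d) \<and> Suc c < C"
proof -
  obtain c' v' d' where a: "c' < C" "v' < V" "d' < D"
     "c * Y + (v * D + d) = W + c' \<or> c * Y + (v * D + d) = W + C + v' \<or>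
      c * Y + (v * D + d) = c' * Y + (v' * D + d') \<and>
       (j = k + c' \<or> j = k + C + v' \<and> Suc c' = C \<or> j = Suc c' * Y + (v' * D + d') \<and> Suc c' < C)"
    using assms(1) unfolding arc0_def by blast
  have "c * Y + (v * D + d) < W" using occ_lt assms by blast
  then have "c * Y + (v * D + d) = c' * Y + (v' * D + d')" and
    j: "j = k + c' \<or> j = k + C + v' \<and> Suc c' = C \<or> j = Suc c' * Y + (v' * D + d') \<and> Suc c' < C"
    using a(4) by auto
  then have "c = c' \<and> v = v' \<and> d = d'" using occ_inject assms(2-4) a(1-3) by blast
  then show ?thesis using j by blast
qed

lemma arc_target: "\<not> arc0 (k + i) j"
proof
  assume "arc0 (k + i) j"
  then obtain c v d where a: "c < C" "v < V" "d < D"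
    "k + i = W + c \<or> k + i = c * Y + (v * D + d) \<or> k + i = W + C + v"
    unfolding arc0_def by blast
  then show False using occ_lt[OF a(1-3)] layout by auto
qed

text \<open>The value of a variable is the one at which its path enters the occurrences of clause 0;
  an induction along the clauses shows that the path then keeps to that value. The occurrence on a
  clause path is not on this chain, by capacity, so it belongs to a true literal.\<close>

lemma feasible_imp_sat:
  assumes "half_integrally_feasible G S T"
  shows "csp_sat V D C lit"
proof -
  obtain Q where Q': "\<forall>i < k. vpath G (S ! i) (Q i) (T ! i)"
    and cd': "\<forall>v \<in> pverts G. card {i. i < k \<and> v \<in> set (Q i)} \<le> 2"
    using assms unfolding half_integrally_feasible_iff[OF wf(1)] by (auto simp: S_def)
  have Q: "vpath G i (Q i) (tgt i)" if "i < k" for i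
    using Q' that by (simp add: S_def T_def)
  have cd: "card {i. i < k \<and> v \<in> set (Q i)} \<le> 2" if "v < n" for v
    using cd' that by (simp add: verts)
  have nohub: "\<not> hub x" if i: "i < h" and x: "x \<in> set (Q i)" for i x
  proof
    assume hx: "hub x"
    \<comment> \<open>The predecessor of the hub \<open>x\<close> in the cycle. The paths of
      \<open>x\<close> and \<open>p\<close> both contain \<open>x\<close>, so the path of
      \<open>i\<close> would be the third; \<open>2 \<le> m\<close> makes \<open>p\<close> differ
      from \<open>x\<close>.\<close>
    define p where "p = (if x = h then k - 1 else x - 1)"
    have p: "p < k" "h \<le> p" "tgt p = x" "p \<noteq> x" "\<not> p < W" "\<not> p < h"
      using hx layout pos by (auto simp: p_def hub_def tgt_def)
    have "x < k" "x < n" "x \<noteq> i" "i \<noteq> p" "i < k" using hx i layout p by (auto simp: hub_def)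
    then show False
      using card_le_2_contra[OF cd[of x], of i x p] vpath_ends(1)[OF Q[of x]]
        vpath_ends(2)[OF Q[of p]] x p by auto
  qed
  have disj: "\<not> (x \<in> set (Q i) \<and> x \<in> set (Q j))" if "x < W" "W \<le> i" "W \<le> j" "i \<noteq> j" "i < k" "j < k" for x i j
  proof
    assume "x \<in> set (Q i) \<and> x \<in> set (Q j)"
    then show False
      using card_le_2_contra[OF cd[of x], of x i j] vpath_ends(1)[OF Q[of x]] that layout by auto
  qed
  have step: "\<exists>y \<in> set (Q i). arc0 x y" if st: "W \<le> i" "i < h" "x \<in> set (Q i)" "x \<noteq> tgt i" for i x
  proof -
    obtain y where y: "y \<in> set (Q i)" "(x, y) \<in> parcs G"
      using vpath_successor[OF Q st(3,4)] st layout by auto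
    then show ?thesis using arc_no_hub nohub st by blast
  qed
  have chain: "\<exists>d < D. \<forall>c < C. c * Y + (v * D + d) \<in> set (Q (W + C + v))" if v: "v < V" for v
  proof -
    let ?i = "W + C + v"
    have i: "W \<le> ?i" "?i < h" "?i < k" "tgt ?i = k + C + v" "?i \<noteq> tgt ?i"
      using v layout by (auto simp: tgt_def)
    obtain y where "y \<in> set (Q ?i)" "arc0 ?i y"
      using step[OF i(1,2) vpath_ends(1)[OF Q[OF i(3)]] i(5)] by blast
    then obtain d where d: "d < D" "v * D + d \<in> set (Q ?i)" using arc_var_source v by blast
    have "c < C \<longrightarrow> c * Y + (v * D + d) \<in> set (Q ?i)" for c
    proof (induction c)
      case 0
      then show ?case using d by simp
    next
      case (Suc c)
      show ?case
      proof
        assume c: "Suc c < C"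
        then have x: "c * Y + (v * D + d) \<in> set (Q ?i)" using Suc by simp
        have "c * Y + (v * D + d) < W" using occ_lt c v d by simp
        then have "c * Y + (v * D + d) \<noteq> tgt ?i" using i(4) layout by auto
        then obtain y where y: "y \<in> set (Q ?i)" "arc0 (c * Y + (v * D + d)) y"
          using step[OF i(1,2) x] by blast
        \<comment> \<open>The path could leave the chain towards the target of the clause, but that
          is a dead end: only hubs follow a target, and the path is not finished there.\<close>
        have "y \<noteq> k + c"
        proof
          assume e: "y = k + c"
          then have "y \<noteq> tgt ?i" using c i(4) by auto
          then show False using step[OF i(1,2) y(1)] e arc_target by blast
        qed
        then show "Suc c * Y + (v * D + d) \<in> set (Q ?i)"
          using arc_occ[OF y(2)] c v d y(1) by auto
      qed
    qed
    then show ?thesis using d(1) by blast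
  qed
  then obtain \<sigma> where \<sigma>: "\<And>v. v < V \<Longrightarrow> \<sigma> v < D"
    "\<And>v c. v < V \<Longrightarrow> c < C \<Longrightarrow> c * Y + (v * D + \<sigma> v) \<in> set (Q (W + C + v))"
    by metis
  have "\<exists>v < V. \<exists>d < D. lit c (v * D + d) \<and> \<sigma> v \<noteq> d" if c: "c < C" for c
  proof -
    let ?i = "W + c"
    have i: "W \<le> ?i" "?i < h" "?i < k" "tgt ?i = k + c" "?i \<noteq> tgt ?i"
      using c layout by (auto simp: tgt_def)
    obtain y where y: "y \<in> set (Q ?i)" "arc0 ?i y"
      using step[OF i(1,2) vpath_ends(1)[OF Q[OF i(3)]] i(5)] by blast
    then obtain v d where vd: "v < V" "d < D" "y = c * Y + (v * D + d)" "lit c (v * D + d)"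
      using arc_clause_source c by blast
    have "\<sigma> v \<noteq> d"
    proof
      assume "\<sigma> v = d"
      then have "y \<in> set (Q (W + C + v))" using \<sigma>(2) vd c by blast
      moreover have "y < W" using occ_lt vd c by simp
      ultimately show False using disj[of y ?i "W + C + v"] y(1) i c vd(1) layout by simp
    qed
    then show ?thesis using vd by blast
  qed
  then show ?thesis unfolding csp_sat_def using \<sigma>(1) by blast
qed

section \<open>Paths from a satisfying assignment\<close>

lemma arc0_arc:
  assumes "arc0 i j"
  shows "(i, j) \<in> parcs G"
proof -
  obtain c v d where a: "c < C" "v < V" "d < D"
    "i = W + c \<and> j = c * Y + (v * D + d) \<or>
     i = c * Y + (v * D + d) \<and> j = k + c \<or>
     i = W + C + v \<and> j = c * Y + (v * D + d) \<or>
     i = c * Y + (v * D + d) \<and> j = k + C + v \<or>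
     i = c * Y + (v * D + d) \<and> j = Suc c * Y + (v * D + d) \<and> Suc c < C"
    using assms unfolding arc0_def by blast
  have "Suc c < C \<Longrightarrow> Suc c * Y + (v * D + d) < W" "c * Y + (v * D + d) < W" "0 < Y"
    using occ_lt a by (blast, blast, force)
  then have "i < n \<and> j < n \<and> i \<noteq> j" using a layout by auto
  then show ?thesis using assms by (simp add: G_def)
qed

lemma region_cases:
  obtains "i < W" | c where "c < C" "i = W + c" | v where "v < V" "i = W + C + v" | "h \<le> i"
proof -
  consider "i < W" | "W \<le> i" "i < W + C" | "W + C \<le> i" "i < h" | "h \<le> i" by linarith
  then show thesis
  proof cases
    case 1
    then show ?thesis using that(1) by blast
  next
    case 2
    then show ?thesis using that(2)[of "i - W"] by simp
  next
    case 3
    then show ?thesis using that(3)[of "i - (W + C)"] layout(4) by simp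
  next
    case 4
    then show ?thesis using that(4) by blast
  qed
qed

text \<open>The bound 2 comes from \<open>uniq\<close>: a vertex is the source of at most one path,
  the one with its own number, and lies on at most one further path.\<close>

lemma sat_imp_feasible:
  assumes "csp_sat V D C lit"
  shows "half_integrally_feasible G S T"
proof -
  obtain \<sigma> where \<sigma>: "\<And>v. v < V \<Longrightarrow> \<sigma> v < D"
    and ex: "\<And>c. c < C \<Longrightarrow> \<exists>v < V. \<exists>d < D. lit c (v * D + d) \<and> \<sigma> v \<noteq> d"
    using assms unfolding csp_sat_def by auto
  then obtain cv cd where cvd: "\<And>c. c < C \<Longrightarrow> cv c < V \<and> cd c < D \<and>
      lit c (cv c * D + cd c) \<and> \<sigma> (cv c) \<noteq> cd c"
    by metis
  define oc where "oc c = c * Y + (cv c * D + cd c)" for c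
  define ov where "ov v c = c * Y + (v * D + \<sigma> v)" for v c
  have ocW: "oc c < W" if "c < C" for c using occ_lt cvd that by (simp add: oc_def)
  have ovW: "ov v c < W" if "v < V" "c < C" for v c using occ_lt \<sigma> that by (simp add: ov_def)
  define Q where "Q i = (if i < W then [i]
      else if i < W + C then [i, oc (i - W), k + (i - W)]
      else if i < h then i # map (ov (i - W - C)) [0..<C] @ [k + C + (i - W - C)]
      else [i, tgt i])" for i
  have ocov: "oc c \<noteq> ov v c'" if "c < C" "c' < C" "v < V" for c c' v
  proof
    assume "oc c = ov v c'"
    then have "cv c = v \<and> cd c = \<sigma> v"
      unfolding oc_def ov_def using occ_inject cvd \<sigma> that by blast
    then show False using cvd[OF that(1)] by auto
  qed
  have path: "vpath G i (Q i) (tgt i)" if i: "i < k" for i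
  proof -
    show ?thesis
    proof (cases i rule: region_cases)
      case 1
      then show ?thesis using layout by (auto simp: vpath_def Q_def tgt_def verts)
    next
      case (2 c)
      have "arc0 i (oc c)" "arc0 (oc c) (k + c)"
        unfolding arc0_def oc_def using 2 cvd by blast+
      then have "(i, oc c) \<in> parcs G" "(oc c, k + c) \<in> parcs G" using arc0_arc by auto
      then show ?thesis using 2 layout ocW[of c] i
        by (auto simp: vpath_def Q_def tgt_def verts)
    next
      case (3 v)
      have a: "arc0 i (ov v 0)" "arc0 (ov v (C - 1)) (k + C + v)"
      proof -
        show "arc0 i (ov v 0)" unfolding arc0_def ov_def
          by (intro exI[of _ 0] exI[of _ v] exI[of _ "\<sigma> v"] conjI) (use 3 \<sigma> pos in simp_all)
        show "arc0 (ov v (C - 1)) (k + C + v)" unfolding arc0_def ov_def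
          by (intro exI[of _ "C - 1"] exI[of _ v] exI[of _ "\<sigma> v"] conjI) (use 3 \<sigma> pos in simp_all)
      qed
      have a': "arc0 (ov v c) (ov v (Suc c))" if "Suc c < C" for c
        unfolding arc0_def ov_def
        by (intro exI[of _ c] exI[of _ v] exI[of _ "\<sigma> v"] conjI) (use 3 \<sigma> that in simp_all)
      have ch: "successively (\<lambda>a b. (a, b) \<in> parcs G) (map (ov v) [0..<C])"
        by (rule successively_upt) (use a' arc0_arc in blast)
      have C: "[0..<C] \<noteq> []" "hd (map (ov v) [0..<C]) = ov v 0" "last (map (ov v) [0..<C]) = ov v (C - 1)"
        using pos by (simp_all add: hd_map last_map)
      have "inj_on (ov v) {0..<C}"
      proof (rule inj_onI)
        fix c c' assume "c \<in> {0..<C}" "c' \<in> {0..<C}" "ov v c = ov v c'"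
        then show "c = c'" unfolding ov_def using occ_inject[of c v "\<sigma> v" c' v "\<sigma> v"] 3 \<sigma> by simp
      qed
      then have "distinct (map (ov v) [0..<C])" by (simp add: distinct_map)
      moreover have "Q i = i # map (ov v) [0..<C] @ [k + C + v]" "tgt i = k + C + v"
        using 3 layout by (auto simp: Q_def tgt_def)
      moreover have "successively (\<lambda>a b. (a, b) \<in> parcs G) (i # map (ov v) [0..<C] @ [k + C + v])"
        using ch C arc0_arc[OF a(1)] arc0_arc[OF a(2)]
        by (simp add: successively_append_iff successively_Cons)
      moreover have r: "x < W" if "x \<in> ov v ` {0..<C}" for x using ovW 3 that by auto
      have "i \<notin> ov v ` {0..<C}" "k + C + v \<notin> ov v ` {0..<C}"
        using r[of i] r[of "k + C + v"] 3(2) layout by (linarith, linarith)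
      moreover have "ov v ` {0..<C} \<subseteq> {..<n}" using r layout by fastforce
      moreover have "i < n" "k + C + v < n" "i \<noteq> k + C + v" using 3 layout by auto
      ultimately show ?thesis by (simp add: vpath_def verts)
    next
      case 4
      then have "hub i" "hub (tgt i)" "tgt i \<noteq> i"
        using i pos layout by (auto simp: hub_def tgt_def)
      then show ?thesis using 4 layout i
        by (auto simp: vpath_def Q_def verts G_def hub_def)
    qed
  qed
  have mem: "(\<exists>c < C. i = W + c \<and> (x = oc c \<or> x = k + c)) \<or>
      (\<exists>v < V. i = W + C + v \<and> ((\<exists>c < C. x = ov v c) \<or> x = k + C + v)) \<or> (h \<le> i \<and> x = tgt i)"
    if "i < k" "x \<in> set (Q i)" "x \<noteq> i" for i x
  proof -
    show ?thesis
    proof (cases i rule: region_cases)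
      case 3
      then show ?thesis using that layout by (auto simp: Q_def)
    qed (use that layout in \<open>auto simp: Q_def\<close>)
  qed
  have hubtgt: "h \<le> tgt i \<and> tgt i < k" if "h \<le> i" "i < k" for i
    using that layout by (auto simp: tgt_def)
  have kinds: "k \<le> x \<and> i = x - k + W \<or> h \<le> x \<and> x < k \<and> h \<le> i \<and> tgt i = x \<or>
      x < W \<and> ((\<exists>c < C. i = W + c \<and> x = oc c) \<or> (\<exists>v < V. i = W + C + v \<and> (\<exists>c < C. x = ov v c)))"
    if "i < k" "x \<in> set (Q i)" "x \<noteq> i" for i x
    using mem[OF that]
  proof (elim disjE exE conjE)
    fix c assume "c < C" "i = W + c" "x = oc c"
    then show ?thesis using ocW by blast
  next
    fix v c assume "v < V" "i = W + C + v" "c < C" "x = ov v c"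
    then show ?thesis using ovW by blast
  next
    assume "h \<le> i" "x = tgt i"
    then show ?thesis using hubtgt that(1) by blast
  qed simp_all
  have oc_inj: "c = c'" if "oc c = oc c'" "c < C" "c' < C" for c c'
    using occ_inject cvd that unfolding oc_def by blast
  have ov_inj: "v = v'" if "ov v c = ov v' c'" "c < C" "c' < C" "v < V" "v' < V" for v v' c c'
    using occ_inject \<sigma> that unfolding ov_def by blast
  have tgt_inj: "i = j" if "tgt i = tgt j" "h \<le> i" "h \<le> j" "i < k" "j < k" for i j
    using that layout by (auto simp: tgt_def split: if_splits)
  have uniq: "i = j" if i: "i < k \<and> x \<in> set (Q i)" and j: "j < k \<and> x \<in> set (Q j)" and ne: "i \<noteq> x" "j \<noteq> x" for i j x
  proof -
    note 1 = kinds[of i x] and 2 = kinds[of j x]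
    consider (W) "x < W" | (hub) "h \<le> x" "x < k" | (k) "k \<le> x"
      using 1 i ne by blast
    then show ?thesis
    proof cases
      case W
      then have "\<not> k \<le> x" "\<not> h \<le> x" using layout by linarith+
      then have "(\<exists>c < C. i = W + c \<and> x = oc c) \<or> (\<exists>v < V. i = W + C + v \<and> (\<exists>c < C. x = ov v c))"
        "(\<exists>c < C. j = W + c \<and> x = oc c) \<or> (\<exists>v < V. j = W + C + v \<and> (\<exists>c < C. x = ov v c))"
        using 1 2 i j ne by blast+
      then show ?thesis using oc_inj ov_inj ocov by (elim disjE exE conjE) blast+
    next
      case hub
      then have "\<not> x < W" "\<not> k \<le> x" using layout by linarith+
      then show ?thesis using 1 2 i j ne tgt_inj by metis
    next
      case k
      then have "\<not> x < W" "\<not> x < k" using layout by linarith+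
      then show ?thesis using 1 2 i j ne by blast
    qed
  qed
  have "card {i. i < k \<and> x \<in> set (Q i)} \<le> 2" for x
    unfolding card_le_2_iff using uniq[of _ x] by metis
  then show ?thesis unfolding half_integrally_feasible_iff[OF wf(1)]
    using path by (intro exI[of _ Q]) (simp add: S_def T_def)
qed

end

section \<open>Computation tableaux\<close>

text \<open>
  A situation is a state together with the symbols read on the tapes. In a tableau, \<open>s 0 t 0 0\<close> is
  the index of the situation at time \<open>t\<close>, \<open>s 1 t j 0\<close> is the position of head \<open>j\<close>, \<open>s 2 t j p\<close> is
  the symbol at position \<open>p\<close> on tape \<open>j\<close>, and \<open>s 3 0 0 0\<close> is the length of the certificate.
  Positions are shifted by \<open>R\<close>, the number of steps.
\<close>
locale tableau =
  fixes M :: tm and R P B :: nat and x :: "bool list"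
  assumes wf: "wf_tm M" and two: "2 \<le> tm_tapes M"
begin

abbreviation "J \<equiv> tm_tapes M"

definition sits :: "(nat \<times> nat list) list" where
  "sits = List.product [0..<tm_states M] (List.n_lists J [0..<tm_symbols M])"

text \<open>Extended to the halting state by an action that changes nothing, so that a tableau
  always has \<open>R\<close> steps and its rules need no case for halting.\<close>

definition delta :: "nat \<times> nat list \<Rightarrow> nat \<times> (nat \<times> move) list" where
  "delta qs = (if fst qs = tm_halt M then (fst qs, map (\<lambda>a. (a, Stay)) (snd qs))
     else tm_trans M (fst qs) (snd qs))"

definition good_read :: "nat \<Rightarrow> nat \<Rightarrow> nat \<Rightarrow> bool" where
  "good_read l j a \<longleftrightarrow> l < length sits \<and> snd (sits ! l) ! j = a"

definition good_next :: "nat \<Rightarrow> nat \<Rightarrow> bool" where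
  "good_next l b \<longleftrightarrow> l < length sits \<and> b < length sits \<and> fst (sits ! b) = fst (delta (sits ! l))"

definition good_move :: "nat \<Rightarrow> nat \<Rightarrow> nat \<Rightarrow> nat \<Rightarrow> bool" where
  "good_move l j p p' \<longleftrightarrow> l < length sits \<and> int p' = move_pos (snd (snd (delta (sits ! l)) ! j)) (int p)"

definition good_write :: "nat \<Rightarrow> nat \<Rightarrow> nat \<Rightarrow> bool" where
  "good_write l j a \<longleftrightarrow> l < length sits \<and> fst (snd (delta (sits ! l)) ! j) = a"

definition good_init :: "nat \<Rightarrow> bool" where
  "good_init l \<longleftrightarrow> l < length sits \<and> fst (sits ! l) = 0"

definition good_x :: "nat \<Rightarrow> nat \<Rightarrow> bool" where
  "good_x p a \<longleftrightarrow> (if R \<le> p \<and> p < R + length x then a = bit_symbol (x ! (p - R)) else a = 0)"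

text \<open>The nondeterminism of a tableau sits here: the length and the bits of the certificate
  are free, whereas all else is determined by them.\<close>

definition good_u :: "nat \<Rightarrow> nat \<Rightarrow> nat \<Rightarrow> bool" where
  "good_u p a l \<longleftrightarrow> l \<le> P \<and> (if R \<le> p \<and> p < R + l then a = 1 \<or> a = 2 else a = 0)"

text \<open>Each condition relates at most three values of \<open>s\<close>. Acceptance is read from
  a single cell, position 0 of the output tape (\<open>R\<close> after the shift): as the verifier
  is assumed to output exactly one bit, this cell separates \<open>[True]\<close> from
  \<open>[False]\<close>.\<close>

definition valid :: "(nat \<Rightarrow> nat \<Rightarrow> nat \<Rightarrow> nat \<Rightarrow> nat) \<Rightarrow> bool" where
  "valid s \<longleftrightarrow>
     (\<forall>t \<le> R. \<forall>j < J. good_read (s 0 t 0 0) j (s 2 t j (s 1 t j 0))) \<and>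
     (\<forall>t < R. good_next (s 0 t 0 0) (s 0 (t + 1) 0 0)) \<and>
     (\<forall>t < R. \<forall>j < J. good_move (s 0 t 0 0) j (s 1 t j 0) (s 1 (t + 1) j 0)) \<and>
     (\<forall>t < R. \<forall>j < J. good_write (s 0 t 0 0) j (s 2 (t + 1) j (s 1 t j 0))) \<and>
     (\<forall>t < R. \<forall>j < J. \<forall>p < B. p \<noteq> s 1 t j 0 \<longrightarrow> s 2 (t + 1) j p = s 2 t j p) \<and>
     good_init (s 0 0 0 0) \<and>
     (\<forall>j < J. s 1 0 j 0 = R) \<and>
     (\<forall>p < B. good_x p (s 2 0 0 p)) \<and>
     (\<forall>p < B. good_u p (s 2 0 1 p) (s 3 0 0 0)) \<and>
     (\<forall>j < J. \<forall>p < B. 2 \<le> j \<longrightarrow> s 2 0 j p = 0) \<and>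
     s 2 R (J - 1) R = 2"

section \<open>Tableaux and the actual computation\<close>

definition cfg :: "bool list \<Rightarrow> nat \<Rightarrow> config" where
  "cfg u t = (tm_step M ^^ t) (tm_init M [x, u])"

lemma sits_nth:
  assumes "l < length sits"
  shows "fst (sits ! l) < tm_states M" "length (snd (sits ! l)) = J"
    "set (snd (sits ! l)) \<subseteq> {..<tm_symbols M}"
proof -
  have "sits ! l \<in> set sits" using assms by simp
  then show "fst (sits ! l) < tm_states M" "length (snd (sits ! l)) = J"
    "set (snd (sits ! l)) \<subseteq> {..<tm_symbols M}"
    by (auto simp: sits_def set_n_lists)
qed

lemma sits_ex:
  assumes "q < tm_states M" "length ss = J" "set ss \<subseteq> {..<tm_symbols M}"
  shows "\<exists>l < length sits. sits ! l = (q, ss)"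
proof -
  have "(q, ss) \<in> set sits"
    using assms by (auto simp: sits_def set_n_lists)
  then show ?thesis by (simp add: in_set_conv_nth)
qed

lemma delta_wf:
  assumes "q < tm_states M" "length ss = J" "set ss \<subseteq> {..<tm_symbols M}"
  shows "fst (delta (q, ss)) < tm_states M" "length (snd (delta (q, ss))) = J"
    "fst ` set (snd (delta (q, ss))) \<subseteq> {..<tm_symbols M}"
  using assms wf by (auto simp: delta_def wf_tm_def)

lemma step_delta:
  "tm_step M (q, ts) = (fst (delta (q, map tape_read ts)), map2 tape_act (snd (delta (q, map tape_read ts))) ts)"
proof (cases "q = tm_halt M")
  case True
  have "tape_act (tape_read t, Stay) t = t" for t by (simp add: tape_act_def tape_read_def)
  then have "map2 tape_act (map (\<lambda>a. (a, Stay)) (map tape_read ts)) ts = ts"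
    by (induction ts) auto
  then show ?thesis using True by (simp add: tm_step_def delta_def)
next
  case False
  then show ?thesis by (simp add: tm_step_def delta_def split: prod.splits)
qed

definition ok_cfg :: "config \<Rightarrow> bool" where
  "ok_cfg c \<longleftrightarrow> fst c < tm_states M \<and> length (snd c) = J \<and>
     (\<forall>j < J. \<forall>i. fst (snd c ! j) i < tm_symbols M)"

lemma ok_reads:
  assumes "ok_cfg c"
  shows "set (map tape_read (snd c)) \<subseteq> {..<tm_symbols M}"
proof
  fix a assume "a \<in> set (map tape_read (snd c))"
  then obtain j where "j < J" "a = tape_read (snd c ! j)"
    using assms by (auto simp: ok_cfg_def in_set_conv_nth)
  then show "a \<in> {..<tm_symbols M}" using assms by (simp add: ok_cfg_def tape_read_def)
qed

lemma ok_step: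
  assumes "ok_cfg c"
  shows "ok_cfg (tm_step M c)"
    and "j < J \<Longrightarrow> snd (tm_step M c) ! j =
      tape_act (snd (delta (fst c, map tape_read (snd c))) ! j) (snd c ! j)"
proof -
  obtain q ts where c: "c = (q, ts)" by fastforce
  have q: "q < tm_states M" "length ts = J" using assms by (auto simp: ok_cfg_def c)
  note d = delta_wf[OF q(1) _ ok_reads[OF assms], unfolded c, simplified, OF q(2)]
  show nth: "j < J \<Longrightarrow> snd (tm_step M c) ! j =
      tape_act (snd (delta (fst c, map tape_read (snd c))) ! j) (snd c ! j)" for j
    using d q by (simp add: c step_delta)
  have "fst (snd (delta (q, map tape_read ts)) ! j) < tm_symbols M" if "j < J" for j
    using d that by (metis imageI lessThan_iff nth_mem subsetD)
  then have "fst (snd (tm_step M c) ! j) i < tm_symbols M" if "j < J" for j i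
    using nth[OF that] that assms by (simp add: tape_act_def c ok_cfg_def)
  then show "ok_cfg (tm_step M c)"
    using d q by (simp add: ok_cfg_def c step_delta)
qed

lemma cfg_0: "cfg u 0 = tm_init M [x, u]"
  by (simp add: cfg_def)

lemma cfg_Suc: "cfg u (Suc t) = tm_step M (cfg u t)"
  by (simp add: cfg_def)

lemma ok_cfg: "ok_cfg (cfg u t)"
proof (induction t)
  case 0
  have "3 \<le> tm_symbols M" "0 < tm_states M" using wf by (auto simp: wf_tm_def)
  then show ?case
    by (auto simp: cfg_0 ok_cfg_def tm_init_def string_contents_def bit_symbol_def)
next
  case (Suc t)
  then show ?case using ok_step(1) by (simp add: cfg_Suc)
qed

lemma init_tape:
  assumes "j < J"
  shows "snd (cfg u 0) ! j = (string_contents (if j = 0 then x else if j = 1 then u else []), 0)"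
  using assms by (auto simp: cfg_0 tm_init_def less_Suc_eq nth_Cons')

text \<open>Within \<open>R\<close> steps the heads stay between \<open>-R\<close> and
  \<open>R\<close>; after the shift by \<open>R\<close> these positions are natural numbers up to
  \<open>2 * R\<close>.\<close>

lemma head_bound: "j < J \<Longrightarrow> \<bar>snd (snd (cfg u t) ! j)\<bar> \<le> int t"
proof (induction t)
  case 0
  then show ?case by (simp add: init_tape)
next
  case (Suc t)
  have "\<bar>move_pos m i\<bar> \<le> \<bar>i\<bar> + 1" for m i by (cases m) auto
  from this[of "snd (snd (delta (fst (cfg u t), map tape_read (snd (cfg u t)))) ! j)"
      "snd (snd (cfg u t) ! j)"]
  show ?case using ok_step(2)[OF ok_cfg Suc.prems, of u t] Suc by (simp add: cfg_Suc tape_act_def)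
qed

definition agrees :: "(nat \<Rightarrow> nat \<Rightarrow> nat \<Rightarrow> nat \<Rightarrow> nat) \<Rightarrow> bool list \<Rightarrow> nat \<Rightarrow> bool" where
  "agrees s u t \<longleftrightarrow> s 0 t 0 0 < length sits \<and> fst (sits ! s 0 t 0 0) = fst (cfg u t) \<and>
     (\<forall>j < J. int (s 1 t j 0) = snd (snd (cfg u t) ! j) + int R) \<and>
     (\<forall>j < J. \<forall>p < B. s 2 t j p = fst (snd (cfg u t) ! j) (int p - int R))"

text \<open>\<open>agrees\<close> fixes only the state of the situation. The symbols in it are fixed
  by \<open>good_read\<close>, which ties each of them to the cell under the head.\<close>

lemma agrees_sit:
  assumes v: "valid s" and B: "\<And>t j. s 1 t j 0 < B" and a: "agrees s u t" "t \<le> R"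
  shows "sits ! s 0 t 0 0 = (fst (cfg u t), map tape_read (snd (cfg u t)))"
proof -
  let ?l = "s 0 t 0 0"
  have l: "?l < length sits" "fst (sits ! ?l) = fst (cfg u t)" using a by (auto simp: agrees_def)
  have "snd (sits ! ?l) = map tape_read (snd (cfg u t))"
  proof (rule nth_equalityI)
    show len: "length (snd (sits ! ?l)) = length (map tape_read (snd (cfg u t)))"
      using sits_nth(2)[OF l(1)] ok_cfg by (simp add: ok_cfg_def)
    fix j assume "j < length (snd (sits ! ?l))"
    then have j: "j < J" using sits_nth(2)[OF l(1)] by simp
    have "snd (sits ! ?l) ! j = s 2 t j (s 1 t j 0)"
      using v a(2) j unfolding valid_def good_read_def by blast
    also have "\<dots> = fst (snd (cfg u t) ! j) (int (s 1 t j 0) - int R)"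
      using a(1) j B by (simp add: agrees_def)
    also have "int (s 1 t j 0) - int R = snd (snd (cfg u t) ! j)"
      using a(1) j by (simp add: agrees_def)
    finally show "snd (sits ! ?l) ! j = map tape_read (snd (cfg u t)) ! j"
      using j ok_cfg[of u t] by (simp add: tape_read_def ok_cfg_def)
  qed
  then show ?thesis using l(2) by (metis prod.collapse)
qed

lemma move_pos_shift: "move_pos m (i + k) = move_pos m i + k"
  by (cases m) auto

text \<open>The certificate is read off tape 1 at time 0. From then on the rules leave no choice:
  the state, the heads and the cells at time \<open>t + 1\<close> follow from those at time
  \<open>t\<close>.\<close>

lemma agrees_all:
  assumes v: "valid s" and B: "\<And>k t j p. s k t j p < B"
    and u: "u = map (\<lambda>i. s 2 0 1 (R + i) = 2) [0..<s 3 0 0 0]" and PB: "R + P \<le> B" "0 < B"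
  shows "t \<le> R \<Longrightarrow> agrees s u t"
proof (induction t)
  case 0
  have "good_u 0 (s 2 0 1 0) (s 3 0 0 0)" using v PB by (auto simp: valid_def)
  then have len: "s 3 0 0 0 \<le> P" by (simp add: good_u_def)
  have init: "good_init (s 0 0 0 0)" "\<And>j. j < J \<Longrightarrow> s 1 0 j 0 = R" using v by (auto simp: valid_def)
  have cell: "s 2 0 j p = string_contents (if j = 0 then x else if j = 1 then u else []) (int p - int R)"
    if "j < J" "p < B" for j p
  proof -
    have pR: "0 \<le> int p - int R \<longleftrightarrow> R \<le> p" "nat (int p - int R) = p - R"
      "p - R < n \<longleftrightarrow> p < R + n \<or> p < R" if "R \<le> p" for n :: nat
      using that by auto
    consider "j = 0" | "j = 1" | "2 \<le> j" by linarith
    then show ?thesis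
    proof cases
      case 1
      have "good_x p (s 2 0 0 p)" using v that by (auto simp: valid_def)
      then show ?thesis using 1 pR by (cases "R \<le> p") (auto simp: good_x_def string_contents_def split: if_splits)
    next
      case 2
      have "good_u p (s 2 0 1 p) (s 3 0 0 0)" using v that by (auto simp: valid_def)
      then show ?thesis using 2 pR
        by (cases "R \<le> p") (auto simp: good_u_def string_contents_def u bit_symbol_def split: if_splits)
    next
      case 3
      then have "s 2 0 j p = 0" using v that by (auto simp: valid_def)
      then show ?thesis using 3 by (auto simp: string_contents_def)
    qed
  qed
  have "fst (cfg u 0) = 0" by (simp add: cfg_0 tm_init_def)
  then show ?case using init cell init_tape by (simp add: agrees_def good_init_def)
next
  case (Suc t)
  then have a: "agrees s u t" and t: "t < R" "t \<le> R" by auto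
  let ?l = "s 0 t 0 0"
  note sit = agrees_sit[OF v B a t(2)]
  have ok: "ok_cfg (cfg u t)" by (rule ok_cfg)
  have nth: "snd (cfg u (Suc t)) ! j = tape_act (snd (delta (sits ! ?l)) ! j) (snd (cfg u t) ! j)"
    if "j < J" for j
    unfolding cfg_Suc sit by (rule ok_step(2)[OF ok that])
  have st: "fst (cfg u (Suc t)) = fst (delta (sits ! ?l))"
    unfolding cfg_Suc sit by (metis step_delta prod.collapse fst_conv)
  have "good_next ?l (s 0 (Suc t) 0 0)" using v t by (auto simp: valid_def)
  moreover have "int (s 1 (Suc t) j 0) = snd (snd (cfg u (Suc t)) ! j) + int R" if "j < J" for j
  proof -
    have "good_move ?l j (s 1 t j 0) (s 1 (Suc t) j 0)" using v t that by (auto simp: valid_def)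
    then have "int (s 1 (Suc t) j 0) = move_pos (snd (snd (delta (sits ! ?l)) ! j)) (int (s 1 t j 0))"
      by (simp add: good_move_def)
    also have "int (s 1 t j 0) = snd (snd (cfg u t) ! j) + int R" using a that by (simp add: agrees_def)
    finally show ?thesis using nth[OF that] by (simp add: move_pos_shift tape_act_def)
  qed
  moreover have "s 2 (Suc t) j p = fst (snd (cfg u (Suc t)) ! j) (int p - int R)"
    if j: "j < J" and p: "p < B" for j p
  proof -
    have h: "int (s 1 t j 0) = snd (snd (cfg u t) ! j) + int R" using a j by (simp add: agrees_def)
    show ?thesis
    proof (cases "p = s 1 t j 0")
      case True
      have "good_write ?l j (s 2 (Suc t) j p)" using v t j True by (auto simp: valid_def)
      then show ?thesis using nth[OF j] True h by (simp add: good_write_def tape_act_def)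
    next
      case False
      then have "s 2 (Suc t) j p = s 2 t j p" using v t j p by (auto simp: valid_def)
      then show ?thesis using nth[OF j] False h a j p by (auto simp: agrees_def tape_act_def)
    qed
  qed
  ultimately show ?case using st by (simp add: agrees_def good_next_def)
qed

lemma valid_imp_accept:
  assumes v: "valid s" and B: "\<And>k t j p. s k t j p < B" and PB: "R + P \<le> B" "R < B"
    and out: "\<And>u. length u \<le> P \<Longrightarrow> \<exists>b. tm_outputs M [x, u] R [b]"
  shows "\<exists>u. length u \<le> P \<and> tm_outputs M [x, u] R [True]"
proof -
  define u where "u = map (\<lambda>i. s 2 0 1 (R + i) = 2) [0..<s 3 0 0 0]"
  have a: "agrees s u R" by (rule agrees_all[OF v B u_def PB(1)]) (use PB in auto)
  have "good_u 0 (s 2 0 1 0) (s 3 0 0 0)" using v PB by (auto simp: valid_def)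
  then have len: "length u \<le> P" by (simp add: good_u_def u_def)
  obtain b where b: "tm_outputs M [x, u] R [b]" using out[OF len] by blast
  have J: "J - 1 < J" using two by simp
  have "last (snd (cfg u R)) = snd (cfg u R) ! (J - 1)"
    using ok_cfg[of u R] two by (subst last_conv_nth) (auto simp: ok_cfg_def)
  then have "fst (snd (cfg u R) ! (J - 1)) 0 = bit_symbol b"
    using b by (simp add: tm_outputs_def Let_def cfg_def string_contents_def)
  moreover have "s 2 R (J - 1) R = fst (snd (cfg u R) ! (J - 1)) 0"
    using a J PB by (simp add: agrees_def)
  moreover have "s 2 R (J - 1) R = 2" using v by (simp add: valid_def)
  ultimately have b: "b" by (simp add: bit_symbol_def split: if_splits)
  then show ?thesis using len \<open>tm_outputs M [x, u] R [b]\<close> by auto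
qed

lemma accept_imp_valid:
  assumes u: "length u \<le> P" "tm_outputs M [x, u] R [True]"
    and B: "2 * R < B" "P < B" "length sits \<le> B" "tm_symbols M \<le> B"
  shows "\<exists>s. valid s \<and> (\<forall>k t j p. s k t j p < B)"
proof -
  \<comment> \<open>Stopping the clock at \<open>R\<close> keeps the head positions below
    \<open>B\<close> for every \<open>t\<close>, as is required of all values of
    \<open>s\<close>.\<close>
  define c where "c t = cfg u (min t R)" for t
  have ok: "ok_cfg (c t)" for t by (simp add: c_def ok_cfg)
  have "\<exists>l < length sits. sits ! l = (fst (c t), map tape_read (snd (c t)))" for t
    using ok[of t] ok_reads[OF ok[of t]] by (intro sits_ex) (auto simp: ok_cfg_def)
  then obtain loc where loc: "\<And>t. loc t < length sits"
      "\<And>t. sits ! loc t = (fst (c t), map tape_read (snd (c t)))"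
    by metis
  define hd where "hd t j = (if j < J then nat (snd (snd (c t) ! j) + int R) else 0)" for t j
  have hd: "int (hd t j) = snd (snd (c t) ! j) + int R" "hd t j \<le> 2 * R" if "j < J" for t j
    using head_bound[OF that, of u "min t R"] that by (auto simp: hd_def c_def)
  have hdB: "hd t j < B" for t j using hd(2)[of j t] B by (cases "j < J") (auto simp: hd_def)
  define cell where "cell t j p = (if j < J then fst (snd (c t) ! j) (int p - int R) else 0)" for t j p
  have cellB: "cell t j p < B" for t j p
    using ok[of t] B by (force simp: cell_def ok_cfg_def dest: less_le_trans)
  define s where "s k t j p = (if k = 0 then loc t else if k = 1 then hd t j
    else if k = 2 then cell t j p else length u)" for k t j p :: nat
  have "s k t j p < B" for k t j p
    using hdB cellB loc(1)[of t] u(1) B by (auto simp: s_def)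
  moreover have "valid s"
  proof -
    have s_simps: "s 0 t j p = loc t" "s (Suc 0) t j p = hd t j" "s 2 t j p = cell t j p" "s 3 t j p = length u" for t j p
      by (simp_all add: s_def)
    have read: "good_read (loc t) j (cell t j (hd t j))" if "j < J" for t j
      using loc[of t] hd(1)[OF that, of t] that ok[of t]
      by (simp add: good_read_def cell_def tape_read_def ok_cfg_def)
    have cSuc: "c (Suc t) = tm_step M (c t)" if "t < R" for t
      using that by (simp add: c_def min_def cfg_Suc)
    have nth: "snd (c (Suc t)) ! j = tape_act (snd (delta (sits ! loc t)) ! j) (snd (c t) ! j)"
      if "t < R" "j < J" for t j
      unfolding cSuc[OF that(1)] loc by (rule ok_step(2)[OF ok that(2)])
    have st: "fst (c (Suc t)) = fst (delta (sits ! loc t))" if "t < R" for t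
      unfolding cSuc[OF that] loc by (metis step_delta prod.collapse fst_conv)
    have "good_next (loc t) (loc (Suc t))" if "t < R" for t
      using loc(1)[of t] loc(1)[of "Suc t"] loc(2)[of "Suc t"] st[OF that] by (simp add: good_next_def)
    moreover have "good_move (loc t) j (hd t j) (hd (Suc t) j)" if "t < R" "j < J" for t j
      using loc(1) hd(1)[OF that(2), of t] hd(1)[OF that(2), of "Suc t"] nth[OF that]
      by (simp add: good_move_def move_pos_shift tape_act_def)
    moreover have "good_write (loc t) j (cell (Suc t) j (hd t j))" if "t < R" "j < J" for t j
      using loc(1) hd(1)[OF that(2), of t] nth[OF that] that
      by (simp add: good_write_def cell_def tape_act_def)
    moreover have "cell (Suc t) j p = cell t j p" if "t < R" "j < J" "p \<noteq> hd t j" for t j p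
      using hd(1)[OF that(2), of t] nth[OF that(1,2)] that by (auto simp: cell_def tape_act_def)
    moreover have "good_init (loc 0)"
      using loc(1)[of 0] loc(2)[of 0] by (simp add: good_init_def c_def cfg_0 tm_init_def)
    moreover have "hd 0 j = R" if "j < J" for j
      using that by (simp add: hd_def c_def init_tape)
    moreover have x: "good_x p (cell 0 0 p)" for p
      using two by (auto simp: good_x_def cell_def c_def init_tape string_contents_def nat_diff_distrib)
    moreover have "good_u p (cell 0 (Suc 0) p) (length u)" for p
      using two u(1)
      by (auto simp: good_u_def cell_def c_def init_tape string_contents_def bit_symbol_def nat_diff_distrib)
    moreover have "cell 0 j p = 0" if "2 \<le> j" "j < J" for j p
      using that by (simp add: cell_def c_def init_tape string_contents_def)
    moreover have "cell R (J - Suc 0) R = 2"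
    proof -
      have "last (snd (cfg u R)) = snd (cfg u R) ! (J - 1)"
        using ok_cfg[of u R] two by (subst last_conv_nth) (auto simp: ok_cfg_def)
      then show ?thesis using u(2) two
        by (simp add: cell_def c_def tm_outputs_def Let_def cfg_def string_contents_def bit_symbol_def)
    qed
    ultimately show ?thesis using read unfolding valid_def by (simp add: s_simps)
  qed
  ultimately show ?thesis by blast
qed

end

section \<open>Conditions as terms\<close>

definition holds :: "trm \<Rightarrow> bool list \<Rightarrow> bool list \<Rightarrow> (nat \<Rightarrow> nat) \<Rightarrow> bool" where
  "holds t x u e \<longleftrightarrow> tv t x u e \<noteq> 0"

definition TAnd :: "trm \<Rightarrow> trm \<Rightarrow> trm" where "TAnd = Mul"
definition TOr :: "trm \<Rightarrow> trm \<Rightarrow> trm" where "TOr = Add"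
definition TNot :: "trm \<Rightarrow> trm" where "TNot t = Lt t (Cst 1)"
definition TImp :: "trm \<Rightarrow> trm \<Rightarrow> trm" where "TImp s t = TOr (TNot s) t"
definition TLe :: "trm \<Rightarrow> trm \<Rightarrow> trm" where "TLe s t = TNot (Lt t s)"
definition TEq :: "trm \<Rightarrow> trm \<Rightarrow> trm" where "TEq s t = TAnd (TLe s t) (TLe t s)"
definition TEx :: "nat \<Rightarrow> trm \<Rightarrow> trm \<Rightarrow> trm" where "TEx = Sum"
definition TAll :: "nat \<Rightarrow> trm \<Rightarrow> trm \<Rightarrow> trm" where "TAll i t s = TNot (TEx i t (TNot s))"
definition TDisj :: "trm list \<Rightarrow> trm" where "TDisj ts = foldr TOr ts (Cst 0)"

lemma holds_simps [simp]:
  "holds (Cst n) x u e \<longleftrightarrow> n \<noteq> 0"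
  "holds (TAnd s t) x u e \<longleftrightarrow> holds s x u e \<and> holds t x u e"
  "holds (TOr s t) x u e \<longleftrightarrow> holds s x u e \<or> holds t x u e"
  "holds (TNot t) x u e \<longleftrightarrow> \<not> holds t x u e"
  "holds (TImp s t) x u e \<longleftrightarrow> (holds s x u e \<longrightarrow> holds t x u e)"
  "holds (Lt v w) x u e \<longleftrightarrow> tv v x u e < tv w x u e"
  "holds (TLe v w) x u e \<longleftrightarrow> tv v x u e \<le> tv w x u e"
  "holds (TEq v w) x u e \<longleftrightarrow> tv v x u e = tv w x u e"
  "holds (TEx i v t) x u e \<longleftrightarrow> (\<exists>a < tv v x u e. holds t x u (e(i := a)))"
  "holds (TAll i v t) x u e \<longleftrightarrow> (\<forall>a < tv v x u e. holds t x u (e(i := a)))"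
  "holds (Bit j v) x u e \<longleftrightarrow> tv v x u e < length (inp x u j) \<and> inp x u j ! tv v x u e"
  by (auto simp: holds_def TAnd_def TOr_def TNot_def TImp_def TLe_def TEq_def TEx_def TAll_def)

lemma holds_TDisj [simp]: "holds (TDisj ts) x u e \<longleftrightarrow> (\<exists>t \<in> set ts. holds t x u e)"
  by (induction ts) (auto simp: TDisj_def)

lemma wft_simps [simp]:
  "wft b (TAnd s t) \<longleftrightarrow> wft b s \<and> wft b t"
  "wft b (TOr s t) \<longleftrightarrow> wft b s \<and> wft b t"
  "wft b (TNot t) \<longleftrightarrow> wft b t"
  "wft b (TImp s t) \<longleftrightarrow> wft b s \<and> wft b t"
  "wft b (TLe s t) \<longleftrightarrow> wft b s \<and> wft b t"
  "wft b (TEq s t) \<longleftrightarrow> wft b s \<and> wft b t"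
  "wft b (TEx i s t) \<longleftrightarrow> 3 \<le> i \<and> i < b \<and> wft b s \<and> wft b t"
  "wft b (TAll i s t) \<longleftrightarrow> 3 \<le> i \<and> i < b \<and> wft b s \<and> wft b t"
  by (auto simp: TAnd_def TOr_def TNot_def TImp_def TLe_def TEq_def TEx_def TAll_def)

lemma wft_TDisj [simp]: "wft b (TDisj ts) \<longleftrightarrow> (\<forall>t \<in> set ts. wft b t)"
  by (induction ts) (auto simp: TDisj_def)

text \<open>Finer than \<open>wft\<close>: a term can be evaluated under binders that change
  variables not occurring in it, as long as those it contains keep their values.\<close>

primrec fv :: "trm \<Rightarrow> nat set" where
  "fv (Var i) = {i}"
| "fv (Cst n) = {}"
| "fv (Add s t) = fv s \<union> fv t"
| "fv (Mul s t) = fv s \<union> fv t"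
| "fv (Lt s t) = fv s \<union> fv t"
| "fv (Bit j t) = fv t"
| "fv (Len j) = {}"
| "fv (Sum i t s) = fv t \<union> (fv s - {i})"

lemma fv_simps [simp]:
  "fv (TAnd s t) = fv s \<union> fv t"
  "fv (TOr s t) = fv s \<union> fv t"
  "fv (TNot t) = fv t"
  "fv (TImp s t) = fv s \<union> fv t"
  "fv (TLe s t) = fv s \<union> fv t"
  "fv (TEq s t) = fv s \<union> fv t"
  "fv (TEx i t s) = fv t \<union> (fv s - {i})"
  "fv (TAll i t s) = fv t \<union> (fv s - {i})"
  by (auto simp: TAnd_def TOr_def TNot_def TImp_def TLe_def TEq_def TEx_def TAll_def)

lemma fv_TDisj [simp]: "fv (TDisj ts) = (\<Union>t \<in> set ts. fv t)"
  by (induction ts) (auto simp: TDisj_def)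

lemma tv_fv_cong: "(\<And>i. i \<in> fv t \<Longrightarrow> e i = e' i) \<Longrightarrow> tv t x u e = tv t x u e'"
proof (induction t arbitrary: e e')
  case (Sum i t s)
  have "tv t x u e = tv t x u e'" by (rule Sum.IH(1)) (use Sum.prems in auto)
  moreover have "tv s x u (e(i := a)) = tv s x u (e'(i := a))" for a
    by (rule Sum.IH(2)) (use Sum.prems in auto)
  ultimately show ?case by simp
next
  case (Add s t)
  from Add.IH[of e e'] Add.prems show ?case by simp
next
  case (Mul s t)
  from Mul.IH[of e e'] Mul.prems show ?case by simp
next
  case (Lt s t)
  from Lt.IH[of e e'] Lt.prems show ?case by simp
next
  case (Bit j t)
  from Bit.IH[of e e'] Bit.prems show ?case by simp
qed auto

section \<open>Polynomials and finite tables as terms\<close>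

definition represents :: "trm \<Rightarrow> (nat \<Rightarrow> nat) \<Rightarrow> bool" where
  "represents t f \<longleftrightarrow> wft 3 t \<and> fv t = {} \<and> (\<forall>x u e. tv t x u e = f (length x))"

lemma representsD:
  assumes "represents t f"
  shows "3 \<le> b \<Longrightarrow> wft b t" "fv t = {}" "tv t x u e = f (length x)"
  using assms wft_mono by (auto simp: represents_def)

text \<open>Horner's scheme, by induction on the coefficients.\<close>

lemma polyb_represents: "polyb f \<Longrightarrow> \<exists>t. represents t f"
proof -
  have "\<exists>t. represents t (poly p)" for p :: "nat poly"
  proof (induction p)
    case 0
    show ?case by (rule exI[of _ "Cst 0"]) (simp add: represents_def)
  next
    case (pCons a p)
    then obtain t where "represents t (poly p)" by blast
    then show ?case
      by (intro exI[of _ "Add (Cst a) (Mul (Len 1) t)"]) (auto simp: represents_def inp_def)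
  qed
  moreover assume "polyb f"
  ultimately show ?thesis unfolding polyb_def by (metis ext)
qed

text \<open>A finite table wired into a term. It depends on the simulated machine only, so a
  transition function enters the reduction as a term of constant size.\<close>

definition TTab :: "(nat \<Rightarrow> nat \<Rightarrow> nat \<Rightarrow> bool) \<Rightarrow> nat \<Rightarrow> nat \<Rightarrow> nat \<Rightarrow> trm \<Rightarrow> trm \<Rightarrow> trm \<Rightarrow> trm" where
  "TTab P l m n s t w = TDisj [TAnd (TEq s (Cst a)) (TAnd (TEq t (Cst b)) (TEq w (Cst c))).
     (a, b, c) \<leftarrow> List.product [0..<l] (List.product [0..<m] [0..<n]), P a b c]"

lemma holds_TTab [simp]:
  "holds (TTab P l m n s t w) x u e \<longleftrightarrow>
    tv s x u e < l \<and> tv t x u e < m \<and> tv w x u e < n \<and> P (tv s x u e) (tv t x u e) (tv w x u e)"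
  by (auto simp: TTab_def)

lemma wft_TTab [simp]: "wft b s \<Longrightarrow> wft b t \<Longrightarrow> wft b w \<Longrightarrow> wft b (TTab P l m n s t w)"
  by (auto simp: TTab_def)

lemma fv_TTab: "fv (TTab P l m n s t w) \<subseteq> fv s \<union> fv t \<union> fv w"
  by (auto simp: TTab_def)

section \<open>Ternary constraints\<close>

text \<open>
  The literal \<open>y\<close> denies the equation \<open>\<sigma> (y div D) = y mod D\<close>. The clause with index
  \<open>(y1 * Y + y2) * Y + y3\<close> says that not all three equations hold, provided that the
  triple is forbidden; otherwise it contains all literals and is trivially satisfied.
\<close>
definition forbid_lit :: "nat \<Rightarrow> (nat \<Rightarrow> nat \<Rightarrow> nat \<Rightarrow> bool) \<Rightarrow> nat \<Rightarrow> nat \<Rightarrow> bool" where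
  "forbid_lit Y F c y \<longleftrightarrow> (\<exists>y1 < Y. \<exists>y2 < Y. \<exists>y3 < Y. c = (y1 * Y + y2) * Y + y3 \<and>
     (F y1 y2 y3 \<longrightarrow> y = y1 \<or> y = y2 \<or> y = y3))"

text \<open>Clause indices and triples of literals correspond via digits in base \<open>Y\<close>. A
  clause of a triple that is not forbidden is satisfied at variable 0, because
  \<open>2 \<le> D\<close> leaves a value different from \<open>\<sigma> 0\<close>.\<close>

lemma csp_sat_forbid:
  assumes "1 \<le> V" "2 \<le> D"
  defines "Y \<equiv> V * D"
  shows "csp_sat V D (Y * Y * Y) (forbid_lit Y F) \<longleftrightarrow>
    (\<exists>\<sigma>. (\<forall>v < V. \<sigma> v < D) \<and> (\<forall>y1 < Y. \<forall>y2 < Y. \<forall>y3 < Y. F y1 y2 y3 \<longrightarrow>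
      \<not> (\<sigma> (y1 div D) = y1 mod D \<and> \<sigma> (y2 div D) = y2 mod D \<and> \<sigma> (y3 div D) = y3 mod D)))"
proof -
  have "(\<forall>c < Y * Y * Y. \<exists>v < V. \<exists>d < D. forbid_lit Y F c (v * D + d) \<and> \<sigma> v \<noteq> d) \<longleftrightarrow>
    (\<forall>y1 < Y. \<forall>y2 < Y. \<forall>y3 < Y. F y1 y2 y3 \<longrightarrow>
      \<not> (\<sigma> (y1 div D) = y1 mod D \<and> \<sigma> (y2 div D) = y2 mod D \<and> \<sigma> (y3 div D) = y3 mod D))"
    (is "?L \<longleftrightarrow> ?R") for \<sigma>
  proof
    assume L: ?L
    show ?R
    proof (intro allI impI)
      fix y1 y2 y3 assume y: "y1 < Y" "y2 < Y" "y3 < Y" and F: "F y1 y2 y3"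
      define c where "c = (y1 * Y + y2) * Y + y3"
      have "c < Y * Y * Y" unfolding c_def by (intro nat_digits_less y)
      then obtain v d where vd: "v < V" "d < D" "forbid_lit Y F c (v * D + d)" "\<sigma> v \<noteq> d"
        using L by blast
      then obtain z1 z2 z3 where z: "z1 < Y" "z2 < Y" "z3 < Y" "c = (z1 * Y + z2) * Y + z3"
        "F z1 z2 z3 \<longrightarrow> v * D + d = z1 \<or> v * D + d = z2 \<or> v * D + d = z3"
        unfolding forbid_lit_def by blast
      have "y1 = z1 \<and> y2 = z2 \<and> y3 = z3"
        using z(1-4) y nat_digits unfolding c_def by blast
      then have "v * D + d = y1 \<or> v * D + d = y2 \<or> v * D + d = y3" using z(5) F by blast
      moreover have "(v * D + d) div D = v" "(v * D + d) mod D = d" using vd(2) by auto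
      ultimately show "\<not> (\<sigma> (y1 div D) = y1 mod D \<and> \<sigma> (y2 div D) = y2 mod D \<and> \<sigma> (y3 div D) = y3 mod D)"
        using vd(4) by auto
    qed
  next
    assume R: ?R
    show ?L
    proof (intro allI impI)
      fix c assume c: "c < Y * Y * Y"
      define y1 y2 y3 where "y1 = c div Y div Y" and "y2 = c div Y mod Y" and "y3 = c mod Y"
      have Y: "0 < Y" using c by (cases Y) auto
      then have y: "y1 < Y" "y2 < Y" "y3 < Y"
        using c by (auto simp: y1_def y2_def y3_def less_mult_imp_div_less)
      have cy: "c = (y1 * Y + y2) * Y + y3" by (simp add: y1_def y2_def y3_def)
      show "\<exists>v < V. \<exists>d < D. forbid_lit Y F c (v * D + d) \<and> \<sigma> v \<noteq> d"
      proof (cases "F y1 y2 y3")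
        case True
        then obtain y where y': "y = y1 \<or> y = y2 \<or> y = y3" "\<sigma> (y div D) \<noteq> y mod D"
          using R y by blast
        have "y < V * D" using y' y unfolding Y_def by blast
        then have "y div D < V" "y mod D < D" using assms(2) by (auto simp: less_mult_imp_div_less)
        moreover have "forbid_lit Y F c y" unfolding forbid_lit_def using y cy y'(1) by blast
        ultimately show ?thesis using y'(2) by (metis div_mult_mod_eq)
      next
        case False
        have "forbid_lit Y F c y" for y unfolding forbid_lit_def using y cy False by blast
        moreover have "\<exists>d < D. \<sigma> 0 \<noteq> d" using assms(2) by (metis One_nat_def Suc_1 Suc_le_lessD less_trans zero_less_one zero_neq_one)
        ultimately show ?thesis using assms(1) by (intro exI[of _ 0]) auto
      qed
    qed
  qed
  then show ?thesis unfolding csp_sat_def by simp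
qed

section \<open>Verification of half-integral linkages\<close>

definition bitat :: "bool list \<Rightarrow> nat \<Rightarrow> bool" where
  "bitat w i \<longleftrightarrow> i < length w \<and> w ! i"

text \<open>The offset at which the unary code of \<open>val i\<close> starts, as a number
  \<open>v\<close> takes \<open>v + 1\<close> bits.\<close>

definition sumv :: "(nat \<Rightarrow> nat) \<Rightarrow> nat \<Rightarrow> nat" where
  "sumv val i = (\<Sum>a<i. val a + 1)"

text \<open>From position \<open>p\<close> on, the string \<open>x\<close> consists of the unary codes of \<open>m\<close> numbers.\<close>
definition enc_at :: "bool list \<Rightarrow> nat \<Rightarrow> (nat \<Rightarrow> nat) \<Rightarrow> nat \<Rightarrow> bool" where
  "enc_at x p val m \<longleftrightarrow> p + sumv val m = length x \<and>
     (\<forall>i < m. (\<forall>s < val i. bitat x (p + sumv val i + s)) \<and> \<not> bitat x (p + sumv val i + val i))"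

lemma encode_nat_prefix:
  "zs = encode_nat m @ ys \<longleftrightarrow>
    m < length zs \<and> (\<forall>s < m. bitat zs s) \<and> \<not> bitat zs m \<and> ys = drop (Suc m) zs"
proof
  assume "zs = encode_nat m @ ys"
  then show "m < length zs \<and> (\<forall>s < m. bitat zs s) \<and> \<not> bitat zs m \<and> ys = drop (Suc m) zs"
    by (auto simp: encode_nat_def bitat_def nth_append)
next
  assume a: "m < length zs \<and> (\<forall>s < m. bitat zs s) \<and> \<not> bitat zs m \<and> ys = drop (Suc m) zs"
  then have "zs = take m zs @ zs ! m # drop (Suc m) zs" by (simp add: id_take_nth_drop)
  moreover have "take m zs = replicate m True"
    by (rule nth_equalityI) (use a in \<open>auto simp: bitat_def\<close>)
  ultimately show "zs = encode_nat m @ ys" using a by (simp add: encode_nat_def bitat_def)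
qed

text \<open>Replaces parsing by conditions on single bits at computable positions, which terms can
  express.\<close>

lemma enc_at_iff:
  "enc_at x p val m \<longleftrightarrow> p \<le> length x \<and> drop p x = concat (map (\<lambda>i. encode_nat (val i)) [0..<m])"
proof (induction m arbitrary: p val)
  case 0
  then show ?case by (auto simp: enc_at_def sumv_def)
next
  case (Suc m)
  have sv: "sumv val (Suc i) = val 0 + 1 + sumv (val \<circ> Suc) i" for i
    unfolding sumv_def by (subst sum.lessThan_Suc_shift) simp
  have s0: "sumv val 0 = 0" by (simp add: sumv_def)
  have eq: "concat (map (\<lambda>i. encode_nat (val i)) [0..<Suc m]) =
      encode_nat (val 0) @ concat (map (\<lambda>i. encode_nat ((val \<circ> Suc) i)) [0..<m])"
    by (simp add: map_upt_Suc del: upt_Suc)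
  have "p \<le> length x \<and> drop p x = concat (map (\<lambda>i. encode_nat (val i)) [0..<Suc m]) \<longleftrightarrow>
      p \<le> length x \<and> val 0 < length (drop p x) \<and> (\<forall>s < val 0. bitat (drop p x) s) \<and>
      \<not> bitat (drop p x) (val 0) \<and>
      drop (Suc (val 0)) (drop p x) = concat (map (\<lambda>i. encode_nat ((val \<circ> Suc) i)) [0..<m])"
    unfolding eq encode_nat_prefix by (metis)
  also have "\<dots> \<longleftrightarrow> (\<forall>s < val 0. bitat x (p + s)) \<and> \<not> bitat x (p + val 0) \<and>
      enc_at x (p + val 0 + 1) (val \<circ> Suc) m"
    unfolding Suc.IH by (auto simp: bitat_def add.commute add.left_commute)
  also have "\<dots> \<longleftrightarrow> enc_at x p val (Suc m)"
    unfolding enc_at_def All_less_Suc2 sv s0 by (auto simp: add.assoc)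
  finally show ?case by blast
qed

definition mat :: "(nat \<Rightarrow> nat \<Rightarrow> 'a) \<Rightarrow> nat \<Rightarrow> nat \<Rightarrow> 'a list" where
  "mat f m n = concat (map (\<lambda>i. map (f i) [0..<n]) [0..<m])"

lemma length_mat [simp]: "length (mat f m n) = m * n"
  by (induction m) (auto simp: mat_def)

lemma nth_mat: "i < m \<Longrightarrow> j < n \<Longrightarrow> mat f m n ! (i * n + j) = f i j"
proof (induction m)
  case (Suc m)
  have eq: "mat f (Suc m) n = mat f m n @ map (f m) [0..<n]" by (simp add: mat_def)
  show ?case
  proof (cases "i < m")
    case True
    then have "i * n + j < m * n" using Suc.prems by (intro nat_digits_less)
    then show ?thesis using Suc True by (simp add: eq nth_append)
  next
    case False
    then have "i = m" using Suc.prems by simp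
    then show ?thesis using Suc.prems by (simp add: eq nth_append)
  qed
qed simp

lemma mat_eqI:
  assumes "length xs = m * n" "\<And>i j. i < m \<Longrightarrow> j < n \<Longrightarrow> xs ! (i * n + j) = f i j"
  shows "xs = mat f m n"
proof (rule nth_equalityI)
  fix l assume "l < length xs"
  then have l: "l < m * n" using assms(1) by simp
  then have n: "0 < n" by (cases n) auto
  have "l div n < m" "l mod n < n" using l n by (auto simp: less_mult_imp_div_less)
  then have "xs ! (l div n * n + l mod n) = mat f m n ! (l div n * n + l mod n)"
    using assms(2) nth_mat by metis
  then show "xs ! l = mat f m n ! l" by simp
qed (simp add: assms(1))

text \<open>
  The certificate \<open>val\<close> lists the numbers encoded after the adjacency matrix, the first of which is
  \<open>k\<close>; \<open>U i a v\<close> says that \<open>v\<close> is the vertex number \<open>a\<close> of the path \<open>i\<close>.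
\<close>
definition adj :: "bool list \<Rightarrow> nat \<Rightarrow> nat \<Rightarrow> nat \<Rightarrow> bool" where
  "adj x n i j \<longleftrightarrow> bitat x (n + 1 + (i * n + j))"

text \<open>\<open>U i a\<close> may hold for several vertices. It is only asked that each of them
  is the target or is followed by a neighbour with number \<open>a + 1\<close>; since the numbers
  stay below \<open>n\<close>, the target is reached. The capacity condition counts every vertex in
  \<open>U\<close>, and hence also those of a path found among them.\<close>

definition certified :: "bool list \<Rightarrow> nat \<Rightarrow> nat \<Rightarrow> (nat \<Rightarrow> nat) \<Rightarrow> (nat \<Rightarrow> nat \<Rightarrow> nat \<Rightarrow> bool) \<Rightarrow> bool" where
  "certified x n k val U \<longleftrightarrow>
     (\<forall>s < n. bitat x s) \<and> \<not> bitat x n \<and> enc_at x (n + 1 + n * n) val (k + k + 1) \<and> val 0 = k \<and>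
     (\<forall>i < k + k. val (1 + i) < n) \<and>
     (\<forall>i < k. \<forall>j < k. val (1 + i) = val (1 + j) \<or> val (1 + k + i) = val (1 + k + j) \<longrightarrow> i = j) \<and>
     (\<forall>v < n. \<not> adj x n v v) \<and>
     (\<forall>i < k. U i 0 (val (1 + i))) \<and>
     (\<forall>i < k. \<forall>a < n. \<forall>v < n. U i a v \<longrightarrow>
        v = val (1 + k + i) \<or> (\<exists>w < n. adj x n v w \<and> a + 1 < n \<and> U i (a + 1) w)) \<and>
     (\<forall>v < n. \<forall>i < k. \<forall>j < k. \<forall>l < k. (\<exists>a < n. U i a v) \<and> (\<exists>a < n. U j a v) \<and> (\<exists>a < n. U l a v) \<longrightarrow>
        i = j \<or> i = l \<or> j = l)"

section \<open>Linkages and their certificates\<close>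

lemma map_nth_comp: "map (\<lambda>i. f (xs ! i)) [0..<length xs] = map f xs"
  by (rule nth_equalityI) auto

lemma encode_instance_mat:
  assumes "n = card (pverts G)" "k = length S" "length T = k"
  shows "encode_instance G S T = encode_nat n @ mat (\<lambda>i j. (i, j) \<in> parcs G) n n @
    concat (map (\<lambda>i. encode_nat ((k # S @ T) ! i)) [0..<k + k + 1])"
proof -
  have "map (\<lambda>i. encode_nat ((k # S @ T) ! i)) [0..<k + k + 1] = map encode_nat (k # S @ T)"
    using map_nth_comp[of encode_nat "k # S @ T"] assms by (simp del: upt_Suc)
  then have "concat (map (\<lambda>i. encode_nat ((k # S @ T) ! i)) [0..<k + k + 1]) =
      encode_nat k @ concat (map encode_nat S) @ concat (map encode_nat T)"
    by (simp del: upt_Suc)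
  then show ?thesis using assms by (simp add: encode_instance_def Let_def mat_def del: upt_Suc)
qed

lemma certified_intro:
  assumes enc: "encoded_instance G S T" and x: "x = encode_instance G S T"
    and n: "n = card (pverts G)" and k: "k = length S"
    and Q: "\<And>i. i < k \<Longrightarrow> vpath G (S ! i) (Q i) (T ! i)"
    and cQ: "\<And>v. v \<in> pverts G \<Longrightarrow> card {i. i < k \<and> v \<in> set (Q i)} \<le> 2"
    and val: "\<And>j. j < k + k + 1 \<Longrightarrow> val j = (k # S @ T) ! j"
    and U: "\<And>i a v. i < k \<Longrightarrow> a < n \<Longrightarrow> v < n \<Longrightarrow> U i a v \<longleftrightarrow> a < length (Q i) \<and> Q i ! a = v"
  shows "certified x n k val U"
proof -
  have V: "pverts G = {..<n}" using enc n by (simp add: encoded_instance_def)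
  have li: "length T = k" "distinct S" "distinct T" "set S \<subseteq> {..<n}" "set T \<subseteq> {..<n}" "pair_digraph G"
    using enc k by (auto simp: encoded_instance_def linkage_instance_def V)
  define rest where "rest = concat (map (\<lambda>i. encode_nat ((k # S @ T) ! i)) [0..<k + k + 1])"
  have xe: "x = encode_nat n @ mat (\<lambda>i j. (i, j) \<in> parcs G) n n @ rest"
    unfolding x rest_def by (rule encode_instance_mat[OF n k li(1)])
  have vS: "val (1 + i) = S ! i" "val (1 + k + i) = T ! i" if "i < k" for i
    using that val k li(1) by (auto simp: nth_append)
  have pre: "\<forall>s < n. bitat x s" "\<not> bitat x n"
    using encode_nat_prefix[THEN iffD1, OF xe] by auto
  have "rest = concat (map (\<lambda>i. encode_nat (val i)) [0..<k + k + 1])"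
    unfolding rest_def using val by (intro arg_cong[where f = concat] map_cong) auto
  moreover have "drop (n + 1 + n * n) x = rest" "n + 1 + n * n \<le> length x"
    unfolding xe by (simp_all add: encode_nat_def)
  ultimately have e: "enc_at x (n + 1 + n * n) val (k + k + 1)" by (simp add: enc_at_iff)
  have adj: "adj x n i j \<longleftrightarrow> (i, j) \<in> parcs G" if "i < n" "j < n" for i j
  proof -
    have "i * n + j < n * n" using that by (rule nat_digits_less)
    then show ?thesis unfolding adj_def bitat_def xe
      using nth_mat[OF that, of "\<lambda>i j. (i, j) \<in> parcs G"]
      by (simp add: encode_nat_def nth_append)
  qed
  have vlt: "val (1 + i) < n" if "i < k + k" for i
  proof (cases "i < k")
    case True
    then show ?thesis using vS(1)[OF True] li(4) k by (metis lessThan_iff nth_mem subsetD)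
  next
    case False
    then have i: "i - k < k" "1 + i = 1 + k + (i - k)" using that by auto
    then show ?thesis using vS(2)[OF i(1)] li(1,5) by (metis lessThan_iff nth_mem subsetD)
  qed
  have inj: "i = j" if "i < k" "j < k" "val (1 + i) = val (1 + j) \<or> val (1 + k + i) = val (1 + k + j)" for i j
    using that vS li(1-3) k by (metis nth_eq_iff_index_eq)
  have q: "Q i \<noteq> []" "Q i ! 0 = S ! i" "last (Q i) = T ! i" "distinct (Q i)" "set (Q i) \<subseteq> {..<n}"
    "successively (\<lambda>a b. (a, b) \<in> parcs G) (Q i)" "length (Q i) \<le> n" if "i < k" for i
  proof -
    show *: "Q i \<noteq> []" "Q i ! 0 = S ! i" "last (Q i) = T ! i" "distinct (Q i)" "set (Q i) \<subseteq> {..<n}"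
      "successively (\<lambda>a b. (a, b) \<in> parcs G) (Q i)"
      using Q[OF that] by (auto simp: vpath_def V hd_conv_nth)
    \<comment> \<open>A path repeats no vertex, so all its positions are below \<open>n\<close>, the
      range that \<open>certified\<close> inspects.\<close>
    have "length (Q i) = card (set (Q i))" using *(4) by (simp add: distinct_card)
    also have "\<dots> \<le> card {..<n}" using *(5) by (intro card_mono) auto
    finally show "length (Q i) \<le> n" by simp
  qed
  have used: "(\<exists>a < n. U i a v) \<longleftrightarrow> v \<in> set (Q i)" if "i < k" "v < n" for i v
    using U[OF that(1) _ that(2)] q(7)[OF that(1)] by (metis in_set_conv_nth less_le_trans)
  have start: "U i 0 (val (1 + i))" if i: "i < k" for i
  proof -
    have "0 < length (Q i)" using q(1)[OF i] by simp
    moreover have "0 < n" using calculation q(7)[OF i] by linarith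
    moreover have "val (1 + i) < n" using vlt i by simp
    ultimately show ?thesis using U[OF i] q(2)[OF i] vS(1)[OF i] by simp
  qed
  have step: "v = val (1 + k + i) \<or> (\<exists>w < n. adj x n v w \<and> a + 1 < n \<and> U i (a + 1) w)"
    if i: "i < k" and a: "a < n" and v: "v < n" and u: "U i a v" for i a v
  proof (cases "Suc a < length (Q i)")
    case True
    have Qa: "Q i ! a = v" using u U[OF i a v] by simp
    define w where "w = Q i ! Suc a"
    have w: "w < n" using True q(5)[OF i] nth_mem unfolding w_def by blast
    have "(Q i ! a, Q i ! Suc a) \<in> parcs G"
    proof -
      have "Q i = take a (Q i) @ Q i ! a # Q i ! Suc a # drop (Suc (Suc a)) (Q i)"
        using True by (metis Cons_nth_drop_Suc Suc_lessD append_take_drop_id)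
      then have "successively (\<lambda>a b. (a, b) \<in> parcs G) (take a (Q i) @ Q i ! a # Q i ! Suc a # drop (Suc (Suc a)) (Q i))"
        using q(6)[OF i] by simp
      then show ?thesis by (simp add: successively_append_iff)
    qed
    then have "adj x n v w" using adj v w Qa w_def by simp
    moreover have "Suc a < n" using True q(7)[OF i] by simp
    ultimately show ?thesis using U[OF i _ w, of "Suc a"] True w w_def by auto
  next
    case False
    then have "a = length (Q i) - 1" using u U[OF i a v] by auto
    then have "v = last (Q i)" using u U[OF i a v] q(1)[OF i] by (simp add: last_conv_nth)
    then show ?thesis using q(3)[OF i] vS(2)[OF i] by simp
  qed
  have loops: "\<not> adj x n v v" if "v < n" for v
    using adj[OF that that] pair_loopfree_digraph.pair_no_loops[of G "(v, v)"] li(6)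
    by (auto simp: pair_digraph_def)
  have cap: "i = j \<or> i = l \<or> j = l"
    if "v < n" "i < k" "j < k" "l < k" "(\<exists>a < n. U i a v) \<and> (\<exists>a < n. U j a v) \<and> (\<exists>a < n. U l a v)" for v i j l
  proof -
    have "card {i. i < k \<and> v \<in> set (Q i)} \<le> 2" using cQ that(1) V by simp
    then show ?thesis using that used unfolding card_le_2_iff by blast
  qed
  have v0: "val 0 = k" using val[of 0] by simp
  have a1: "\<forall>i < k + k. val (1 + i) < n"
    using vlt by blast
  have a2: "\<forall>i < k. \<forall>j < k. val (1 + i) = val (1 + j) \<or> val (1 + k + i) = val (1 + k + j) \<longrightarrow> i = j"
    by (intro allI impI) (rule inj)
  have a3: "\<forall>v < n. \<not> adj x n v v" using loops by blast
  have a4: "\<forall>i < k. U i 0 (val (1 + i))" using start by blast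
  have a5: "\<forall>i < k. \<forall>a < n. \<forall>v < n. U i a v \<longrightarrow>
        v = val (1 + k + i) \<or> (\<exists>w < n. adj x n v w \<and> a + 1 < n \<and> U i (a + 1) w)"
    by (intro allI impI) (rule step)
  have a6: "\<forall>v < n. \<forall>i < k. \<forall>j < k. \<forall>l < k.
      (\<exists>a < n. U i a v) \<and> (\<exists>a < n. U j a v) \<and> (\<exists>a < n. U l a v) \<longrightarrow> i = j \<or> i = l \<or> j = l"
    by (intro allI impI) (rule cap)
  show ?thesis unfolding certified_def by (intro conjI pre e v0 a1 a2 a3 a4 a5 a6)
qed

lemma certified_imp_linkage:
  assumes "certified x n k val U"
  shows "x \<in> half_integral_linkage"
proof -
  define G where "G = \<lparr>pverts = {..<n}, parcs = {(i, j). i < n \<and> j < n \<and> adj x n i j}\<rparr>"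
  define S where "S = map (\<lambda>i. val (1 + i)) [0..<k]"
  define T where "T = map (\<lambda>i. val (1 + k + i)) [0..<k]"
  note c = assms[unfolded certified_def]
  note c1 = c[THEN conjunct2] note c2 = c1[THEN conjunct2] note c3 = c2[THEN conjunct2]
  note c4 = c3[THEN conjunct2] note c5 = c4[THEN conjunct2] note c6 = c5[THEN conjunct2]
  note c7 = c6[THEN conjunct2] note c8 = c7[THEN conjunct2] note c9 = c8[THEN conjunct2]
  note pre = c[THEN conjunct1] c1[THEN conjunct1] and e = c2[THEN conjunct1] and v0 = c3[THEN conjunct1]
    and vlt = c4[THEN conjunct1, rule_format] and inj = c5[THEN conjunct1, rule_format]
    and loops = c6[THEN conjunct1, rule_format] and start = c7[THEN conjunct1, rule_format]
    and step = c8[THEN conjunct1, rule_format] and cap = c9[rule_format]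
  have Slt: "val (1 + i) < n" "val (1 + k + i) < n" if "i < k" for i
    using vlt[of i] vlt[of "k + i"] that by (auto simp: add.assoc)
  have wf: "pair_wf_digraph G" by unfold_locales (auto simp: G_def)
  have fin: "finite (parcs G)"
    by (rule finite_subset[of _ "{..<n} \<times> {..<n}"]) (auto simp: G_def)
  have pd: "pair_digraph G"
    using wf fin loops
    by (auto simp: pair_digraph_def pair_fin_digraph_def pair_fin_digraph_axioms_def
        pair_loopfree_digraph_def pair_loopfree_digraph_axioms_def) (auto simp: G_def)
  have "distinct S" "distinct T"
    unfolding S_def T_def distinct_map using inj by (auto intro: inj_onI)
  moreover have "set S \<subseteq> {..<n}" "set T \<subseteq> {..<n}" using Slt by (auto simp: S_def T_def)
  ultimately have enc: "encoded_instance G S T"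
    using pd by (simp add: encoded_instance_def linkage_instance_def G_def S_def T_def)
  have len: "n + 1 + n * n \<le> length x" and
    rest: "drop (n + 1 + n * n) x = concat (map (\<lambda>i. encode_nat (val i)) [0..<k + k + 1])"
    using e by (auto simp: enc_at_iff)
  have "encode_instance G S T = x"
  proof -
    have kST: "(k # S @ T) ! i = val i" if "i < k + k + 1" for i
    proof (cases i)
      case 0
      then show ?thesis using v0 by simp
    next
      case (Suc i')
      then show ?thesis using that
        by (auto simp: S_def T_def nth_append)
    qed
    have "mat (\<lambda>i j. (i, j) \<in> parcs G) n n = take (n * n) (drop (Suc n) x)"
    proof (rule mat_eqI[symmetric])
      show "length (take (n * n) (drop (Suc n) x)) = n * n" using len by simp
      fix i j assume ij: "i < n" "j < n"
      then have "i * n + j < n * n" by (rule nat_digits_less)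
      then show "take (n * n) (drop (Suc n) x) ! (i * n + j) = ((i, j) \<in> parcs G)"
        using ij len by (simp add: G_def adj_def bitat_def)
    qed
    moreover have "x = encode_nat n @ drop (Suc n) x"
      using encode_nat_prefix[of x n] pre len by simp
    moreover have "drop (Suc n) x = take (n * n) (drop (Suc n) x) @ drop (n + 1 + n * n) x"
      by (metis Suc_eq_plus1 add.commute append_take_drop_id drop_drop)
    moreover have "concat (map (\<lambda>i. encode_nat ((k # S @ T) ! i)) [0..<k + k + 1]) = drop (n + 1 + n * n) x"
      unfolding rest using kST by (intro arg_cong[where f = concat] map_cong) auto
    moreover have "encode_instance G S T = encode_nat n @ mat (\<lambda>i j. (i, j) \<in> parcs G) n n @
        concat (map (\<lambda>i. encode_nat ((k # S @ T) ! i)) [0..<k + k + 1])"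
      by (rule encode_instance_mat) (simp_all add: G_def S_def T_def)
    ultimately show ?thesis by metis
  qed
  moreover have "half_integrally_feasible G S T"
  proof -
    \<comment> \<open>All vertices that the certificate lists for path \<open>i\<close>. A path
      inside this set inherits the capacity bound.\<close>
    define A where "A i = {v. v < n \<and> (\<exists>a < n. U i a v)}" for i
    \<comment> \<open>Every step raises the number \<open>a\<close>, which stays below
      \<open>n\<close>; hence the induction on \<open>n - a\<close>.\<close>
    have reach: "(v, T ! i) \<in> (parcs G \<inter> A i \<times> A i)\<^sup>*" if i: "i < k" and "a < n" "v < n" "U i a v" for i a v
      using that(2-4)
    proof (induction "n - a" arbitrary: a v rule: less_induct)
      case less
      show ?case
      proof (cases "v = val (1 + k + i)")
        case True
        then show ?thesis using i by (simp add: T_def)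
      next
        case False
        then obtain w where w: "w < n" "adj x n v w" "a + 1 < n" "U i (a + 1) w"
          using step[OF i less.prems] by blast
        have "(w, T ! i) \<in> (parcs G \<inter> A i \<times> A i)\<^sup>*"
          by (rule less.hyps[of "a + 1"]) (use w in auto)
        moreover have "(v, w) \<in> parcs G \<inter> A i \<times> A i"
        proof -
          have "v \<in> A i" "w \<in> A i" using w less.prems unfolding A_def by blast+
          then show ?thesis using w less.prems by (simp add: G_def)
        qed
        ultimately show ?thesis by (rule converse_rtrancl_into_rtrancl[rotated])
      qed
    qed
    have "\<exists>vs. vpath G (S ! i) vs (T ! i) \<and> set vs \<subseteq> A i" if i: "i < k" for i
    proof (rule rtrancl_vpath)
      have v: "val (1 + i) < n" "0 < n" using Slt[OF i] by auto
      have S: "S ! i = val (1 + i)" using i by (simp add: S_def)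
      show "(S ! i, T ! i) \<in> (parcs G \<inter> A i \<times> A i)\<^sup>*"
        unfolding S by (rule reach[OF i v(2,1) start[OF i]])
      show "S ! i \<in> A i" unfolding A_def S using v start[OF i] by blast
      show "A i \<subseteq> pverts G" by (auto simp: A_def G_def)
    qed
    then obtain Q where Q: "\<And>i. i < k \<Longrightarrow> vpath G (S ! i) (Q i) (T ! i) \<and> set (Q i) \<subseteq> A i"
      by metis
    have "card {i. i < k \<and> v \<in> set (Q i)} \<le> 2" if "v < n" for v
      unfolding card_le_2_iff
    proof (intro allI impI)
      fix i j l assume a: "i < k" "j < k" "l < k" "v \<in> set (Q i) \<and> v \<in> set (Q j) \<and> v \<in> set (Q l)"
      then have "v \<in> A i" "v \<in> A j" "v \<in> A l" using Q by blast+
      then show "i = j \<or> i = l \<or> j = l" using cap[OF that a(1-3)] by (simp add: A_def)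
    qed
    moreover have "length S = k" "pverts G = {..<n}" by (simp_all add: S_def G_def)
    ultimately show ?thesis unfolding half_integrally_feasible_iff[OF wf]
      using Q by (intro exI[of _ Q]) simp
  qed
  ultimately show ?thesis using enc unfolding half_integral_linkage_def by blast
qed

text \<open>Position of a certificate bit, with digits in base \<open>N\<close>. The leading digit
  \<open>d\<close> separates the table of \<open>U\<close>, with 0, from that of \<open>val\<close>,
  with 1.\<close>

definition idx :: "nat \<Rightarrow> nat \<Rightarrow> nat \<Rightarrow> nat \<Rightarrow> nat \<Rightarrow> nat" where
  "idx N d i a v = ((d * N + i) * N + a) * N + v"

definition cert_U :: "bool list \<Rightarrow> bool list \<Rightarrow> nat \<Rightarrow> nat \<Rightarrow> nat \<Rightarrow> bool" where
  "cert_U x u i a v \<longleftrightarrow> bitat u (idx (length x + 1) 0 i a v)"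

text \<open>A number is coded by how many bits of its row are set; thus every string is a
  well-formed certificate, and no syntax has to be checked.\<close>

definition cert_val :: "bool list \<Rightarrow> bool list \<Rightarrow> nat \<Rightarrow> nat" where
  "cert_val x u j = (\<Sum>s < length x + 1. if bitat u (idx (length x + 1) 1 j s 0) then 1 else 0)"

section \<open>The verifier as a term\<close>

definition sLen :: trm where "sLen = Add (Len 1) (Cst 1)"

definition sIdx :: "trm \<Rightarrow> trm \<Rightarrow> trm \<Rightarrow> trm \<Rightarrow> trm" where
  "sIdx d i a v = Add (Mul (Add (Mul (Add (Mul d sLen) i) sLen) a) sLen) v"

definition sU :: "trm \<Rightarrow> trm \<Rightarrow> trm \<Rightarrow> trm" where
  "sU i a v = Bit 2 (sIdx (Cst 0) i a v)"

text \<open>Variables 20 and 21 are reserved for the sums in \<open>sVal\<close> and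
  \<open>sSumv\<close>; variables 3 and 4 hold \<open>n\<close> and \<open>k\<close>
  throughout.\<close>

definition sVal :: "trm \<Rightarrow> trm" where
  "sVal j = Sum 20 sLen (Bit 2 (sIdx (Cst 1) j (Var 20) (Cst 0)))"

definition sSumv :: "trm \<Rightarrow> trm" where
  "sSumv i = Sum 21 i (Add (sVal (Var 21)) (Cst 1))"

definition sAdj :: "trm \<Rightarrow> trm \<Rightarrow> trm" where
  "sAdj i j = Bit 1 (Add (Add (Var 3) (Cst 1)) (Add (Mul i (Var 3)) j))"

lemma tv_sIdx: "tv (sIdx d i a v) x u e =
    idx (length x + 1) (tv d x u e) (tv i x u e) (tv a x u e) (tv v x u e)"
  by (simp add: sIdx_def idx_def sLen_def inp_def)

lemma holds_Bit:
  "holds (Bit 1 v) x u e \<longleftrightarrow> bitat x (tv v x u e)" "holds (Bit 2 v) x u e \<longleftrightarrow> bitat u (tv v x u e)"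
  "holds (Bit (Suc 0) v) x u e \<longleftrightarrow> bitat x (tv v x u e)"
  by (simp_all add: bitat_def inp_def)

lemma holds_sU: "holds (sU i a v) x u e \<longleftrightarrow> cert_U x u (tv i x u e) (tv a x u e) (tv v x u e)"
  by (simp add: sU_def holds_Bit tv_sIdx cert_U_def del: holds_simps)

lemma holds_sAdj: "holds (sAdj i j) x u e \<longleftrightarrow> adj x (e 3) (tv i x u e) (tv j x u e)"
  by (simp add: sAdj_def holds_Bit adj_def del: holds_simps)

lemma tv_sVal:
  assumes "20 \<notin> fv j"
  shows "tv (sVal j) x u e = cert_val x u (tv j x u e)"
proof -
  have "tv j x u (e(20 := s)) = tv j x u e" for s
    by (rule tv_fv_cong) (use assms in auto)
  then have "tv (sIdx (Cst 1) j (Var 20) (Cst 0)) x u (e(20 := s)) = idx (length x + 1) 1 (tv j x u e) s 0" for s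
    by (simp add: tv_sIdx)
  then show ?thesis
    by (simp add: sVal_def cert_val_def sLen_def inp_def bitat_def)
qed

lemma tv_sSumv: "tv (sSumv i) x u e = sumv (cert_val x u) (tv i x u e)"
  by (simp add: sSumv_def sumv_def tv_sVal)

lemma wft_cert [simp]:
  "22 \<le> b \<Longrightarrow> wft b i \<Longrightarrow> wft b a \<Longrightarrow> wft b v \<Longrightarrow> wft b (sU i a v)"
  "22 \<le> b \<Longrightarrow> wft b i \<Longrightarrow> wft b (sVal i)"
  "22 \<le> b \<Longrightarrow> wft b i \<Longrightarrow> wft b (sSumv i)"
  "22 \<le> b \<Longrightarrow> wft b i \<Longrightarrow> wft b a \<Longrightarrow> wft b (sAdj i a)"
  by (auto simp: sU_def sVal_def sSumv_def sAdj_def sIdx_def sLen_def)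

definition sEnc :: trm where
  "sEnc = (let p = Add (Add (Var 3) (Cst 1)) (Mul (Var 3) (Var 3));
       m = Add (Add (Var 4) (Var 4)) (Cst 1); i = Var 5; s = Var 6 in
     TAnd (TEq (Add p (sSumv m)) (Len 1))
       (TAll 5 m (TAnd (TAll 6 (sVal i) (Bit 1 (Add (Add p (sSumv i)) s)))
         (TNot (Bit 1 (Add (Add p (sSumv i)) (sVal i)))))))"

lemma holds_sEnc:
  "holds sEnc x u e \<longleftrightarrow> enc_at x (e 3 + 1 + e 3 * e 3) (cert_val x u) (e 4 + e 4 + 1)"
  by (simp add: sEnc_def Let_def enc_at_def tv_sVal tv_sSumv holds_Bit inp_def del: holds_simps(11))

definition sCert :: trm where
  "sCert = (let n = Var 3; k = Var 4; o' = Cst 1; i = Var 5; j = Var 6; l = Var 7; v = Var 8;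
      a = Var 9; w = Var 10; used = (\<lambda>i. TEx 9 n (sU i a v)) in
    TAnd (TAll 5 n (Bit 1 i)) (TAnd (TNot (Bit 1 n)) (TAnd sEnc (TAnd (TEq (sVal (Cst 0)) k)
    (TAnd (TAll 5 (Add k k) (Lt (sVal (Add o' i)) n))
    (TAnd (TAll 5 k (TAll 6 k (TImp (TOr (TEq (sVal (Add o' i)) (sVal (Add o' j)))
        (TEq (sVal (Add (Add o' k) i)) (sVal (Add (Add o' k) j)))) (TEq i j))))
    (TAnd (TAll 8 n (TNot (sAdj v v)))
    (TAnd (TAll 5 k (sU i (Cst 0) (sVal (Add o' i))))
    (TAnd (TAll 5 k (TAll 9 n (TAll 8 n (TImp (sU i a v) (TOr (TEq v (sVal (Add (Add o' k) i)))
        (TEx 10 n (TAnd (sAdj v w) (TAnd (Lt (Add a o') n) (sU i (Add a o') w)))))))))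
      (TAll 8 n (TAll 5 k (TAll 6 k (TAll 7 k (TImp (TAnd (used i) (TAnd (used j) (used l)))
        (TOr (TEq i j) (TOr (TEq i l) (TEq j l)))))))))))))))))"

lemma holds_sCert:
  "holds sCert x u e \<longleftrightarrow> certified x (e 3) (e 4) (cert_val x u) (cert_U x u)"
  unfolding sCert_def Let_def certified_def
  by (simp add: tv_sVal holds_sU holds_sAdj holds_sEnc holds_Bit del: holds_simps(11))

lemma wft_sCert: "wft 22 sCert"
  by (simp add: sCert_def sEnc_def Let_def)

lemma length_encode_nats:
  "length xs \<le> length (concat (map encode_nat xs))"
  "y \<in> set xs \<Longrightarrow> y < length (concat (map encode_nat xs))"
  by (induction xs) (auto simp: encode_nat_def)

lemma sum_below: "(\<Sum>s<N. if s < v then 1 else 0) = min N (v :: nat)"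
  by (induction N) auto

lemma certificate_exists:
  assumes "x \<in> half_integral_linkage"
  defines "N \<equiv> length x + 1"
  shows "\<exists>u. length u \<le> 2 * N * N * N \<and>
    (\<exists>n < N. \<exists>k < N. certified x n k (cert_val x u) (cert_U x u))"
proof -
  obtain G S T where enc: "encoded_instance G S T" and x: "x = encode_instance G S T"
    and feas: "half_integrally_feasible G S T"
    using assms(1) unfolding half_integral_linkage_def by blast
  define n k where "n = card (pverts G)" and "k = length S"
  have wf: "pair_wf_digraph G" and lT: "length T = k"
    using enc by (auto simp: encoded_instance_def linkage_instance_def pair_digraph_def
        pair_fin_digraph_def k_def)
  obtain Q where Q: "\<And>i. i < k \<Longrightarrow> vpath G (S ! i) (Q i) (T ! i)"
    and cQ: "\<And>v. v \<in> pverts G \<Longrightarrow> card {i. i < k \<and> v \<in> set (Q i)} \<le> 2"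
    using feas unfolding half_integrally_feasible_iff[OF wf] k_def by blast
  have len: "length x = n + 1 + n * n + length (concat (map encode_nat (k # S @ T)))"
  proof -
    have "map (\<lambda>i. encode_nat ((k # S @ T) ! i)) [0..<k + k + 1] = map encode_nat (k # S @ T)"
      using map_nth_comp[of encode_nat "k # S @ T"] lT by (simp add: k_def del: upt_Suc)
    then show ?thesis
      unfolding x encode_instance_mat[OF n_def k_def lT] by (simp add: encode_nat_def del: upt_Suc)
  qed
  have nN: "n < N" "k + k + 1 < N"
    using len length_encode_nats(1)[of "k # S @ T"] lT by (auto simp: N_def k_def simp del: concat.simps list.map)
  have valN: "(k # S @ T) ! j < N" if "j < k + k + 1" for j
  proof -
    have "(k # S @ T) ! j \<in> set (k # S @ T)" using that lT by (intro nth_mem) (simp add: k_def)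
    then show ?thesis using len length_encode_nats(2) unfolding N_def by fastforce
  qed
  \<comment> \<open>The digits of a bit position are, from the left, the table, the path or the
    number of the entry, the position, and the vertex. In the second table the position digit writes
    the entry in unary.\<close>
  define g where "g i = (if i div N div N div N = 0
      then i div N mod N < length (Q (i div N div N mod N)) \<and> Q (i div N div N mod N) ! (i div N mod N) = i mod N
      else i div N mod N < (k # S @ T) ! (i div N div N mod N))" for i
  define u where "u = map g [0..<2 * N * N * N]"
  have bit: "bitat u (idx N d i a v) \<longleftrightarrow> g (idx N d i a v)" if "d < 2" "i < N" "a < N" "v < N" for d i a v
  proof -
    have "idx N d i a v < 2 * N * N * N" unfolding idx_def using that by (intro nat_digits_less)
    then show ?thesis by (simp add: u_def bitat_def)
  qed
  have N: "0 < N" by (simp add: N_def)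
  have dig: "idx N d i a v div N div N div N = d" "idx N d i a v div N div N mod N = i"
    "idx N d i a v div N mod N = a" "idx N d i a v mod N = v" if "i < N" "a < N" "v < N" for d i a v
    using that by (simp_all add: idx_def)
  have "certified x n k (cert_val x u) (cert_U x u)"
  proof (rule certified_intro[OF enc x n_def k_def Q cQ])
    fix j assume j: "j < k + k + 1"
    then have jN: "j < N" using nN by simp
    have "cert_val x u j = (\<Sum>s<N. if s < (k # S @ T) ! j then 1 else 0)"
      unfolding cert_val_def N_def[symmetric]
      by (rule sum.cong) (use jN N in \<open>auto simp: bit g_def dig\<close>)
    then show "cert_val x u j = (k # S @ T) ! j"
      using valN[OF j] by (simp add: sum_below)
  next
    fix i a v assume "i < k" "a < n" "v < n"
    then have "i < N" "a < N" "v < N" using nN by auto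
    then show "cert_U x u i a v \<longleftrightarrow> a < length (Q i) \<and> Q i ! a = v"
      unfolding cert_U_def N_def[symmetric] by (simp add: bit g_def dig)
  qed
  moreover have "k < N" using nN(2) by simp
  ultimately have "\<exists>n < N. \<exists>k < N. certified x n k (cert_val x u) (cert_U x u)"
    using nN(1) by blast
  moreover have "length u \<le> 2 * N * N * N" by (simp add: u_def)
  ultimately show ?thesis by blast
qed

text \<open>\<open>n\<close> and \<open>k\<close> are not part of the certificate: being at most the
  length of the input, they are found by bounded quantification.\<close>

theorem half_integral_linkage_NP: "half_integral_linkage \<in> NP"
proof (rule NP_term)
  let ?t = "TEx 3 sLen (TEx 4 sLen sCert)"
  let ?p = "\<lambda>n :: nat. 2 * (n + 1) * (n + 1) * (n + 1)"
  show "wft 22 ?t" using wft_sCert by (simp add: sLen_def)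
  show "polyb ?p" by (intro polyb_intros)
  fix x
  have "tv ?t x u (\<lambda>_. 0) \<noteq> 0 \<longleftrightarrow> (\<exists>n < length x + 1. \<exists>k < length x + 1.
      certified x n k (cert_val x u) (cert_U x u))" for u
    unfolding holds_def[symmetric] by (simp add: holds_sCert sLen_def inp_def)
  then show "x \<in> half_integral_linkage \<longleftrightarrow>
      (\<exists>u. length u \<le> ?p (length x) \<and> tv ?t x u (\<lambda>_. 0) \<noteq> 0)"
    using certificate_exists[of x] certified_imp_linkage by blast
qed

section \<open>The reduction\<close>

text \<open>The number of the variable that stands for the entry \<open>s k t j p\<close> of a
  tableau.\<close>

definition atom :: "nat \<Rightarrow> nat \<Rightarrow> nat \<Rightarrow> nat \<Rightarrow> nat \<Rightarrow> nat" where
  "atom b k t j p = ((k * b + t) * b + j) * b + p"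

lemma atom_less: "k < 4 \<Longrightarrow> t < b \<Longrightarrow> j < b \<Longrightarrow> p < b \<Longrightarrow> atom b k t j p < 4 * b * b * b"
  unfolding atom_def by (intro nat_digits_less)

locale reduction =
  fixes M :: tm and R P :: "nat \<Rightarrow> nat" and tR tP :: trm and m0 :: nat
  assumes wf: "wf_tm M" and two: "2 \<le> tm_tapes M"
    and tR: "represents tR R" and tP: "represents tP P"
begin

section \<open>Sizes of the instance\<close>

definition c0 :: nat where
  "c0 = length (tableau.sits M) + tm_symbols M + tm_tapes M + 4"

text \<open>One bound for times, tapes, positions, symbols, situations and the length of the
  certificate. It serves as the common domain of all variables and as the base of their
  numbering.\<close>

definition B :: "nat \<Rightarrow> nat" where "B n = 2 * R n + P n + n + c0"
definition nV :: "nat \<Rightarrow> nat" where "nV n = 4 * B n * B n * B n"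
definition nY :: "nat \<Rightarrow> nat" where "nY n = nV n * B n"
definition nC :: "nat \<Rightarrow> nat" where "nC n = nY n * nY n * nY n"
definition nh :: "nat \<Rightarrow> nat" where "nh n = nC n * nY n + nC n + nV n"
text \<open>\<open>m0\<close> is chosen so that
  \<open>\<epsilon> \<le> (1 - \<epsilon>) * m0\<close>, which makes the number of hubs at least
  \<open>\<epsilon>\<close> times the number of demands. Adding 2 guarantees a cycle of at least two
  hubs.\<close>

definition nm :: "nat \<Rightarrow> nat" where "nm n = m0 * nh n + 2"

definition tB :: trm where "tB = Add (Add (Add (Mul (Cst 2) tR) tP) (Len 1)) (Cst c0)"
definition tV :: trm where "tV = Mul (Mul (Mul (Cst 4) tB) tB) tB"
definition tY :: trm where "tY = Mul tV tB"
definition tC :: trm where "tC = Mul (Mul tY tY) tY"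
definition th :: trm where "th = Add (Add (Mul tC tY) tC) tV"
definition tM :: trm where "tM = Add (Mul (Cst m0) th) (Cst 2)"

lemma reps:
  "represents tB B" "represents tV nV" "represents tY nY" "represents tC nC" "represents th nh"
  "represents tM nm"
proof -
  show 1: "represents tB B" using tR tP by (simp add: represents_def tB_def B_def inp_def)
  show 2: "represents tV nV" using 1 by (simp add: represents_def tV_def nV_def)
  show 3: "represents tY nY" using 1 2 by (simp add: represents_def tY_def nY_def)
  show 4: "represents tC nC" using 3 by (simp add: represents_def tC_def nC_def)
  show 5: "represents th nh" using 2 3 4 by (simp add: represents_def th_def nh_def)
  show "represents tM nm" using 5 by (simp add: represents_def tM_def nm_def)
qed

lemmas tv_reps [simp] = representsD(3)[OF tR] representsD(3)[OF tP] reps[THEN representsD(3)]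
lemmas wft_reps [simp] = representsD(1)[OF tR] representsD(1)[OF tP] reps[THEN representsD(1)]
lemmas fv_reps [simp] = representsD(2)[OF tR] representsD(2)[OF tP] reps[THEN representsD(2)]

text \<open>The literal of the equation between the entry \<open>k t j p\<close> and the value
  \<open>d\<close>; its quotient by \<open>B\<close> is the variable, its remainder the
  value.\<close>

definition tE :: "trm \<Rightarrow> trm \<Rightarrow> trm \<Rightarrow> trm \<Rightarrow> trm \<Rightarrow> trm" where
  "tE k t j p d =
     Add (Mul (Add (Mul (Add (Mul (Add (Mul k tB) t) tB) j) tB) p) tB) d"

lemma tv_tE [simp]: "tv (tE k t j p d) x u e =
    atom (B (length x)) (tv k x u e) (tv t x u e) (tv j x u e) (tv p x u e) * B (length x) + tv d x u e"
  by (simp add: tE_def atom_def)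

lemma wft_tE [simp]: "3 \<le> b \<Longrightarrow> wft b (tE k t j p d) \<longleftrightarrow> wft b k \<and> wft b t \<and> wft b j \<and> wft b p \<and> wft b d"
  by (auto simp: tE_def)

lemma fv_tE [simp]: "fv (tE k t j p d) = fv k \<union> fv t \<union> fv j \<union> fv p \<union> fv d"
  by (auto simp: tE_def)

definition LOC :: "trm \<Rightarrow> trm \<Rightarrow> trm" where "LOC t l = tE (Cst 0) t (Cst 0) (Cst 0) l"
definition HEAD :: "trm \<Rightarrow> trm \<Rightarrow> trm \<Rightarrow> trm" where "HEAD t j p = tE (Cst 1) t j (Cst 0) p"
definition CELL :: "trm \<Rightarrow> trm \<Rightarrow> trm \<Rightarrow> trm \<Rightarrow> trm" where "CELL t j p a = tE (Cst 2) t j p a"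
definition LEN :: "trm \<Rightarrow> trm" where "LEN l = tE (Cst 3) (Cst 0) (Cst 0) (Cst 0) l"

text \<open>The displacement of the head plus 1, which avoids negative numbers; \<open>tMove\<close>
  adds 1 on the other side.\<close>

definition mv :: "nat \<Rightarrow> nat \<Rightarrow> nat" where
  "mv l j = (case snd (snd (tableau.delta M (tableau.sits M ! l)) ! j) of
     Go_Left \<Rightarrow> 0 | Stay \<Rightarrow> 1 | Go_Right \<Rightarrow> 2)"

abbreviation "L \<equiv> length (tableau.sits M)"
abbreviation "J \<equiv> tm_tapes M"
abbreviation "K \<equiv> tm_symbols M"

definition tRead :: trm where
  "tRead = TTab (tableau.good_read M) L J K (Var 17) (Var 12) (Var 15)"
definition tNext :: trm where
  "tNext = TTab (\<lambda>l b _. tableau.good_next M l b) L L 1 (Var 17) (Var 16) (Cst 0)"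
definition tMove :: trm where
  "tMove = TEx 18 (Cst 3) (TAnd (TTab (\<lambda>l j i. mv l j = i) L J 3 (Var 17) (Var 12) (Var 18))
     (TEq (Add (Var 14) (Cst 1)) (Add (Var 13) (Var 18))))"
definition tWrite :: trm where
  "tWrite = TTab (tableau.good_write M) L J K (Var 17) (Var 12) (Var 15)"
definition tInit :: trm where
  "tInit = TTab (\<lambda>l _ _. tableau.good_init M l) L 1 1 (Var 17) (Cst 0) (Cst 0)"
definition tX :: trm where
  "tX = TOr (TEx 18 (Len 1) (TAnd (TEq (Var 13) (Add tR (Var 18)))
       (TOr (TAnd (Bit 1 (Var 18)) (TEq (Var 15) (Cst 2)))
            (TAnd (TNot (Bit 1 (Var 18))) (TEq (Var 15) (Cst 1))))))
     (TAnd (TNot (TEx 18 (Len 1) (TEq (Var 13) (Add tR (Var 18))))) (TEq (Var 15) (Cst 0)))"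
definition tU :: trm where
  "tU = TAnd (TLe (Var 17) tP)
     (TOr (TAnd (TAnd (TLe tR (Var 13)) (Lt (Var 13) (Add tR (Var 17))))
            (TOr (TEq (Var 15) (Cst 1)) (TEq (Var 15) (Cst 2))))
          (TAnd (TNot (TAnd (TLe tR (Var 13)) (Lt (Var 13) (Add tR (Var 17)))))
            (TEq (Var 15) (Cst 0))))"

text \<open>
  Each rule is a condition on the variables 11 to 17, which stand for a time, a tape, two
  positions, two symbols and a situation, followed by the three equations that it forbids.
\<close>
definition rules :: "(trm \<times> trm \<times> trm \<times> trm) list" where
  "rules = (let t = Var 11; t' = Add (Var 11) (Cst 1); j = Var 12; p = Var 13; q = Var 14;
       a = Var 15; b = Var 16; l = Var 17; z = Cst 0; tape = Lt (Var 12) (Cst J); time = Lt (Var 11) tR in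
    [(TAnd (TLe t tR) (TAnd tape (TNot tRead)), LOC t l, HEAD t j p, CELL t j p a),
     (TAnd time (TNot tNext), LOC t l, LOC t' b, LOC t l),
     (TAnd time (TAnd tape (TNot tMove)), LOC t l, HEAD t j p, HEAD t' j q),
     (TAnd time (TAnd tape (TNot tWrite)), LOC t l, HEAD t j p, CELL t' j p a),
     (TAnd time (TAnd tape (TAnd (TNot (TEq p q)) (TNot (TEq a b)))), HEAD t j q, CELL t j p a, CELL t' j p b),
     (TNot tInit, LOC z l, LOC z l, LOC z l),
     (TAnd tape (TNot (TEq p tR)), HEAD z j p, HEAD z j p, HEAD z j p),
     (TNot tX, CELL z z p a, CELL z z p a, CELL z z p a),
     (TNot tU, CELL z (Cst 1) p a, LEN l, LEN l),
     (TAnd tape (TAnd (TLe (Cst 2) j) (TNot (TEq a z))), CELL z j p a, CELL z j p a, CELL z j p a),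
     (TNot (TEq a (Cst 2)), CELL tR (Cst (J - 1)) tR a, CELL tR (Cst (J - 1)) tR a, CELL tR (Cst (J - 1)) tR a)])"

definition env :: "(nat \<Rightarrow> nat) \<Rightarrow> nat \<Rightarrow> nat \<Rightarrow> nat \<Rightarrow> nat \<Rightarrow> nat \<Rightarrow> nat \<Rightarrow> nat \<Rightarrow> nat \<Rightarrow> nat" where
  "env e t j p q a b l = e(11 := t, 12 := j, 13 := p, 14 := q, 15 := a, 16 := b, 17 := l)"

lemma env_simps [simp]:
  "env e t j p q a b l 11 = t" "env e t j p q a b l 12 = j" "env e t j p q a b l 13 = p"
  "env e t j p q a b l 14 = q" "env e t j p q a b l 15 = a" "env e t j p q a b l 16 = b"
  "env e t j p q a b l 17 = l" "env e t j p q a b l 8 = e 8" "env e t j p q a b l 9 = e 9"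
  "env e t j p q a b l 10 = e 10"
  by (simp_all add: env_def)

text \<open>The given triple is held in variables 8 to 10. It is forbidden if a bounded search over
  variables 11 to 17 finds an instance of a rule with exactly these three equations.\<close>

definition tF :: trm where
  "tF = TEx 11 tB (TEx 12 tB (TEx 13 tB (TEx 14 tB (TEx 15 tB (TEx 16 tB (TEx 17 tB
     (TDisj (map (\<lambda>(c, r1, r2, r3). TAnd c (TAnd (TEq (Var 8) r1) (TAnd (TEq (Var 9) r2)
       (TEq (Var 10) r3)))) rules))))))))"

lemma holds_tF:
  "holds tF x u e \<longleftrightarrow> (\<exists>t < B (length x). \<exists>j < B (length x). \<exists>p < B (length x). \<exists>q < B (length x).
     \<exists>a < B (length x). \<exists>b < B (length x). \<exists>l < B (length x). \<exists>(c, r1, r2, r3) \<in> set rules.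
       holds c x u (env e t j p q a b l) \<and> e 8 = tv r1 x u (env e t j p q a b l) \<and>
       e 9 = tv r2 x u (env e t j p q a b l) \<and> e 10 = tv r3 x u (env e t j p q a b l))"
proof -
  have "(\<exists>r \<in> set rules. holds (case r of (c, r1, r2, r3) \<Rightarrow> TAnd c (TAnd (TEq (Var 8) r1) (TAnd (TEq (Var 9) r2)
       (TEq (Var 10) r3)))) x u (env e t j p q a b l)) \<longleftrightarrow>
    (\<exists>(c, r1, r2, r3) \<in> set rules.
       holds c x u (env e t j p q a b l) \<and> e 8 = tv r1 x u (env e t j p q a b l) \<and>
       e 9 = tv r2 x u (env e t j p q a b l) \<and> e 10 = tv r3 x u (env e t j p q a b l))" for t j p q a b l
    by (rule bex_cong[OF refl]) (auto split: prod.splits)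
  then show ?thesis by (simp add: tF_def env_def[symmetric])
qed

definition forbidden :: "bool list \<Rightarrow> nat \<Rightarrow> nat \<Rightarrow> nat \<Rightarrow> bool" where
  "forbidden x y1 y2 y3 \<longleftrightarrow> holds tF x [] ((\<lambda>_. 0)(8 := y1, 9 := y2, 10 := y3))"

end

locale reduction_input = reduction +
  fixes x :: "bool list"
begin

section \<open>The constraints for a fixed input\<close>

definition n :: nat where "n = length x"
definition r :: nat where "r = R n"
definition b :: nat where "b = B n"
definition pp :: nat where "pp = P n"

lemma tableau: "tableau M"
  using wf two by unfold_locales

lemma bounds: "2 * r < b" "pp < b" "L \<le> b" "K \<le> b" "J < b" "4 \<le> b" "r < b" "r + pp \<le> b"
  by (auto simp: b_def B_def r_def pp_def c0_def)

lemma conds: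
  fixes e :: "nat \<Rightarrow> nat"
  assumes "t < b" "j < b" "p < b" "q < b" "a < b" "d < b" "l < b"
  defines "e' \<equiv> env e t j p q a d l"
  shows "j < J \<Longrightarrow> holds tRead x u e' \<longleftrightarrow> tableau.good_read M l j a"
    "holds tNext x u e' \<longleftrightarrow> tableau.good_next M l d"
    "j < J \<Longrightarrow> holds tMove x u e' \<longleftrightarrow> tableau.good_move M l j p q"
    "j < J \<Longrightarrow> holds tWrite x u e' \<longleftrightarrow> tableau.good_write M l j a"
    "holds tInit x u e' \<longleftrightarrow> tableau.good_init M l"
    "holds tX x u e' \<longleftrightarrow> tableau.good_x r x p a"
    "holds tU x u e' \<longleftrightarrow> tableau.good_u r pp p a l"
proof -
  note defs = tableau.good_read_def[OF tableau] tableau.good_next_def[OF tableau] tableau.good_move_def[OF tableau]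
    tableau.good_write_def[OF tableau] tableau.good_init_def[OF tableau]
  \<comment> \<open>The tables of \<open>tRead\<close> and \<open>tWrite\<close> stop at
    \<open>K\<close>; no case is lost, since only symbols below \<open>K\<close> are ever read or
    written.\<close>
  have K: "snd (tableau.sits M ! l) ! j < K" "fst (snd (tableau.delta M (tableau.sits M ! l)) ! j) < K"
    if l: "l < L" and j: "j < J"
  proof -
    note sn = tableau.sits_nth[OF tableau l]
    show "snd (tableau.sits M ! l) ! j < K" using sn j by (metis lessThan_iff nth_mem subsetD)
    obtain q' ss where qs: "tableau.sits M ! l = (q', ss)" by fastforce
    then show "fst (snd (tableau.delta M (tableau.sits M ! l)) ! j) < K"
      using tableau.delta_wf(2,3)[OF tableau, of q' ss] sn j
      by (metis fst_conv snd_conv imageI lessThan_iff nth_mem subsetD)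
  qed
  show "j < J \<Longrightarrow> holds tRead x u e' \<longleftrightarrow> tableau.good_read M l j a"
    using K by (auto simp: tRead_def e'_def defs)
  show "holds tNext x u e' \<longleftrightarrow> tableau.good_next M l d"
    by (auto simp: tNext_def e'_def defs)
  show "j < J \<Longrightarrow> holds tWrite x u e' \<longleftrightarrow> tableau.good_write M l j a"
    using K by (auto simp: tWrite_def e'_def defs)
  show "holds tInit x u e' \<longleftrightarrow> tableau.good_init M l"
    by (auto simp: tInit_def e'_def defs)
  show "j < J \<Longrightarrow> holds tMove x u e' \<longleftrightarrow> tableau.good_move M l j p q"
  proof -
    assume j: "j < J"
    have m: "q + 1 = p + mv l j \<longleftrightarrow>
        int q = move_pos (snd (snd (tableau.delta M (tableau.sits M ! l)) ! j)) (int p)"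
      by (cases "snd (snd (tableau.delta M (tableau.sits M ! l)) ! j)") (auto simp: mv_def)
    have "mv l j < 3" by (auto simp: mv_def split: move.splits)
    then show ?thesis using j m by (auto simp: tMove_def e'_def env_def defs)
  qed
  show "holds tX x u e' \<longleftrightarrow> tableau.good_x r x p a"
  proof (cases "r \<le> p \<and> p < r + length x")
    case True
    then have "p = r + i \<longleftrightarrow> i = p - r" "p - r < length x" for i by auto
    then show ?thesis using True
      by (auto simp: tX_def e'_def env_def tableau.good_x_def[OF tableau] inp_def r_def[symmetric]
          n_def[symmetric] bit_symbol_def)
  next
    case False
    then have "\<not> (\<exists>i < length x. p = r + i)" by auto
    then show ?thesis using False
      by (auto simp: tX_def e'_def env_def tableau.good_x_def[OF tableau] inp_def r_def[symmetric]
          n_def[symmetric])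
  qed
  show "holds tU x u e' \<longleftrightarrow> tableau.good_u r pp p a l"
    by (auto simp: tU_def e'_def tableau.good_u_def[OF tableau] r_def[symmetric]
          n_def[symmetric] pp_def[symmetric])
qed

text \<open>Since the rules do not look at variables 8 to 10, their conditions and equations are
  independent of the triple against which they are compared.\<close>

lemma fv_rules:
  assumes "(c, r1, r2, r3) \<in> set rules"
  shows "fv c \<union> fv r1 \<union> fv r2 \<union> fv r3 \<subseteq> {11..17}"
proof -
  define A where "A = {11..17 :: nat}"
  have mem: "11 \<in> A" "12 \<in> A" "13 \<in> A" "14 \<in> A" "15 \<in> A" "16 \<in> A" "17 \<in> A"
    by (simp_all add: A_def)
  have tab: "fv tRead \<subseteq> A" "fv tNext \<subseteq> A" "fv tWrite \<subseteq> A" "fv tInit \<subseteq> A"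
    unfolding tRead_def tNext_def tWrite_def tInit_def by (rule order_trans[OF fv_TTab], simp add: mem)+
  have tab': "fv tMove \<subseteq> A"
    using fv_TTab[of "\<lambda>l j i. mv l j = i" L J 3 "Var 17" "Var 12" "Var 18"] mem by (auto simp: tMove_def)
  have x: "fv tX \<subseteq> A" "fv tU \<subseteq> A" using mem by (auto simp: tX_def tU_def)
  have "list_all (\<lambda>(c, r1, r2, r3). fv c \<union> fv r1 \<union> fv r2 \<union> fv r3 \<subseteq> A) rules"
    unfolding rules_def Let_def LOC_def HEAD_def CELL_def LEN_def by (simp add: mem tab tab' x)
  then show ?thesis using assms unfolding A_def list_all_iff by blast
qed

text \<open>Some equations speak of time \<open>t + 1\<close>, which is below \<open>b\<close> only
  because the conditions of these rules demand \<open>t < r\<close>; hence the assumption that the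
  condition holds.\<close>

lemma rules_less:
  assumes "t < b" "j < b" "p < b" "q < b" "a < b" "d < b" "l < b"
    and "(c, r1, r2, r3) \<in> set rules" "holds c x u (env e t j p q a d l)"
  shows "tv r1 x u (env e t j p q a d l) < nY n \<and> tv r2 x u (env e t j p q a d l) < nY n \<and>
    tv r3 x u (env e t j p q a d l) < nY n"
proof -
  have E: "atom b k t j p * b + d < nY n" if "k < 4" "t < b" "j < b" "p < b" "d < b" for k t j p d
    unfolding nY_def nV_def b_def[symmetric] using that by (intro nat_digits_less atom_less)
  have rep: "R (length x) = r" "B (length x) = b" by (simp_all add: r_def b_def n_def)
  have lt: "0 < b" "1 < b" "Suc 0 < b" "r < b" "J - Suc 0 < b" "t < r \<Longrightarrow> Suc t < b"
    using bounds by auto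
  have "list_all (\<lambda>(c, r1, r2, r3). holds c x u (env e t j p q a d l) \<longrightarrow>
    tv r1 x u (env e t j p q a d l) < nY n \<and> tv r2 x u (env e t j p q a d l) < nY n \<and>
    tv r3 x u (env e t j p q a d l) < nY n) rules"
    unfolding rules_def Let_def LOC_def HEAD_def CELL_def LEN_def
    by (simp add: rep E lt assms(1-7))
  then show ?thesis using assms(8,9) unfolding list_all_iff by blast
qed

definition meets :: "(nat \<Rightarrow> nat) \<Rightarrow> nat \<Rightarrow> bool" where
  "meets \<sigma> y \<longleftrightarrow> \<sigma> (y div b) = y mod b"

definition fires :: "nat \<Rightarrow> nat \<Rightarrow> nat \<Rightarrow> nat \<Rightarrow> nat \<Rightarrow> nat \<Rightarrow> nat \<Rightarrow> nat \<Rightarrow> nat \<Rightarrow> nat \<Rightarrow> bool" where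
  "fires t j p q a d l y1 y2 y3 \<longleftrightarrow> (\<exists>(c, r1, r2, r3) \<in> set rules.
     let e = env (\<lambda>_. 0) t j p q a d l in
     holds c x [] e \<and> y1 = tv r1 x [] e \<and> y2 = tv r2 x [] e \<and> y3 = tv r3 x [] e)"

definition blocks :: "(nat \<Rightarrow> nat) \<Rightarrow> nat \<Rightarrow> nat \<Rightarrow> nat \<Rightarrow> nat \<Rightarrow> nat \<Rightarrow> nat \<Rightarrow> nat \<Rightarrow> bool" where
  "blocks \<sigma> t j p q a d l \<longleftrightarrow> (\<forall>(c, r1, r2, r3) \<in> set rules.
     let e = env (\<lambda>_. 0) t j p q a d l in
     holds c x [] e \<longrightarrow> \<not> (meets \<sigma> (tv r1 x [] e) \<and> meets \<sigma> (tv r2 x [] e) \<and> meets \<sigma> (tv r3 x [] e)))"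

definition obeys :: "(nat \<Rightarrow> nat) \<Rightarrow> bool" where
  "obeys \<sigma> \<longleftrightarrow> (\<forall>t < b. \<forall>j < b. \<forall>p < b. \<forall>q < b. \<forall>a < b. \<forall>d < b. \<forall>l < b. blocks \<sigma> t j p q a d l)"

lemma blocks_iff:
  "blocks \<sigma> t j p q a d l \<longleftrightarrow>
    (\<forall>y1 y2 y3. fires t j p q a d l y1 y2 y3 \<longrightarrow> \<not> (meets \<sigma> y1 \<and> meets \<sigma> y2 \<and> meets \<sigma> y3))"
  unfolding blocks_def fires_def Let_def by fast

lemma fires_less:
  assumes "t < b" "j < b" "p < b" "q < b" "a < b" "d < b" "l < b" "fires t j p q a d l y1 y2 y3"
  shows "y1 < nY n \<and> y2 < nY n \<and> y3 < nY n"
  using assms(8) rules_less[OF assms(1-7)] unfolding fires_def Let_def by fast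

lemma forbidden_iff:
  "forbidden x y1 y2 y3 \<longleftrightarrow> (\<exists>t < b. \<exists>j < b. \<exists>p < b. \<exists>q < b. \<exists>a < b. \<exists>d < b. \<exists>l < b.
     fires t j p q a d l y1 y2 y3)"
proof -
  define e1 :: "nat \<Rightarrow> nat" where "e1 = (\<lambda>_. 0)(8 := y1, 9 := y2, 10 := y3)"
  have e1: "e1 8 = y1" "e1 9 = y2" "e1 10 = y3" by (simp_all add: e1_def)
  have eq: "tv c x [] (env e1 t j p q a d l) = tv c x [] (env (\<lambda>_. 0) t j p q a d l)"
    if "fv c \<subseteq> {11..17}" for c t j p q a d l
    by (rule tv_fv_cong) (use that in \<open>auto simp: env_def e1_def\<close>)
  have inner: "(\<exists>(c, r1, r2, r3) \<in> set rules.
       holds c x [] (env e1 t j p q a d l) \<and> e1 8 = tv r1 x [] (env e1 t j p q a d l) \<and>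
       e1 9 = tv r2 x [] (env e1 t j p q a d l) \<and> e1 10 = tv r3 x [] (env e1 t j p q a d l)) \<longleftrightarrow>
    (\<exists>(c, r1, r2, r3) \<in> set rules. let e = env (\<lambda>_. 0) t j p q a d l in
     holds c x [] e \<and> y1 = tv r1 x [] e \<and> y2 = tv r2 x [] e \<and> y3 = tv r3 x [] e)" for t j p q a d l
  proof (rule bex_cong[OF refl], clarify)
    fix c r1 r2 r3 assume "(c, r1, r2, r3) \<in> set rules"
    then have fv: "fv c \<subseteq> {11..17}" "fv r1 \<subseteq> {11..17}" "fv r2 \<subseteq> {11..17}" "fv r3 \<subseteq> {11..17}"
      using fv_rules by blast+
    show "holds c x [] (env e1 t j p q a d l) \<and> e1 8 = tv r1 x [] (env e1 t j p q a d l) \<and>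
       e1 9 = tv r2 x [] (env e1 t j p q a d l) \<and> e1 10 = tv r3 x [] (env e1 t j p q a d l) \<longleftrightarrow>
     (let e = env (\<lambda>_. 0) t j p q a d l in
     holds c x [] e \<and> y1 = tv r1 x [] e \<and> y2 = tv r2 x [] e \<and> y3 = tv r3 x [] e)"
      unfolding holds_def Let_def fv[THEN eq] by (simp add: e1)
  qed
  show ?thesis unfolding forbidden_def e1_def[symmetric] holds_tF b_def n_def fires_def by (simp only: inner)
qed

text \<open>The view from triples, as in the clauses, against the view from instances of rules. The
  passage to instances needs \<open>fires_less\<close>: the triple of an instance is in the range
  for which there are clauses.\<close>

lemma forbidden_obeys:
  "(\<forall>y1 < nY n. \<forall>y2 < nY n. \<forall>y3 < nY n. forbidden x y1 y2 y3 \<longrightarrow>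
      \<not> (\<sigma> (y1 div b) = y1 mod b \<and> \<sigma> (y2 div b) = y2 mod b \<and> \<sigma> (y3 div b) = y3 mod b)) \<longleftrightarrow> obeys \<sigma>"
  (is "?L \<longleftrightarrow> _")
proof
  assume L: ?L
  show "obeys \<sigma>" unfolding obeys_def blocks_iff
  proof (intro allI impI)
    fix t j p q a d l y1 y2 y3
    assume le: "t < b" "j < b" "p < b" "q < b" "a < b" "d < b" "l < b"
    assume f: "fires t j p q a d l y1 y2 y3"
    have "forbidden x y1 y2 y3" unfolding forbidden_iff
      by (rule exI[of _ t], rule conjI[OF le(1)], rule exI[of _ j], rule conjI[OF le(2)],
          rule exI[of _ p], rule conjI[OF le(3)], rule exI[of _ q], rule conjI[OF le(4)],
          rule exI[of _ a], rule conjI[OF le(5)], rule exI[of _ d], rule conjI[OF le(6)],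
          rule exI[of _ l], rule conjI[OF le(7) f])
    then show "\<not> (meets \<sigma> y1 \<and> meets \<sigma> y2 \<and> meets \<sigma> y3)"
      using L fires_less[OF le f] unfolding meets_def by blast
  qed
next
  assume o: "obeys \<sigma>"
  show ?L
  proof (intro allI impI)
    fix y1 y2 y3 assume "forbidden x y1 y2 y3"
    then obtain t j p q a d l where
      le: "t < b" "j < b" "p < b" "q < b" "a < b" "d < b" "l < b" and f: "fires t j p q a d l y1 y2 y3"
      unfolding forbidden_iff by (elim exE conjE)
    have "blocks \<sigma> t j p q a d l" by (rule o[unfolded obeys_def, rule_format]) (rule le)+
    then show "\<not> (\<sigma> (y1 div b) = y1 mod b \<and> \<sigma> (y2 div b) = y2 mod b \<and> \<sigma> (y3 div b) = y3 mod b)"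
      using f unfolding blocks_iff meets_def by blast
  qed
qed

text \<open>A rule forbids its equations when its condition holds; contraposed, the equations imply
  a condition of \<open>valid\<close> in which the parameters replace the entries of the
  tableau.\<close>

lemma blocks_explicit:
  assumes "t < b" "j < b" "p < b" "q < b" "a < b" "d < b" "l < b"
  shows "blocks \<sigma> t j p q a d l \<longleftrightarrow>
    (t \<le> r \<and> j < J \<and> \<sigma> (atom b 0 t 0 0) = l \<and> \<sigma> (atom b 1 t j 0) = p \<and> \<sigma> (atom b 2 t j p) = a \<longrightarrow>
       tableau.good_read M l j a) \<and>
    (t < r \<and> \<sigma> (atom b 0 t 0 0) = l \<and> \<sigma> (atom b 0 (t + 1) 0 0) = d \<longrightarrow> tableau.good_next M l d) \<and>
    (t < r \<and> j < J \<and> \<sigma> (atom b 0 t 0 0) = l \<and> \<sigma> (atom b 1 t j 0) = p \<and> \<sigma> (atom b 1 (t + 1) j 0) = q \<longrightarrow>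
       tableau.good_move M l j p q) \<and>
    (t < r \<and> j < J \<and> \<sigma> (atom b 0 t 0 0) = l \<and> \<sigma> (atom b 1 t j 0) = p \<and> \<sigma> (atom b 2 (t + 1) j p) = a \<longrightarrow>
       tableau.good_write M l j a) \<and>
    (t < r \<and> j < J \<and> p \<noteq> q \<and> \<sigma> (atom b 1 t j 0) = q \<and> \<sigma> (atom b 2 t j p) = a \<and> \<sigma> (atom b 2 (t + 1) j p) = d \<longrightarrow>
       a = d) \<and>
    (\<sigma> (atom b 0 0 0 0) = l \<longrightarrow> tableau.good_init M l) \<and>
    (j < J \<and> \<sigma> (atom b 1 0 j 0) = p \<longrightarrow> p = r) \<and>
    (\<sigma> (atom b 2 0 0 p) = a \<longrightarrow> tableau.good_x r x p a) \<and>
    (\<sigma> (atom b 2 0 1 p) = a \<and> \<sigma> (atom b 3 0 0 0) = l \<longrightarrow> tableau.good_u r pp p a l) \<and>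
    (j < J \<and> 2 \<le> j \<and> \<sigma> (atom b 2 0 j p) = a \<longrightarrow> a = 0) \<and>
    (\<sigma> (atom b 2 r (J - 1) r) = a \<longrightarrow> a = 2)"
proof -
  have m: "meets \<sigma> (y * b + d) \<longleftrightarrow> \<sigma> y = d" if "d < b" for y d
    using that by (simp add: meets_def)
  have rep: "R (length x) = r" "B (length x) = b" by (simp_all add: r_def b_def n_def)
  note c = conds[OF assms]
  show ?thesis
    unfolding blocks_def list_all_iff[symmetric] rules_def Let_def LOC_def HEAD_def CELL_def LEN_def
      list.pred_inject prod.case
    apply (intro arg_cong2[where f = "(\<and>)"])
    apply (simp_all add: c rep m assms cong: conj_cong)
    apply auto
    done
qed

lemma obeys_imp_valid:
  assumes o: "obeys \<sigma>" and \<sigma>: "\<And>v. v < nV n \<Longrightarrow> \<sigma> v < b"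
  shows "\<exists>s. tableau.valid M r pp b x s \<and> (\<forall>k t j p. s k t j p < b)"
proof -
  \<comment> \<open>The value 0 outside the range keeps \<open>s\<close> below \<open>b\<close>
    everywhere.\<close>
  define s where "s k t j p = (if k < 4 \<and> t < b \<and> j < b \<and> p < b then \<sigma> (atom b k t j p) else 0)" for k t j p
  have s: "\<sigma> (atom b k t j p) = s k t j p" if "k < 4" "t < b" "j < b" "p < b" for k t j p
    using that by (simp add: s_def)
  have "s k t j p < b" for k t j p
  proof -
    have "atom b k t j p < nV n" if "k < 4" "t < b" "j < b" "p < b"
      unfolding nV_def b_def[symmetric] using that by (rule atom_less)
    then show ?thesis using \<sigma> bounds by (auto simp: s_def)
  qed
  note sb = this
  have lt: "0 < b" "1 < b" "r < b" "J - 1 < b" "2 * r < b" using bounds by auto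
  have B: "blocks \<sigma> t j p q a d l" if "t < b" "j < b" "p < b" "q < b" "a < b" "d < b" "l < b" for t j p q a d l
    by (rule o[unfolded obeys_def, rule_format]) (rule that)+
  \<comment> \<open>Each condition of \<open>valid\<close> is an instance of a rule: the parameters
    mentioned by the rule are set to the actual entries of \<open>s\<close>, which makes its
    equations true, and the others to 0.\<close>
  note E = blocks_explicit[THEN iffD1, OF _ _ _ _ _ _ _ B]
  have "tableau.valid M r pp b x s"
    unfolding tableau.valid_def[OF tableau]
  proof (intro conjI allI impI)
    fix t j assume t: "t \<le> r" and j: "j < J"
    then have "t < b" "j < b" using bounds by auto
    then show "tableau.good_read M (s 0 t 0 0) j (s 2 t j (s 1 t j 0))"
      using E[of t j "s 1 t j 0" 0 "s 2 t j (s 1 t j 0)" 0 "s 0 t 0 0"]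
        sb lt t j by (simp add: s)
  next
    fix t assume t: "t < r"
    then have "t < b" "t + 1 < b" using bounds by auto
    then show "tableau.good_next M (s 0 t 0 0) (s 0 (t + 1) 0 0)"
      using E[of t 0 0 0 0 "s 0 (t + 1) 0 0" "s 0 t 0 0"]
        sb lt t by (simp add: s)
  next
    fix t j assume t: "t < r" and j: "j < J"
    then have "t < b" "t + 1 < b" "j < b" using bounds by auto
    then show "tableau.good_move M (s 0 t 0 0) j (s 1 t j 0) (s 1 (t + 1) j 0)"
      using E[of t j "s 1 t j 0" "s 1 (t + 1) j 0" 0 0 "s 0 t 0 0"]
        sb lt t j by (simp add: s)
  next
    fix t j assume t: "t < r" and j: "j < J"
    then have "t < b" "t + 1 < b" "j < b" using bounds by auto
    then show "tableau.good_write M (s 0 t 0 0) j (s 2 (t + 1) j (s 1 t j 0))"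
      using E[of t j "s 1 t j 0" 0 "s 2 (t + 1) j (s 1 t j 0)" 0 "s 0 t 0 0"]
        sb lt t j by (simp add: s)
  next
    fix t j p assume t: "t < r" and j: "j < J" and p: "p < b" "p \<noteq> s 1 t j 0"
    then have "t < b" "t + 1 < b" "j < b" using bounds by auto
    then show "s 2 (t + 1) j p = s 2 t j p"
      using E[of t j p "s 1 t j 0" "s 2 t j p" "s 2 (t + 1) j p" 0]
        sb lt t j p by (simp add: s)
  next
    show "tableau.good_init M (s 0 0 0 0)"
      using E[of 0 0 0 0 0 0 "s 0 0 0 0"] sb lt by (simp add: s)
  next
    fix j assume j: "j < J"
    then have "j < b" using bounds by auto
    then show "s 1 0 j 0 = r"
      using E[of 0 j "s 1 0 j 0" 0 0 0 0] sb lt j by (simp add: s)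
  next
    fix p assume p: "p < b"
    then show "tableau.good_x r x p (s 2 0 0 p)"
      using E[of 0 0 p 0 "s 2 0 0 p" 0 0] sb lt by (simp add: s)
    show "tableau.good_u r pp p (s 2 0 1 p) (s 3 0 0 0)"
      using E[of 0 0 p 0 "s 2 0 1 p" 0 "s 3 0 0 0"] sb lt p by (simp add: s)
  next
    fix j p assume j: "j < J" and p: "p < b" and 2: "2 \<le> j"
    then have "j < b" using bounds by auto
    then show "s 2 0 j p = 0"
      using E[of 0 j p 0 "s 2 0 j p" 0 0] sb lt j p 2 by (simp add: s)
  next
    show "s 2 r (J - 1) r = 2"
      using E[of 0 0 0 0 "s 2 r (J - 1) r" 0 0] sb lt by (simp add: s)
  qed
  then show ?thesis using sb by blast
qed

lemma valid_imp_obeys: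
  assumes v: "tableau.valid M r pp b x s" and s: "\<And>k t j p. s k t j p < b"
  shows "\<exists>\<sigma>. obeys \<sigma> \<and> (\<forall>v < nV n. \<sigma> v < b)"
proof -
  define \<sigma> where "\<sigma> v = s (v div b div b div b) (v div b div b mod b) (v div b mod b) (v mod b)" for v
  have \<sigma>: "\<sigma> (atom b k t j p) = s k t j p" if "t < b" "j < b" "p < b" for k t j p
    using that by (simp add: \<sigma>_def atom_def)
  have lt: "0 < b" "Suc 0 < b" "r < b" "J - Suc 0 < b" "t < r \<Longrightarrow> Suc t < b" for t using bounds by auto
  have "obeys \<sigma>" unfolding obeys_def
  proof (intro allI impI)
    fix t j p q a d l
    assume le: "t < b" "j < b" "p < b" "q < b" "a < b" "d < b" "l < b"
    show "blocks \<sigma> t j p q a d l"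
      unfolding blocks_explicit[OF le]
      using v[unfolded tableau.valid_def[OF tableau]] le lt
      by (auto simp: \<sigma>)
  qed
  then show ?thesis using s by (auto simp: \<sigma>_def)
qed

definition lit :: "nat \<Rightarrow> nat \<Rightarrow> bool" where "lit = forbid_lit (nY n) (forbidden x)"

theorem accept_iff_csp_sat:
  assumes "\<And>u. length u \<le> pp \<Longrightarrow> \<exists>b. tm_outputs M [x, u] r [b]"
  shows "(\<exists>u. length u \<le> pp \<and> tm_outputs M [x, u] r [True]) \<longleftrightarrow> csp_sat (nV n) b (nC n) lit"
proof -
  have pos: "1 \<le> nV n" "2 \<le> b" using bounds by (auto simp: nV_def b_def[symmetric])
  have "csp_sat (nV n) b (nC n) lit \<longleftrightarrow> (\<exists>\<sigma>. (\<forall>v < nV n. \<sigma> v < b) \<and> obeys \<sigma>)"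
    using csp_sat_forbid[OF pos, of "forbidden x"] forbidden_obeys
    unfolding lit_def nC_def nY_def b_def[symmetric] by simp
  also have "\<dots> \<longleftrightarrow> (\<exists>s. tableau.valid M r pp b x s \<and> (\<forall>k t j p. s k t j p < b))"
    using obeys_imp_valid valid_imp_obeys by blast
  also have "\<dots> \<longleftrightarrow> (\<exists>u. length u \<le> pp \<and> tm_outputs M [x, u] r [True])"
    using tableau.valid_imp_accept[OF tableau, of r pp b x] tableau.accept_imp_valid[OF tableau, of _ pp x r b]
      bounds assms by blast
  finally show ?thesis by blast
qed

end

text \<open>The double negation turns an arbitrary nonzero value of the condition into the factor
  1.\<close>

definition TIf :: "trm \<Rightarrow> trm \<Rightarrow> trm \<Rightarrow> trm" where
  "TIf c s t = Add (Mul (TNot (TNot c)) s) (Mul (TNot c) t)"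

lemma TIf_simps [simp]:
  "tv (TIf c s t) x u e = (if holds c x u e then tv s x u e else tv t x u e)"
  "wft b (TIf c s t) \<longleftrightarrow> wft b c \<and> wft b s \<and> wft b t"
  by (auto simp: TIf_def TNot_def holds_def)

section \<open>Printing the encoded instance\<close>

definition pNat :: "nat \<Rightarrow> trm \<Rightarrow> prog" where
  "pNat i t = Cat (For i t (Emit (Cst 1))) (Emit (Cst 0))"

lemma concat_singletons: "concat (map (\<lambda>a. [f a]) xs) = map f xs"
  by (induction xs) auto

lemma pv_pNat [simp]: "pv (pNat i t) x u e = encode_nat (tv t x u e)"
  by (simp add: pNat_def encode_nat_def concat_singletons map_replicate_const)

lemma wfp_pNat [simp]: "wfp b (pNat i t) \<longleftrightarrow> 3 \<le> i \<and> i < b \<and> wft b t"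
  by (auto simp: pNat_def)

context reduction
begin

text \<open>\<open>Var 5\<close> is the clause, \<open>Var 6\<close> and \<open>Var 7\<close> are
  the variable and the value of the literal. The clause index is decoded by searching for its three
  digits, which are put where \<open>tF\<close> expects them.\<close>

definition tLit :: trm where
  "tLit = (let y = Add (Mul (Var 6) tB) (Var 7) in
     TEx 8 tY (TEx 9 tY (TEx 10 tY
       (TAnd (TEq (Var 5) (Add (Mul (Add (Mul (Var 8) tY) (Var 9)) tY) (Var 10)))
         (TImp tF (TOr (TEq y (Var 8)) (TOr (TEq y (Var 9)) (TEq y (Var 10)))))))))"

definition tK :: trm where "tK = Add th tM"
definition tN :: trm where "tN = Add (Add tK tC) tV"

definition tArc :: trm where
  "tArc = (let i = Var 3; j = Var 4; c = Var 5; v = Var 6; y = Add (Mul (Var 6) tB) (Var 7);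
       w = Mul tC tY; occ = Add (Mul c tY) y in
     TAnd (TNot (TEq i j)) (TDisj
       [TAnd (TLe th i) (Lt i tK), TAnd (TLe th j) (Lt j tK),
        TEx 5 tC (TEx 6 tV (TEx 7 tB (TDisj
          [TAnd (TEq i (Add w c)) (TAnd (TEq j occ) tLit),
           TAnd (TEq i occ) (TAnd (TEq j (Add tK c)) tLit),
           TAnd (TEq i (Add (Add w tC) v)) (TAnd (TEq j occ) (TEq c (Cst 0))),
           TAnd (TEq i occ) (TAnd (TEq j (Add (Add tK tC) v)) (TEq (Add c (Cst 1)) tC)),
           TAnd (TEq i occ) (TAnd (TEq j (Add (Mul (Add c (Cst 1)) tY) y)) (Lt (Add c (Cst 1)) tC))])))]))"

definition tTgt :: trm where
  "tTgt = (let i = Var 3 in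
     TIf (Lt i (Mul tC tY)) i (TIf (Lt i th) (Add i (Add (Add tC tV) tM))
       (TIf (Lt (Add i (Cst 1)) tK) (Add i (Cst 1)) th)))"

definition red_prog :: prog where
  "red_prog = Cat (pNat 5 tN) (Cat (For 3 tN (For 4 tN (Emit tArc)))
     (Cat (pNat 5 tK) (Cat (For 3 tK (pNat 4 (Var 3))) (For 3 tK (pNat 4 tTgt)))))"

lemma wft_tF: "wft 30 tF"
proof -
  have "list_all (\<lambda>(c, r1, r2, r3). wft 30 c \<and> wft 30 r1 \<and> wft 30 r2 \<and> wft 30 r3) rules"
    unfolding rules_def Let_def LOC_def HEAD_def CELL_def LEN_def tRead_def tNext_def tMove_def
      tWrite_def tInit_def tX_def tU_def
    by simp
  then show ?thesis by (auto simp: tF_def list_all_iff)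
qed

lemma wfp_red_prog: "wfp 30 red_prog"
  by (simp add: red_prog_def tN_def tK_def tArc_def tTgt_def tLit_def Let_def wft_tF)

end

context reduction_input
begin

section \<open>Correctness of the printed instance\<close>

lemma rep: "length x = n" "R n = r" "B n = b" "P n = pp"
  by (simp_all add: r_def b_def n_def pp_def)

lemma fv_tF: "fv tF \<subseteq> {8, 9, 10}"
  using fv_rules by (fastforce simp: tF_def)

lemma holds_tLit: "holds tLit x [] e \<longleftrightarrow> lit (e 5) (e 6 * b + e 7)"
proof -
  have "holds tF x [] (e(8 := y1, 9 := y2, 10 := y3)) \<longleftrightarrow> forbidden x y1 y2 y3" for y1 y2 y3
    unfolding forbidden_def holds_def
    by (intro arg_cong[where f = "\<lambda>v. v \<noteq> 0"] tv_fv_cong) (use fv_tF in auto)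
  then show ?thesis
    by (simp add: tLit_def Let_def lit_def forbid_lit_def rep)
qed

sublocale g: csp_graph "nV n" b "nC n" "nm n" lit
proof
  have "0 < nY n" using bounds by (simp add: nY_def nV_def b_def[symmetric])
  then show "0 < nC n" by (simp add: nC_def)
  show "2 \<le> nm n" by (simp add: nm_def)
qed

lemma sizes:
  "g.Y = nY n" "g.W = nC n * nY n" "g.h = nh n" "g.k = nh n + nm n" "g.n = nh n + nm n + nC n + nV n"
  by (simp_all add: g.Y_def g.W_def g.h_def g.k_def g.n_def nY_def nh_def rep)

lemma tv_sizes:
  "tv tK x [] e = g.k" "tv tN x [] e = g.n"
  by (simp_all add: tK_def tN_def sizes rep)

lemma holds_tArc:
  "holds tArc x [] e \<longleftrightarrow> e 3 \<noteq> e 4 \<and> (g.hub (e 3) \<or> g.hub (e 4) \<or> g.arc0 (e 3) (e 4))"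
proof -
  have 1: "holds (TDisj [s, t, w]) x [] e \<longleftrightarrow> holds s x [] e \<or> holds t x [] e \<or> holds w x [] e" for s t w
    by simp
  show ?thesis
    unfolding tArc_def Let_def g.hub_def g.arc0_def
    by (simp add: holds_tLit tv_sizes sizes rep 1 del: holds_TDisj) (simp add: holds_tLit tv_sizes sizes rep)
qed

lemma tv_tTgt: "tv tTgt x [] e = g.tgt (e 3)"
  by (simp add: tTgt_def Let_def g.tgt_def tv_sizes sizes rep)

lemma concat_map_encode: "concat (map encode_nat (map f xs)) = concat (map (\<lambda>a. encode_nat (f a)) xs)"
  by (simp add: comp_def)

lemma red_prog_encodes: "pv red_prog x [] (\<lambda>_. 0) = encode_instance g.G g.S g.T"
proof -
  have arcs: "(i, j) \<in> parcs g.G \<longleftrightarrow> i \<noteq> j \<and> (g.hub i \<or> g.hub j \<or> g.arc0 i j)" if "i < g.n" "j < g.n" for i j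
    using that by (simp add: g.G_def)
  have mat: "concat (map (\<lambda>i. map (\<lambda>j. 0 < tv tArc x [] ((\<lambda>_. 0)(3 := i, 4 := j))) [0..<g.n]) [0..<g.n])
      = [(i, j) \<in> parcs g.G. i \<leftarrow> [0..<g.n], j \<leftarrow> [0..<g.n]]"
    by (intro arg_cong[where f = concat] map_cong refl)
      (simp add: holds_tArc[unfolded holds_def neq0_conv] arcs)
  show ?thesis
    unfolding encode_instance_def Let_def g.verts
    by (simp add: red_prog_def tv_sizes tv_tTgt g.S_def g.T_def concat_map_encode mat comp_def)
qed

text \<open>Membership only says that some feasible instance has this code. That an infeasible
  instance is mapped to a no-instance rests on the encoding being injective.\<close>

lemma encode_in_linkage_iff:
  assumes "encoded_instance G S T"
  shows "encode_instance G S T \<in> half_integral_linkage \<longleftrightarrow> half_integrally_feasible G S T"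
  using encode_instance_inject[OF assms] assms unfolding half_integral_linkage_def by blast

lemma red_prog_correct:
  assumes "\<And>u. length u \<le> pp \<Longrightarrow> \<exists>b. tm_outputs M [x, u] r [b]"
  shows "pv red_prog x [] (\<lambda>_. 0) \<in> half_integral_linkage \<longleftrightarrow>
    (\<exists>u. length u \<le> pp \<and> tm_outputs M [x, u] r [True])"
  using accept_iff_csp_sat[OF assms] g.sat_imp_feasible g.feasible_imp_sat
  unfolding red_prog_encodes encode_in_linkage_iff[OF g.instance_encoded] by blast

lemma red_prog_connected:
  assumes "\<epsilon> < 1" "\<epsilon> \<le> (1 - \<epsilon>) * real m0"
  shows "pv red_prog x [] (\<lambda>_. 0) \<in> strongly_connected_instances \<epsilon>"
proof -
  have "\<epsilon> * real (nh n) \<le> (1 - \<epsilon>) * real m0 * real (nh n)"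
    using assms(2) by (intro mult_right_mono) auto
  also have "\<dots> \<le> (1 - \<epsilon>) * real (nm n)"
    using assms(1) by (simp add: nm_def mult.assoc)
  finally have "\<epsilon> * real g.k \<le> real (nm n)" by (simp add: sizes algebra_simps)
  then show ?thesis
    unfolding red_prog_encodes strongly_connected_instances_def
    using g.instance_encoded g.connected[OF assms(1)] by blast
qed

end

theorem linkage_hard:
  assumes "\<epsilon> < 1" "A \<in> NP"
  shows "\<exists>f. polytime_computable f \<and>
    (\<forall>x. f x \<in> strongly_connected_instances \<epsilon> \<and> (x \<in> A \<longleftrightarrow> f x \<in> half_integral_linkage))"
proof -
  obtain M p q where M: "wf_tm M" "2 \<le> tm_tapes M"
    and total: "\<And>x u. length u \<le> poly p (length x) \<Longrightarrow> \<exists>b. tm_outputs M [x, u] (poly q (length x)) [b]"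
    and A: "\<And>x. x \<in> A \<longleftrightarrow> (\<exists>u. length u \<le> poly p (length x) \<and> tm_outputs M [x, u] (poly q (length x)) [True])"
    using assms(2) unfolding NP_def by blast
  obtain tR tP where t: "represents tR (poly q)" "represents tP (poly p)"
    using polyb_represents polyb_def by metis
  \<comment> \<open>The least natural number with
    \<open>\<epsilon> \<le> (1 - \<epsilon>) * m0\<close>; it is 0 if \<open>\<epsilon>\<close> is
    not positive.\<close>
  define m0 where "m0 = nat \<lceil>\<epsilon> / (1 - \<epsilon>)\<rceil>"
  have "\<epsilon> / (1 - \<epsilon>) \<le> real m0" unfolding m0_def by linarith
  then have m0: "\<epsilon> \<le> (1 - \<epsilon>) * real m0" using assms(1) by (simp add: field_simps)
  interpret reduction M "poly q" "poly p" tR tP m0 by unfold_locales (use M t in auto)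
  have "pv red_prog x [] (\<lambda>_. 0) \<in> strongly_connected_instances \<epsilon> \<and>
      (x \<in> A \<longleftrightarrow> pv red_prog x [] (\<lambda>_. 0) \<in> half_integral_linkage)" for x
  proof -
    interpret reduction_input M "poly q" "poly p" tR tP m0 x ..
    show ?thesis
      using red_prog_connected[OF assms(1) m0] red_prog_correct total A by (simp add: pp_def r_def n_def)
  qed
  then show ?thesis using polytime_computable_prog[OF wfp_red_prog] by blast
qed

text \<open>One reduction serves both parts, as all its outputs are highly connected; and the whole
  language is in \<open>NP\<close>, so it is itself the language that has to agree with it on the
  restricted inputs.\<close>

theorem theorem1p2:
  fixes \<epsilon> :: real
  assumes "\<epsilon> < 1"
  shows "NP_complete half_integral_linkage \<and>
    NP_complete_restricted (strongly_connected_instances \<epsilon>) half_integral_linkage"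
  unfolding NP_complete_def NP_complete_restricted_def
  using linkage_hard[OF assms] half_integral_linkage_NP by blast

end
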